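(* If $N=1$ or $N=2$, assume that $J$ is nonincreasing in the radial variable. Let $f\in L^1(\mathbb{R}^N)$, $f\ge0$ a.e., and let $u$ be the $L^1$-solution of the nonlocal Stefan problem $\partial_t u=J*v-v$, $v=(u-1)_+$, $u(\cdot,0)=f$. Let $\mathcal Pf$ be the projection of $f$ onto a nonlocal mesa. Then $u(\cdot,t)\to\mathcal Pf$ in $L^1(\mathbb{R}^N)$ as $t\to\infty$.
   Context: Standing assumptions: $J:\mathbb{R}^N\to[0,\infty)$ is continuous, compactly supported, radially symmetric, and $\int_{\mathbb{R}^N}J=1$. Here $*$ is convolution in space and $s_+=\max\{s,0\}$. $L^1_+(\mathbb{R}^N)$ is the set of a.e. nonnegative functions in $L^1(\mathbb{R}^N)$; $C_0(\mathbb{R}^N)$ is the set of continuous functions tending to $0$ at infinity. For $f\in L^1(\mathbb{R}^N)$, the $L^1$-solution is the unique $u\in C([0,\infty);L^1(\mathbb{R}^N))$ such that for every $t>0$, $u(t)=f+\int_0^t(J*v(s)-v(s))\,ds$ with $v=(u-1)_+$ a.e. Nonlocal obstacle problem (OP): given $f\in L^1_+(\mathbb{R}^N)$, find a nonnegative $w\in L^1(\mathbb{R}^N)$ such that $0\le f+J*w-w\le1$ and $(f+J*w-w-1)\,w=0$ a.e. Projection $\mathcal P$: Let $\mathcal S=L^1_+(\mathbb{R}^N)$ if $N\ge3$; if $N=1,2$, let $\mathcal S$ be the set of $f\in L^1_+(\mathbb{R}^N)$ such that $f\le g$ a.e. for some $g\in L^1_+(\mathbb{R}^N)\cap C_0(\mathbb{R}^N)$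 radial and strictly decreasing in the radial variable. For $f\in\mathcal S$, (OP) has a unique solution $w$ and $\mathcal Pf:=f+J*w-w$. The map $\mathcal P$ is an $L^1$-contraction on $\mathcal S$ (i.e. $\|\mathcal Pf_1-\mathcal Pf_2\|_{L^1}\le\|f_1-f_2\|_{L^1}$), and $\mathcal S$ is dense in $L^1_+(\mathbb{R}^N)$; $\mathcal P$ is extended by continuity to all of $L^1_+(\mathbb{R}^N)$, i.e. $\mathcal Pf=\lim_n\mathcal Pf_n$ in $L^1(\mathbb{R}^N)$ for any sequence $\{f_n\}\subset\mathcal S$ with $f_n\to f$ in $L^1(\mathbb{R}^N)$. *)

theory Defs
  imports "HOL-Analysis.Analysis"
begin

section \<open>The space of integrable functions modulo a.e. equality\<close>

text \<open>
  Borel representatives lose nothing: every Lebesgue-integrable function is a.e. equal to a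
  Borel-measurable one, so this quotient is also the one of the Lebesgue-integrable functions.
\<close>

definition L1_rel :: "('a::euclidean_space \<Rightarrow> real) \<Rightarrow> ('a \<Rightarrow> real) \<Rightarrow> bool" where
  "L1_rel f g \<longleftrightarrow>
     integrable lborel f \<and> integrable lborel g \<and> (AE x in lborel. f x = g x)"

quotient_type (overloaded) 'a L1 = "'a::euclidean_space \<Rightarrow> real" / partial: L1_rel
proof (rule part_equivpI)
  show "\<exists>f :: 'a \<Rightarrow> real. L1_rel f f"
    by (rule exI[of _ "\<lambda>_. 0"]) (simp add: L1_rel_def)
  show "symp (L1_rel :: ('a \<Rightarrow> real) \<Rightarrow> _)"
    by (rule sympI) (auto simp: L1_rel_def)
  show "transp (L1_rel :: ('a \<Rightarrow> real) \<Rightarrow> _)"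
    by (rule transpI) (auto simp: L1_rel_def)
qed

instantiation L1 :: (euclidean_space) real_normed_vector
begin

lift_definition zero_L1 :: "'a L1" is "\<lambda>_. 0"
  by (simp add: L1_rel_def)

lift_definition plus_L1 :: "'a L1 \<Rightarrow> 'a L1 \<Rightarrow> 'a L1" is "\<lambda>f g x. f x + g x"
  unfolding L1_rel_def by auto

lift_definition minus_L1 :: "'a L1 \<Rightarrow> 'a L1 \<Rightarrow> 'a L1" is "\<lambda>f g x. f x - g x"
  unfolding L1_rel_def by auto

lift_definition uminus_L1 :: "'a L1 \<Rightarrow> 'a L1" is "\<lambda>f x. - f x"
  unfolding L1_rel_def by auto

lift_definition scaleR_L1 :: "real \<Rightarrow> 'a L1 \<Rightarrow> 'a L1" is "\<lambda>c f x. c * f x"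
  unfolding L1_rel_def by auto

lift_definition norm_L1 :: "'a L1 \<Rightarrow> real" is "\<lambda>f. \<integral>x. \<bar>f x\<bar> \<partial>lborel"
  unfolding L1_rel_def by (intro integral_cong_AE) auto

definition sgn_L1 :: "'a L1 \<Rightarrow> 'a L1" where
  "sgn_L1 f = scaleR (inverse (norm f)) f"

definition dist_L1 :: "'a L1 \<Rightarrow> 'a L1 \<Rightarrow> real" where
  "dist_L1 f g = norm (f - g)"

definition uniformity_L1 :: "('a L1 \<times> 'a L1) filter" where
  "uniformity_L1 = (INF e\<in>{0<..}. principal {(f, g). dist f g < e})"

definition open_L1 :: "'a L1 set \<Rightarrow> bool" where
  "open_L1 U \<longleftrightarrow> (\<forall>f\<in>U. \<forall>\<^sub>F (f', g) in uniformity. f' = f \<longrightarrow> g \<in> U)"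

instance
proof
  fix f g h :: "'a L1" and a b :: real
  show "f + g + h = f + (g + h)"
    by transfer (auto simp: L1_rel_def algebra_simps)
  show "f + g = g + f"
    by transfer (auto simp: L1_rel_def algebra_simps)
  show "0 + f = f"
    by transfer (auto simp: L1_rel_def)
  show "- f + f = 0"
    by transfer (auto simp: L1_rel_def)
  show "f - g = f + - g"
    by transfer (auto simp: L1_rel_def)
  show "a *\<^sub>R (f + g) = a *\<^sub>R f + a *\<^sub>R g"
    by transfer (auto simp: L1_rel_def algebra_simps)
  show "(a + b) *\<^sub>R f = a *\<^sub>R f + b *\<^sub>R f"
    by transfer (auto simp: L1_rel_def algebra_simps)
  show "a *\<^sub>R b *\<^sub>R f = (a * b) *\<^sub>R f"
    by transfer (auto simp: L1_rel_def algebra_simps)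
  show "1 *\<^sub>R f = f"
    by transfer (auto simp: L1_rel_def)
  show "sgn f = inverse (norm f) *\<^sub>R f"
    by (rule sgn_L1_def)
  show "dist f g = norm (f - g)"
    by (rule dist_L1_def)
  show "(uniformity :: ('a L1 \<times> 'a L1) filter) =
      (INF e\<in>{0<..}. principal {(f, g). dist f g < e})"
    by (rule uniformity_L1_def)
  show "open U \<longleftrightarrow> (\<forall>f\<in>U. \<forall>\<^sub>F (f', g) in uniformity. f' = f \<longrightarrow> g \<in> U)"
    for U :: "'a L1 set"
    by (rule open_L1_def)
  show "norm f = 0 \<longleftrightarrow> f = 0"
  proof transfer
    fix f :: "'a \<Rightarrow> real"
    assume "L1_rel f f"
    then have "integrable lborel f"
      by (simp add: L1_rel_def)
    then show "(\<integral>x. \<bar>f x\<bar> \<partial>lborel) = 0 \<longleftrightarrow> L1_rel f (\<lambda>_. 0)"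
      using integral_nonneg_eq_0_iff_AE[of lborel "\<lambda>x. \<bar>f x\<bar>"] by (simp add: L1_rel_def)
  qed
  show "norm (f + g) \<le> norm f + norm g"
  proof transfer
    fix f g :: "'a \<Rightarrow> real"
    assume "L1_rel f f" "L1_rel g g"
    then have fg: "integrable lborel f" "integrable lborel g"
      by (simp_all add: L1_rel_def)
    have "(\<integral>x. \<bar>f x + g x\<bar> \<partial>lborel) \<le> (\<integral>x. \<bar>f x\<bar> + \<bar>g x\<bar> \<partial>lborel)"
      using fg by (intro integral_mono) auto
    also have "\<dots> = (\<integral>x. \<bar>f x\<bar> \<partial>lborel) + (\<integral>x. \<bar>g x\<bar> \<partial>lborel)"
      using fg by (intro Bochner_Integration.integral_add) auto
    finally show "(\<integral>x. \<bar>f x + g x\<bar> \<partial>lborel) \<le>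
        (\<integral>x. \<bar>f x\<bar> \<partial>lborel) + (\<integral>x. \<bar>g x\<bar> \<partial>lborel)" .
  qed
  show "norm (a *\<^sub>R f) = \<bar>a\<bar> * norm f"
    by transfer (simp add: abs_mult)
qed

end

definition L1_nonneg :: "'a::euclidean_space L1 \<Rightarrow> bool" where
  "L1_nonneg f \<longleftrightarrow> (AE x in lborel. 0 \<le> rep_L1 f x)"

lift_definition excess :: "'a::euclidean_space L1 \<Rightarrow> 'a L1" is
  "\<lambda>u x. max (u x - 1) 0"
proof -
  have *: "integrable lborel (\<lambda>x. max (u x - 1) 0)"
    if "integrable lborel u" for u :: "'a \<Rightarrow> real"
  proof (rule Bochner_Integration.integrable_bound[OF that])
    show "(\<lambda>x. max (u x - 1) 0) \<in> borel_measurable lborel"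
      using borel_measurable_integrable[OF that] by simp
  qed (simp add: max_def)
  show "L1_rel (\<lambda>x. max (u x - 1) 0) (\<lambda>x. max (u' x - 1) 0)"
    if "L1_rel u u'" for u u' :: "'a \<Rightarrow> real"
  proof -
    have "AE x in lborel. u x = u' x"
      using that by (simp add: L1_rel_def)
    then have "AE x in lborel. max (u x - 1) 0 = max (u' x - 1) 0"
      by eventually_elim simp
    with that * show ?thesis
      unfolding L1_rel_def by blast
  qed
qed

lemma integrable_convolution:
  fixes J v :: "'a::euclidean_space \<Rightarrow> real"
  assumes J: "integrable lborel J" and v: "integrable lborel v"
  shows "integrable lborel (\<lambda>x. \<integral>y. J (x - y) * v y \<partial>lborel)"
proof -
  have [measurable]: "J \<in> borel_measurable borel" "v \<in> borel_measurable borel"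
    using J v by (auto dest: borel_measurable_integrable)
  have translate: "distr lborel borel (\<lambda>x. x - y) = (lborel :: 'a measure)" for y
  proof -
    have "(\<lambda>x. x - y) = (+) (- y)"
      by auto
    then show ?thesis
      by (simp only: lborel_distr_plus)
  qed
  have shift: "integrable lborel (\<lambda>x. J (x - y))" for y
    using J integrable_distr_eq[of "\<lambda>x. x - y" lborel borel J]
    by (simp add: translate)
  have shift_norm: "(\<integral>x. \<bar>J (x - y)\<bar> \<partial>lborel) = (\<integral>x. \<bar>J x\<bar> \<partial>lborel)" for y
    using integral_distr[of "\<lambda>x. x - y" lborel borel "\<lambda>x. \<bar>J x\<bar>"]
    by (simp add: translate)
  have "integrable (lborel \<Otimes>\<^sub>M lborel) (\<lambda>(y, x). J (x - y) * v y)"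
  proof (rule lborel_pair.Fubini_integrable)
    show "(\<lambda>(y, x). J (x - y) * v y) \<in> borel_measurable (lborel \<Otimes>\<^sub>M lborel)"
      by measurable
    have "(\<lambda>y. \<integral>x. norm (case (y, x) of (y, x) \<Rightarrow> J (x - y) * v y) \<partial>lborel) =
        (\<lambda>y. (\<integral>x. \<bar>J x\<bar> \<partial>lborel) * \<bar>v y\<bar>)"
      by (simp add: abs_mult shift_norm)
    then show "integrable lborel
        (\<lambda>y. \<integral>x. norm (case (y, x) of (y, x) \<Rightarrow> J (x - y) * v y) \<partial>lborel)"
      using v by simp
    show "AE y in lborel. integrable lborel (\<lambda>x. case (y, x) of (y, x) \<Rightarrow> J (x - y) * v y)"
      using shift by simp
  qed
  from lborel_pair.integrable_fst'[OF lborel_pair.integrable_product_swap[OF this]]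
  show ?thesis
    by simp
qed

text \<open>The convolution with a kernel that is not integrable is given the junk value 0.\<close>

lift_definition L1_conv :: "('a::euclidean_space \<Rightarrow> real) \<Rightarrow> 'a L1 \<Rightarrow> 'a L1" is
  "\<lambda>J v x. if integrable lborel J then \<integral>y. J (x - y) * v y \<partial>lborel else 0"
proof -
  fix J v w :: "'a \<Rightarrow> real"
  assume vw: "L1_rel v w"
  show "L1_rel (\<lambda>x. if integrable lborel J then \<integral>y. J (x - y) * v y \<partial>lborel else 0)
      (\<lambda>x. if integrable lborel J then \<integral>y. J (x - y) * w y \<partial>lborel else 0)"
  proof (cases "integrable lborel J")
    case True
    then have [measurable]: "J \<in> borel_measurable borel"
      by (auto dest: borel_measurable_integrable)
    have [measurable]: "v \<in> borel_measurable borel" "w \<in> borel_measurable borel"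
      using vw by (auto simp: L1_rel_def dest: borel_measurable_integrable)
    have "(\<integral>y. J (x - y) * v y \<partial>lborel) = (\<integral>y. J (x - y) * w y \<partial>lborel)" for x
      by (rule integral_cong_AE) (use vw in \<open>auto simp: L1_rel_def\<close>)
    then show ?thesis
      using True vw integrable_convolution[of J] by (simp add: L1_rel_def)
  qed (simp add: L1_rel_def)
qed


section \<open>The nonlocal Stefan problem\<close>

definition admissible_kernel :: "('a::euclidean_space \<Rightarrow> real) \<Rightarrow> bool" where
  "admissible_kernel J \<longleftrightarrow>
     (\<forall>x. 0 \<le> J x) \<and>
     continuous_on UNIV J \<and>
     compact (closure {x. J x \<noteq> 0}) \<and>
     (\<forall>x y. norm x = norm y \<longrightarrow> J x = J y) \<and>
     (\<integral>x. J x \<partial>lborel) = 1"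

definition radially_nonincreasing :: "('a::euclidean_space \<Rightarrow> real) \<Rightarrow> bool" where
  "radially_nonincreasing J \<longleftrightarrow> (\<forall>x y. norm x \<le> norm y \<longrightarrow> J y \<le> J x)"

text \<open>The time integral is the integral of a function with values in \<^typ>\<open>'a L1\<close>.\<close>

definition L1_solution ::
    "('a::euclidean_space \<Rightarrow> real) \<Rightarrow> 'a L1 \<Rightarrow> (real \<Rightarrow> 'a L1) \<Rightarrow> bool" where
  "L1_solution J f u \<longleftrightarrow>
     continuous_on {0..} u \<and>
     (\<forall>t>0. (\<lambda>s. L1_conv J (excess (u s)) - excess (u s)) integrable_on {0..t} \<and>
        u t = f + integral {0..t} (\<lambda>s. L1_conv J (excess (u s)) - excess (u s)))"


section \<open>The nonlocal obstacle problem and the projection\<close>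

definition solves_OP :: "('a::euclidean_space \<Rightarrow> real) \<Rightarrow> 'a L1 \<Rightarrow> 'a L1 \<Rightarrow> bool" where
  "solves_OP J f w \<longleftrightarrow>
     L1_nonneg w \<and>
     (AE x in lborel. 0 \<le> rep_L1 (f + L1_conv J w - w) x \<and>
        rep_L1 (f + L1_conv J w - w) x \<le> 1) \<and>
     (AE x in lborel. (rep_L1 (f + L1_conv J w - w) x - 1) * rep_L1 w x = 0)"

definition radial_barrier :: "('a::euclidean_space \<Rightarrow> real) \<Rightarrow> bool" where
  "radial_barrier g \<longleftrightarrow>
     integrable lborel g \<and> (\<forall>x. 0 \<le> g x) \<and>
     continuous_on UNIV g \<and> (g \<longlongrightarrow> 0) at_infinity \<and>
     (\<forall>x y. norm x = norm y \<longrightarrow> g x = g y) \<and>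
     (\<forall>x y. norm x < norm y \<longrightarrow> g y < g x)"

definition OP_data :: "'a::euclidean_space L1 set" where
  "OP_data =
     {f. L1_nonneg f \<and>
        (DIM('a) \<le> 2 \<longrightarrow>
          (\<exists>g. radial_barrier g \<and> (AE x in lborel. rep_L1 f x \<le> g x)))}"

definition OP_proj :: "('a::euclidean_space \<Rightarrow> real) \<Rightarrow> 'a L1 \<Rightarrow> 'a L1" where
  "OP_proj J f = (let w = (THE w. solves_OP J f w) in f + L1_conv J w - w)"

text \<open>The extension of \<^term>\<open>OP_proj J\<close> by continuity from \<^term>\<open>OP_data\<close> to all nonnegative data.\<close>

definition mesa_proj :: "('a::euclidean_space \<Rightarrow> real) \<Rightarrow> 'a L1 \<Rightarrow> 'a L1" where
  "mesa_proj J f =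
     (THE p. \<forall>F :: nat \<Rightarrow> 'a L1. (\<forall>n. F n \<in> OP_data) \<and> F \<longlonglongrightarrow> f \<longrightarrow>
        (\<lambda>n. OP_proj J (F n)) \<longlonglongrightarrow> p)"

end

theory Submission
  imports Defs "HOL-Probability.Distributions"
begin

text \<open>
  Write \<open>A v = J * v - v\<close> and \<open>w(t) = \<integral>\<^sub>0\<^sup>t (u - 1)\<^sub>+\<close>, so that \<open>u(t) = f + A w(t)\<close> with \<open>w\<close> nondecreasing in
  time and \<open>u(t) \<ge> 1\<close> wherever \<open>w(t) > 0\<close>. If \<open>W\<close> solves the obstacle problem for \<open>F\<close> and
  \<open>q = F + A W\<close>, then integrating \<open>q - u(t) = F - f + A (W - w(t))\<close> over \<open>{q > u(t)} \<union> {W > w(t)}\<close>, on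
  which \<open>A (W - w(t))\<close> has nonpositive integral, bounds \<open>\<parallel>u(t) - q\<parallel>\<close> by \<open>\<parallel>f - F\<parallel>\<close> plus a multiple of the
  integral of \<open>(u - 1)\<^sub>+\<close> over \<open>{w(t) < W}\<close>. The latter is the rate of growth of \<open>\<integral> min (w(t), W)\<close>, which
  stays below \<open>\<integral> W\<close>; hence \<open>limsup \<parallel>u(t) - q\<parallel> \<le> \<parallel>f - F\<parallel>\<close>. This comparison with a single solution \<open>u\<close> also
  shows that \<open>F \<mapsto> F + A W\<close> extends continuously to \<open>f\<close>, and the theorem follows by density.

  The obstacle problem is solved by the monotone iteration
  \<open>W\<^sub>k\<^sub>+\<^sub>1 = W\<^sub>k + (F + A W\<^sub>k - 1)\<^sub>+\<close> once it is bounded in \<open>L\<^sup>1\<close>: for data below a barrier vanishing at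
  infinity by an explicit supersolution with compact support, in dimension at least three by
  testing with a bounded strictly superharmonic function. A difference of two solutions
  lies in the kernel of \<open>A\<close>, which is trivial on \<open>L\<^sup>1\<close> because \<open>\<integral> J(z) cos (\<xi> \<bullet> z) dz < 1\<close> for small \<open>\<xi> \<noteq> 0\<close>.
\<close>

section \<open>The Banach lattice of integrable functions\<close>

lemma L1_rel_rep: "L1_rel (rep_L1 f) (rep_L1 f)"
  by (rule Quotient3_rep_reflp[OF Quotient3_L1])

lemma integrable_rep_L1 [simp, intro]: "integrable lborel (rep_L1 f)"
  using L1_rel_rep[of f] by (simp add: L1_rel_def)

lemma borel_measurable_rep_L1 [measurable, simp]: "rep_L1 f \<in> borel_measurable borel"
  using borel_measurable_integrable[OF integrable_rep_L1] by simp

lemma AE_rep_abs_L1: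
  assumes "integrable lborel g"
  shows "AE x in lborel. rep_L1 (abs_L1 g) x = g x"
proof -
  have "L1_rel g g" using assms by (simp add: L1_rel_def)
  then have "L1_rel (rep_L1 (abs_L1 g)) g"
    by (rule rep_abs_rsp_left[OF Quotient3_L1])
  then show ?thesis by (simp add: L1_rel_def)
qed

lemma L1_eqI:
  assumes "AE x in lborel. rep_L1 f x = rep_L1 g x"
  shows "f = g"
  using assms Quotient3_rel_rep[OF Quotient3_L1, of f g] by (simp add: L1_rel_def)

lemma AE_rep_zero: "AE x in lborel. rep_L1 0 x = 0"
  unfolding zero_L1_def by (rule AE_rep_abs_L1) simp

lemma AE_rep_plus: "AE x in lborel. rep_L1 (f + g) x = rep_L1 f x + rep_L1 g x"
  unfolding plus_L1_def map_fun_def comp_def id_def by (rule AE_rep_abs_L1) simp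

lemma AE_rep_minus: "AE x in lborel. rep_L1 (f - g) x = rep_L1 f x - rep_L1 g x"
  unfolding minus_L1_def map_fun_def comp_def id_def by (rule AE_rep_abs_L1) simp

lemma AE_rep_uminus: "AE x in lborel. rep_L1 (- f) x = - rep_L1 f x"
  unfolding uminus_L1_def map_fun_def comp_def id_def by (rule AE_rep_abs_L1) simp

lemma AE_rep_scaleR: "AE x in lborel. rep_L1 (c *\<^sub>R f) x = c * rep_L1 f x"
  unfolding scaleR_L1_def map_fun_def comp_def id_def by (rule AE_rep_abs_L1) simp

lemma integrable_excess: "integrable lborel (\<lambda>x. max (rep_L1 u x - 1) 0)"
  by (rule Bochner_Integration.integrable_bound[OF integrable_rep_L1[of u]]) (auto simp: max_def)

lemma AE_rep_excess: "AE x in lborel. rep_L1 (excess u) x = max (rep_L1 u x - 1) 0"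
  unfolding excess_def map_fun_def comp_def id_def by (rule AE_rep_abs_L1) (rule integrable_excess)

lemma AE_rep_conv:
  assumes "integrable lborel J"
  shows "AE x in lborel. rep_L1 (L1_conv J v) x = (\<integral>y. J (x - y) * rep_L1 v y \<partial>lborel)"
proof -
  have "AE x in lborel. rep_L1 (L1_conv J v) x =
     (if integrable lborel J then \<integral>y. J (x - y) * rep_L1 v y \<partial>lborel else 0)"
    unfolding L1_conv_def map_fun_def comp_def id_def
    by (rule AE_rep_abs_L1) (use integrable_convolution[OF assms] assms in simp)
  then show ?thesis using assms by simp
qed

lemma norm_L1_eq: "norm f = (\<integral>x. \<bar>rep_L1 f x\<bar> \<partial>lborel)"
  unfolding norm_L1_def by simp

definition L1_int :: "'a::euclidean_space L1 \<Rightarrow> real" where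
  "L1_int f = (\<integral>x. rep_L1 f x \<partial>lborel)"

lemma L1_int_plus: "L1_int (f + g) = L1_int f + L1_int g"
proof -
  have "L1_int (f + g) = (\<integral>x. rep_L1 f x + rep_L1 g x \<partial>lborel)"
    unfolding L1_int_def by (intro integral_cong_AE AE_rep_plus) auto
  then show ?thesis by (simp add: L1_int_def)
qed

lemma L1_int_scaleR: "L1_int (c *\<^sub>R f) = c * L1_int f"
proof -
  have "L1_int (c *\<^sub>R f) = (\<integral>x. c * rep_L1 f x \<partial>lborel)"
    unfolding L1_int_def by (intro integral_cong_AE AE_rep_scaleR) auto
  then show ?thesis by (simp add: L1_int_def)
qed

lemma abs_L1_int_le: "\<bar>L1_int f\<bar> \<le> norm f"
  unfolding L1_int_def norm_L1_eq by (rule integral_abs_bound)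

lemma bounded_linear_L1_int: "bounded_linear L1_int"
  by (rule bounded_linear_intro[where K = 1])
     (auto simp: L1_int_plus L1_int_scaleR abs_L1_int_le)

lemma L1_int_diff: "L1_int (f - g) = L1_int f - L1_int g"
  by (rule linear_diff[OF bounded_linear.linear[OF bounded_linear_L1_int]])

section \<open>Almost everywhere order, the positive cone and positive parts\<close>

instantiation L1 :: (euclidean_space) ordered_real_vector
begin

definition less_eq_L1 :: "'a L1 \<Rightarrow> 'a L1 \<Rightarrow> bool" where
  "f \<le> g \<longleftrightarrow> (AE x in lborel. rep_L1 f x \<le> rep_L1 g x)"

definition less_L1 :: "'a L1 \<Rightarrow> 'a L1 \<Rightarrow> bool" where
  "(f :: 'a L1) < g \<longleftrightarrow> f \<le> g \<and> \<not> g \<le> f"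

instance
proof
  fix f g h :: "'a L1" and a b :: real
  show "f < g \<longleftrightarrow> f \<le> g \<and> \<not> g \<le> f" by (rule less_L1_def)
  show "f \<le> f" by (simp add: less_eq_L1_def)
  show "f \<le> h" if "f \<le> g" "g \<le> h"
    using that unfolding less_eq_L1_def by eventually_elim simp
  show "f = g" if "f \<le> g" "g \<le> f"
  proof (rule L1_eqI)
    show "AE x in lborel. rep_L1 f x = rep_L1 g x"
      using that unfolding less_eq_L1_def by eventually_elim simp
  qed
  show "h + f \<le> h + g" if "f \<le> g"
    using that AE_rep_plus[of h f] AE_rep_plus[of h g] unfolding less_eq_L1_def
    by eventually_elim simp
  show "a *\<^sub>R f \<le> a *\<^sub>R g" if "f \<le> g" "0 \<le> a"
    using that(1) AE_rep_scaleR[of a f] AE_rep_scaleR[of a g] unfolding less_eq_L1_def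
    by eventually_elim (simp add: mult_left_mono that)
  show "a *\<^sub>R f \<le> b *\<^sub>R f" if "a \<le> b" "0 \<le> f"
    using that(2) AE_rep_zero AE_rep_scaleR[of a f] AE_rep_scaleR[of b f] unfolding less_eq_L1_def
    by eventually_elim (simp add: mult_right_mono that)
qed

end

lemma L1_nonneg_iff: "L1_nonneg f \<longleftrightarrow> 0 \<le> f"
proof
  show "0 \<le> f" if "L1_nonneg f"
    using AE_rep_zero that unfolding L1_nonneg_def less_eq_L1_def by eventually_elim simp
  show "L1_nonneg f" if "0 \<le> f"
    using AE_rep_zero that unfolding L1_nonneg_def less_eq_L1_def by eventually_elim simp
qed

lemma AE_nonneg_L1: "0 \<le> f \<Longrightarrow> AE x in lborel. 0 \<le> rep_L1 f x"
  using L1_nonneg_iff[of f] by (simp add: L1_nonneg_def)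

lemma nonneg_L1_I: "AE x in lborel. 0 \<le> rep_L1 f x \<Longrightarrow> 0 \<le> f"
  using L1_nonneg_iff[of f] by (simp add: L1_nonneg_def)

lemma L1_int_mono: "f \<le> g \<Longrightarrow> L1_int f \<le> L1_int g"
  unfolding L1_int_def less_eq_L1_def by (rule integral_mono_AE) auto

lemma norm_eq_L1_int: "0 \<le> f \<Longrightarrow> norm f = L1_int f"
  unfolding norm_L1_eq L1_int_def
  by (intro integral_cong_AE) (auto dest!: AE_nonneg_L1)

text \<open>The function \<open>|f| - f\<close> is nonnegative with integral
  \<open>norm f - L1_int f\<close>, so it vanishes almost everywhere as soon as that number does.
  The criterion compares two continuous functions of \<open>f\<close>, which makes the positive cone
  closed.\<close>

lemma nonneg_L1_iff: "0 \<le> f \<longleftrightarrow> norm f \<le> L1_int f"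
proof
  show "norm f \<le> L1_int f" if "0 \<le> f" using norm_eq_L1_int[OF that] by simp
  assume le: "norm f \<le> L1_int f"
  have i: "integrable lborel (\<lambda>x. \<bar>rep_L1 f x\<bar> - rep_L1 f x)" by simp
  have "(\<integral>x. \<bar>rep_L1 f x\<bar> - rep_L1 f x \<partial>lborel) = norm f - L1_int f"
    by (simp add: norm_L1_eq L1_int_def)
  also have "\<dots> = 0" using le abs_L1_int_le[of f] by linarith
  finally have "AE x in lborel. \<bar>rep_L1 f x\<bar> - rep_L1 f x = 0"
    by (subst (asm) integral_nonneg_eq_0_iff_AE[OF i]) auto
  then have "AE x in lborel. 0 \<le> rep_L1 f x" by eventually_elim linarith
  then show "0 \<le> f" by (rule nonneg_L1_I)
qed

lemma L1_eq_zeroI: "0 \<le> f \<Longrightarrow> L1_int f \<le> 0 \<Longrightarrow> f = 0"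
  using norm_eq_L1_int[of f] norm_le_zero_iff[of f] by simp

lemma closed_nonneg_L1: "closed {f :: 'a::euclidean_space L1. 0 \<le> f}"
  unfolding nonneg_L1_iff
  by (intro closed_Collect_le continuous_intros
       linear_continuous_on[OF bounded_linear_L1_int])

lemma nonneg_L1_LIMSEQ:
  fixes f :: "nat \<Rightarrow> 'a::euclidean_space L1"
  assumes "f \<longlonglongrightarrow> l" "eventually (\<lambda>n. 0 \<le> f n) sequentially"
  shows "0 \<le> l"
  using Lim_in_closed_set[OF closed_nonneg_L1 _ _ assms(1)] assms(2) by simp

definition pos_part :: "'a::euclidean_space L1 \<Rightarrow> 'a L1" where
  "pos_part f = abs_L1 (\<lambda>x. max (rep_L1 f x) 0)"

lemma AE_rep_pos_part: "AE x in lborel. rep_L1 (pos_part f) x = max (rep_L1 f x) 0"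
  unfolding pos_part_def by (rule AE_rep_abs_L1) simp

lemma norm_le_L1: 
  assumes "AE x in lborel. \<bar>rep_L1 f x\<bar> \<le> \<bar>rep_L1 g x\<bar>"
  shows "norm f \<le> norm g"
  unfolding norm_L1_eq using assms by (intro integral_mono_AE) auto

lemma norm_pos_part_diff_le: "norm (pos_part f - pos_part g) \<le> norm (f - g)"
proof (rule norm_le_L1)
  show "AE x in lborel. \<bar>rep_L1 (pos_part f - pos_part g) x\<bar> \<le> \<bar>rep_L1 (f - g) x\<bar>"
    using AE_rep_pos_part[of f] AE_rep_pos_part[of g] AE_rep_minus[of f g]
      AE_rep_minus[of "pos_part f" "pos_part g"]
    by eventually_elim (auto simp: max_def)
qed

lemma norm_excess_diff_le: "norm (excess f - excess g) \<le> norm (f - g)"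
proof (rule norm_le_L1)
  show "AE x in lborel. \<bar>rep_L1 (excess f - excess g) x\<bar> \<le> \<bar>rep_L1 (f - g) x\<bar>"
    using AE_rep_excess[of f] AE_rep_excess[of g] AE_rep_minus[of f g]
      AE_rep_minus[of "excess f" "excess g"]
    by eventually_elim (auto simp: max_def)
qed

lemma continuous_on_nonexpansive:
  fixes F :: "'b::real_normed_vector \<Rightarrow> 'c::real_normed_vector"
  assumes "\<And>x y. norm (F x - F y) \<le> norm (x - y)"
  shows "continuous_on S F"
  unfolding continuous_on_iff dist_norm
proof (intro ballI allI impI)
  show "\<exists>d>0. \<forall>x'\<in>S. norm (x' - x) < d \<longrightarrow> norm (F x' - F x) < e" if "0 < e" for x e
    using that assms by (intro exI[of _ e]) (auto intro: order.strict_trans1)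
qed

lemma continuous_on_pos_part [continuous_intros]:
  "continuous_on S f \<Longrightarrow> continuous_on S (\<lambda>x. pos_part (f x))"
  by (rule continuous_on_compose2[OF continuous_on_nonexpansive[OF norm_pos_part_diff_le, of UNIV]]) auto

lemma continuous_on_excess [continuous_intros]:
  "continuous_on S f \<Longrightarrow> continuous_on S (\<lambda>x. excess (f x))"
  by (rule continuous_on_compose2[OF continuous_on_nonexpansive[OF norm_excess_diff_le, of UNIV]]) auto

lemma pos_part_nonneg: "0 \<le> pos_part f"
proof (rule nonneg_L1_I)
  show "AE x in lborel. 0 \<le> rep_L1 (pos_part f) x"
    using AE_rep_pos_part[of f] by eventually_elim simp
qed

lemma excess_nonneg: "0 \<le> excess f"
proof (rule nonneg_L1_I)
  show "AE x in lborel. 0 \<le> rep_L1 (excess f) x"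
    using AE_rep_excess[of f] by eventually_elim simp
qed

lemma pos_part_minus: "pos_part f - pos_part (- f) = f"
proof (rule L1_eqI)
  show "AE x in lborel. rep_L1 (pos_part f - pos_part (- f)) x = rep_L1 f x"
    using AE_rep_pos_part[of f] AE_rep_pos_part[of "- f"] AE_rep_uminus[of f]
      AE_rep_minus[of "pos_part f" "pos_part (- f)"]
    by eventually_elim auto
qed

lemma pos_part_eq_zero: "pos_part f = 0 \<Longrightarrow> f \<le> 0"
proof -
  assume "pos_part f = 0"
  then have "AE x in lborel. rep_L1 0 x = max (rep_L1 f x) 0"
    using AE_rep_pos_part[of f] by simp
  then show "f \<le> 0"
    using AE_rep_zero unfolding less_eq_L1_def
    by eventually_elim (auto simp: max_def split: if_splits)
qed

text \<open>Pointwise, \<open>|s| = 2 * max s 0 - s\<close>. Once the integral of \<open>f\<close>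
  is known, only its positive part has to be estimated.\<close>

lemma norm_eq_pos_part: "norm f = 2 * norm (pos_part f) - L1_int f"
proof -
  have "norm f = (\<integral>x. 2 * rep_L1 (pos_part f) x - rep_L1 f x \<partial>lborel)"
    unfolding norm_L1_eq
    by (intro integral_cong_AE) (use AE_rep_pos_part[of f] in \<open>auto simp: max_def abs_if\<close>)
  also have "\<dots> = 2 * L1_int (pos_part f) - L1_int f"
    by (simp add: L1_int_def)
  finally show ?thesis by (simp add: norm_eq_L1_int pos_part_nonneg)
qed

lemma norm_mono_L1:
  fixes f :: "'a::euclidean_space L1"
  shows "0 \<le> f \<Longrightarrow> f \<le> g \<Longrightarrow> norm f \<le> norm g"
proof -
  assume *: "0 \<le> f" "f \<le> g"
  then have "0 \<le> g" by (rule order.trans)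
  with * show "norm f \<le> norm g" by (simp add: norm_eq_L1_int L1_int_mono)
qed

section \<open>Completeness and monotone convergence\<close>

instance L1 :: (euclidean_space) banach
proof
  fix X :: "nat \<Rightarrow> 'a L1"
  assume C: "Cauchy X"
  \<comment> \<open>Riesz-Fischer: along a subsequence with increments below
    \<open>(1/2) ^ n\<close> the telescoping series converges absolutely almost everywhere, and its
    sum \<open>D\<close> supplies the limit.\<close>
  obtain r where r: "strict_mono r" and
    rn: "\<And>n. norm (X (r (Suc n)) - X (r n)) < (1/2) ^ n"
  proof -
    have ex: "\<exists>N. \<forall>m\<ge>N. \<forall>n\<ge>N. norm (X m - X n) < (1/2) ^ k" for k :: nat
      using C unfolding Cauchy_iff by (metis zero_less_power half_gt_zero zero_less_one)
    then obtain N where N: "\<And>k m n. m \<ge> N k \<Longrightarrow> n \<ge> N k \<Longrightarrow> norm (X m - X n) < (1/2) ^ k"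
      by metis
    define r where "r = rec_nat (N 0) (\<lambda>k m. max (Suc m) (N (Suc k)))"
    have r0: "r k \<ge> N k" for k by (cases k) (auto simp: r_def)
    have rS: "r (Suc k) > r k" for k by (auto simp: r_def less_max_iff_disj)
    show ?thesis
    proof
      show "strict_mono r" using rS by (simp add: strict_mono_Suc_iff)
      show "norm (X (r (Suc n)) - X (r n)) < (1/2) ^ n" for n
        using N[of n "r (Suc n)" "r n"] r0[of n] rS[of n] by simp
    qed
  qed
  define d where "d n = rep_L1 (X (r (Suc n)) - X (r n))" for n
  have nd: "(\<integral>x. norm (d n x) \<partial>lborel) = norm (X (r (Suc n)) - X (r n))" for n
    by (simp add: d_def norm_L1_eq)
  have di [simp]: "integrable lborel (d n)" for n by (simp add: d_def)
  have sn: "summable (\<lambda>n. \<integral>x. norm (d n x) \<partial>lborel)"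
  proof (rule summable_comparison_test'[where g = "\<lambda>n. (1/2) ^ n" and N = 0])
    show "norm (\<integral>x. norm (d n x) \<partial>lborel) \<le> (1/2) ^ n" for n
      unfolding nd using rn[of n] by simp
  qed (simp add: summable_geometric)
  have ae: "AE x in lborel. summable (\<lambda>n. norm (d n x))"
  proof -
    have "(\<integral>\<^sup>+x. (\<Sum>n. ennreal (norm (d n x))) \<partial>lborel) = (\<Sum>n. \<integral>\<^sup>+x. ennreal (norm (d n x)) \<partial>lborel)"
      by (rule nn_integral_suminf) (auto simp: d_def)
    also have "\<dots> = (\<Sum>n. ennreal (\<integral>x. norm (d n x) \<partial>lborel))"
      by (simp add: nn_integral_eq_integral)
    also have "\<dots> \<noteq> \<infinity>"
      unfolding infinity_ennreal_def
      by (rule ennreal_suminf_neq_top[OF sn]) (rule Bochner_Integration.integral_nonneg, rule norm_ge_zero)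
    finally have "(\<integral>\<^sup>+x. (\<Sum>n. ennreal (norm (d n x))) \<partial>lborel) \<noteq> \<infinity>" .
    then have "AE x in lborel. (\<Sum>n. ennreal (norm (d n x))) \<noteq> \<infinity>"
      by (intro nn_integral_PInf_AE) (auto simp: d_def)
    then show ?thesis
      by eventually_elim (auto intro!: summable_suminf_not_top)
  qed
  define D where "D x = (\<Sum>n. d n x)" for x
  have D: "integrable lborel D" unfolding D_def
    by (rule integrable_suminf[OF di ae sn])
  \<comment> \<open>By telescoping, the distance to the candidate limit is the norm of a tail of the
    series, at most the geometric tail from index \<open>k\<close> on.\<close>
  have tail: "norm (X (r k) - (X (r 0) + abs_L1 D)) \<le> (1/2) ^ k * 2" for k
  proof -
    have part: "AE x in lborel. rep_L1 (X (r k)) x - rep_L1 (X (r 0)) x = (\<Sum>n<k. d n x)"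
    proof (induction k)
      case (Suc k)
      then show ?case using AE_rep_minus[of "X (r (Suc k))" "X (r k)"]
        unfolding d_def by eventually_elim simp
    qed simp
    have sk: "summable (\<lambda>n. \<integral>x. norm (d (n + k) x) \<partial>lborel)"
      using sn by (subst summable_iff_shift[of _ k])
    have aek: "AE x in lborel. summable (\<lambda>n. norm (d (n + k) x))"
      using ae by eventually_elim (subst summable_iff_shift[of _ k])
    have "norm (X (r k) - (X (r 0) + abs_L1 D)) = (\<integral>x. norm (\<Sum>n. d (n + k) x) \<partial>lborel)"
      unfolding norm_L1_eq
    proof (rule integral_cong_AE)
      show "AE x in lborel. \<bar>rep_L1 (X (r k) - (X (r 0) + abs_L1 D)) x\<bar> = norm (\<Sum>n. d (n + k) x)"
        using part AE_rep_minus[of "X (r k)" "X (r 0) + abs_L1 D"] AE_rep_plus[of "X (r 0)" "abs_L1 D"]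
          AE_rep_abs_L1[OF D] ae
      proof eventually_elim
        case (elim x)
        have "summable (\<lambda>n. d n x)" using elim(5) by (rule summable_norm_cancel)
        from suminf_split_initial_segment[OF this, of k] elim show ?case
          by (simp add: D_def)
      qed
    qed (auto simp: d_def)
    also have "\<dots> \<le> (\<Sum>n. \<integral>x. norm (d (n + k) x) \<partial>lborel)"
    proof -
      have 1: "integrable lborel (\<lambda>x. \<Sum>n. norm (d (n + k) x))"
        by (rule integrable_suminf) (use aek sk in auto)
      have 2: "(\<integral>x. (\<Sum>n. norm (d (n + k) x)) \<partial>lborel) = (\<Sum>n. \<integral>x. norm (d (n + k) x) \<partial>lborel)"
        by (rule integral_suminf) (use aek sk in auto)
      have "(\<integral>x. norm (\<Sum>n. d (n + k) x) \<partial>lborel) \<le> (\<integral>x. (\<Sum>n. norm (d (n + k) x)) \<partial>lborel)"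
      proof (rule integral_mono_AE)
        show "integrable lborel (\<lambda>x. norm (\<Sum>n. d (n + k) x))"
          by (intro integrable_norm integrable_suminf[OF di aek sk])
        show "AE x in lborel. norm (\<Sum>n. d (n + k) x) \<le> (\<Sum>n. norm (d (n + k) x))"
          using aek by eventually_elim (rule summable_norm)
      qed (rule 1)
      then show ?thesis using 2 by simp
    qed
    also have "\<dots> \<le> (\<Sum>n. (1/2) ^ (n + k))"
    proof (rule suminf_le[OF _ sk])
      show "(\<integral>x. norm (d (n + k) x) \<partial>lborel) \<le> (1/2) ^ (n + k)" for n
        unfolding nd using rn[of "n + k"] by simp
    qed (auto simp: power_add intro!: summable_mult2 summable_geometric)
    also have "\<dots> = (1/2) ^ k * 2"
    proof -
      have "(\<lambda>n. (1/2) ^ n * (1/2) ^ k :: real) sums (1 / (1 - 1/2) * (1/2) ^ k)"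
        by (intro sums_mult2 geometric_sums) simp
      then show ?thesis by (simp add: sums_iff power_add)
    qed
    finally show ?thesis .
  qed
  have "(\<lambda>k. (1/2) ^ k * 2 :: real) \<longlonglongrightarrow> 0 * 2"
    by (intro tendsto_intros LIMSEQ_power_zero) auto
  then have lim0: "(\<lambda>k. (1/2) ^ k * 2 :: real) \<longlonglongrightarrow> 0" by simp
  have "(\<lambda>k. X (r k) - (X (r 0) + abs_L1 D)) \<longlonglongrightarrow> 0"
    by (rule Lim_null_comparison[OF _ lim0]) (simp only: tail eventually_True)
  then have "(X \<circ> r) \<longlonglongrightarrow> X (r 0) + abs_L1 D"
    unfolding comp_def by (rule LIM_zero_cancel)
  then show "convergent X"
    using Cauchy_converges_subseq[OF C r] by (auto simp: convergent_def)
qed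

text \<open>For comparable elements the norm of the difference is the difference of the integrals,
  so \<open>W\<close> inherits the Cauchy property from the bounded increasing sequence of its
  integrals.\<close>

lemma L1_mono_bounded_convergent:
  fixes W :: "nat \<Rightarrow> 'a::euclidean_space L1"
  assumes mono: "\<And>n. W n \<le> W (Suc n)" and bd: "\<And>n. L1_int (W n) \<le> B"
  obtains l where "W \<longlonglongrightarrow> l"
proof -
  have inc: "incseq W" using mono by (rule incseq_SucI)
  have d: "norm (W m - W n) = L1_int (W m) - L1_int (W n)" if "n \<le> m" for m n
    using incseqD[OF inc that] by (simp add: norm_eq_L1_int L1_int_diff)
  have "incseq (\<lambda>n. L1_int (W n))" using mono by (intro incseq_SucI L1_int_mono)
  then obtain L where "(\<lambda>n. L1_int (W n)) \<longlonglongrightarrow> L"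
    using incseq_convergent[of "\<lambda>n. L1_int (W n)" B] bd by blast
  then have C: "Cauchy (\<lambda>n. L1_int (W n))" by (rule LIMSEQ_imp_Cauchy)
  have eq: "norm (W m - W n) = \<bar>L1_int (W m) - L1_int (W n)\<bar>" for m n
  proof (cases "n \<le> m")
    case True with d[OF this] norm_ge_zero[of "W m - W n"] show ?thesis by simp
  next
    case False
    with d[of m n] norm_ge_zero[of "W n - W m"] show ?thesis by (simp add: norm_minus_commute)
  qed
  have "Cauchy W" using C unfolding Cauchy_iff eq by simp
  then show ?thesis using that Cauchy_convergent convergent_def by metis
qed

section \<open>Convolution with the kernel\<close>

lemma lborel_integral_translate:
  fixes h :: "'a::euclidean_space \<Rightarrow> real"
  shows "(\<integral>x. h (a + x) \<partial>lborel) = (\<integral>x. h x \<partial>lborel)"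
proof (cases "h \<in> borel_measurable borel")
  case True
  have "(\<integral>x. h x \<partial>lborel) = (\<integral>x. h x \<partial>distr lborel borel ((+) a))"
    by (simp add: lborel_distr_plus)
  also have "\<dots> = (\<integral>x. h (a + x) \<partial>lborel)"
    using True by (intro integral_distr) auto
  finally show ?thesis by simp
next
  \<comment> \<open>A translate of a non-measurable function is non-measurable, so both integrals
    have the default value 0.\<close>
  case False
  have "(\<lambda>x. h (a + x)) \<notin> borel_measurable borel"
  proof
    assume "(\<lambda>x. h (a + x)) \<in> borel_measurable borel"
    then have "(\<lambda>x. h (a + (x - a))) \<in> borel_measurable borel"
      by (rule measurable_compose[rotated]) simp
    with False show False by simp
  qed
  with False have "\<not> integrable lborel (\<lambda>x. h (a + x))" "\<not> integrable lborel h"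
    using borel_measurable_integrable by fastforce+
  then show ?thesis by (simp add: not_integrable_integral_eq)
qed

lemma lborel_integrable_translate:
  fixes h :: "'a::euclidean_space \<Rightarrow> real"
  assumes "integrable lborel h"
  shows "integrable lborel (\<lambda>x. h (a + x))"
proof -
  have [measurable]: "h \<in> borel_measurable borel"
    using borel_measurable_integrable[OF assms] by simp
  have "integrable (distr lborel borel ((+) a)) h"
    using assms by (simp add: lborel_distr_plus)
  then show ?thesis by (subst (asm) integrable_distr_eq) auto
qed

lemma integrable_mult_bounded:
  fixes h \<phi> :: "'a::euclidean_space \<Rightarrow> real"
  assumes h: "integrable lborel h" and [measurable]: "\<phi> \<in> borel_measurable borel"
    and bd: "\<And>x. \<bar>\<phi> x\<bar> \<le> C"
  shows "integrable lborel (\<lambda>x. h x * \<phi> x)"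
proof (rule Bochner_Integration.integrable_bound)
  show "integrable lborel (\<lambda>x. h x * C)" using h by simp
  show "(\<lambda>x. h x * \<phi> x) \<in> borel_measurable lborel"
    using borel_measurable_integrable[OF h] by simp
  have "\<bar>\<phi> x\<bar> \<le> \<bar>C\<bar>" for x using bd[of x] by linarith
  then show "AE x in lborel. norm (h x * \<phi> x) \<le> norm (h x * C)"
    by (auto simp: abs_mult intro!: AE_I2 mult_left_mono)
qed

text \<open>The adjoint of convolution with \<open>J\<close>, acting on genuine functions rather
  than on classes. For an even \<open>J\<close> it is the convolution itself, see
  \<open>AE_rep_conv_abs\<close>.\<close>

definition avg :: "('a::euclidean_space \<Rightarrow> real) \<Rightarrow> ('a \<Rightarrow> real) \<Rightarrow> 'a \<Rightarrow> real" where
  "avg J \<phi> x = (\<integral>z. J z * \<phi> (x + z) \<partial>lborel)"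

locale kernel =
  fixes J :: "'a::euclidean_space \<Rightarrow> real"
  assumes J: "admissible_kernel J"
begin

lemma J_nonneg [simp]: "0 \<le> J x"
  and J_cont: "continuous_on UNIV J"
  and J_compact: "compact (closure {x. J x \<noteq> 0})"
  and J_radial: "norm x = norm y \<Longrightarrow> J x = J y"
  and J_int [simp]: "(\<integral>x. J x \<partial>lborel) = 1"
  using J unfolding admissible_kernel_def by blast+

text \<open>A non-integrable function would have integral 0 by convention, contrary to the
  normalisation.\<close>

lemma J_integrable [simp, intro]: "integrable lborel J"
  using J_int not_integrable_integral_eq[of lborel J] by (metis zero_neq_one)

lemma J_measurable [measurable]: "J \<in> borel_measurable borel"
  using J_cont by (rule borel_measurable_continuous_onI)

lemma J_even: "J (- x) = J x"
  by (rule J_radial) simp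

lemma J_commute: "J (x - y) = J (y - x)"
  by (rule J_radial) (simp add: norm_minus_commute)

lemma J_support: obtains r where "0 < r" "\<And>z. J z \<noteq> 0 \<Longrightarrow> norm z \<le> r"
proof -
  have "bounded (closure {x. J x \<noteq> 0})" using J_compact by (rule compact_imp_bounded)
  then obtain r where "0 < r" "\<And>z. z \<in> closure {x. J x \<noteq> 0} \<Longrightarrow> norm z \<le> r"
    unfolding bounded_pos by blast
  then show ?thesis using that closure_subset by (metis (mono_tags, lifting) mem_Collect_eq subsetD)
qed

lemma J_bounded: obtains M where "0 < M" "\<And>z. J z \<le> M"
proof -
  let ?S = "closure {x. J x \<noteq> 0}"
  have "bounded (J ` ?S)"
    using J_compact J_cont by (intro compact_imp_bounded compact_continuous_image)
      (auto intro: continuous_on_subset)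
  then obtain M where M: "0 < M" "\<And>z. z \<in> ?S \<Longrightarrow> norm (J z) \<le> M"
    unfolding bounded_pos by auto
  have "J z \<le> M" for z
  proof (cases "J z = 0")
    case False
    then have "z \<in> ?S" using closure_subset[of "{x. J x \<noteq> 0}"] by auto
    then show ?thesis using M(2)[of z] by simp
  qed (use M in simp)
  with M(1) show ?thesis using that by blast
qed

lemma integrable_J_mult:
  assumes "\<phi> \<in> borel_measurable borel" "\<And>x. \<bar>\<phi> x\<bar> \<le> C"
  shows "integrable lborel (\<lambda>z. J z * \<phi> (x + z))"
proof (rule integrable_mult_bounded[where C = C])
  show "(\<lambda>z. \<phi> (x + z)) \<in> borel_measurable borel"
    using assms(1) by (rule measurable_compose[rotated]) simp
qed (use assms in auto)

lemma avg_bounds: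
  assumes "\<phi> \<in> borel_measurable borel" "\<And>x. a \<le> \<phi> x" "\<And>x. \<phi> x \<le> b"
  shows "a \<le> avg J \<phi> x" "avg J \<phi> x \<le> b"
proof -
  have bd: "\<bar>\<phi> x\<bar> \<le> \<bar>a\<bar> + \<bar>b\<bar>" for x using assms(2,3)[of x] by linarith
  note i = integrable_J_mult[OF assms(1) bd]
  have "(\<integral>z. J z * a \<partial>lborel) \<le> (\<integral>z. J z * \<phi> (x + z) \<partial>lborel)"
    by (intro integral_mono i) (auto intro: mult_left_mono assms)
  then show "a \<le> avg J \<phi> x" by (simp add: avg_def)
  have "(\<integral>z. J z * \<phi> (x + z) \<partial>lborel) \<le> (\<integral>z. J z * b \<partial>lborel)"
    by (intro integral_mono i) (auto intro: mult_left_mono assms)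
  then show "avg J \<phi> x \<le> b" by (simp add: avg_def)
qed

lemma avg_measurable [measurable]:
  assumes [measurable]: "\<phi> \<in> borel_measurable borel"
  shows "avg J \<phi> \<in> borel_measurable borel"
  unfolding avg_def by measurable

text \<open>Fubini, with the inner integral translated by \<open>y\<close>. Boundedness of
  \<open>\<phi>\<close> makes the double integrand integrable.\<close>

lemma duality:
  assumes [measurable]: "\<phi> \<in> borel_measurable borel" and bd: "\<And>x. \<bar>\<phi> x\<bar> \<le> C"
  shows "(\<integral>x. rep_L1 (L1_conv J v) x * \<phi> x \<partial>lborel) = (\<integral>y. rep_L1 v y * avg J \<phi> y \<partial>lborel)"
proof -
  let ?v = "rep_L1 v"
  have C: "0 \<le> C" using bd[of undefined] by linarith
  have inner: "(\<integral>x. norm (J (x - y) * ?v y * \<phi> x) \<partial>lborel) = \<bar>?v y\<bar> * avg J (\<lambda>x. \<bar>\<phi> x\<bar>) y" for y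
  proof -
    have "(\<integral>x. norm (J (x - y) * ?v y * \<phi> x) \<partial>lborel) =
        (\<integral>x. norm (J ((y + x) - y) * ?v y * \<phi> (y + x)) \<partial>lborel)"
      by (rule lborel_integral_translate[symmetric])
    also have "\<dots> = (\<integral>x. \<bar>?v y\<bar> * (J x * \<bar>\<phi> (y + x)\<bar>) \<partial>lborel)"
      by (simp add: abs_mult mult_ac)
    finally show ?thesis by (simp add: avg_def)
  qed
  have outer: "(\<integral>x. J (x - y) * ?v y * \<phi> x \<partial>lborel) = ?v y * avg J \<phi> y" for y
  proof -
    have "(\<integral>x. J (x - y) * ?v y * \<phi> x \<partial>lborel) =
        (\<integral>x. J ((y + x) - y) * ?v y * \<phi> (y + x) \<partial>lborel)"
      by (rule lborel_integral_translate[symmetric])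
    also have "\<dots> = (\<integral>x. ?v y * (J x * \<phi> (y + x)) \<partial>lborel)"
      by (simp add: mult_ac)
    finally show ?thesis by (simp add: avg_def)
  qed
  have I: "integrable (lborel \<Otimes>\<^sub>M lborel) (\<lambda>(y, x). J (x - y) * ?v y * \<phi> x)"
  proof (rule lborel_pair.Fubini_integrable)
    show "(\<lambda>(y, x). J (x - y) * ?v y * \<phi> x) \<in> borel_measurable (lborel \<Otimes>\<^sub>M lborel)"
      by measurable
    have "integrable lborel (\<lambda>y. ?v y * avg J (\<lambda>x. \<bar>\<phi> x\<bar>) y)"
    proof (rule integrable_mult_bounded[where C = C])
      show "\<bar>avg J (\<lambda>x. \<bar>\<phi> x\<bar>) y\<bar> \<le> C" for y
        using avg_bounds[of "\<lambda>x. \<bar>\<phi> x\<bar>" 0 C y] bd by simp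
    qed auto
    then have "integrable lborel (\<lambda>y. norm (?v y * avg J (\<lambda>x. \<bar>\<phi> x\<bar>) y))"
      by (rule integrable_norm)
    moreover have "0 \<le> avg J (\<lambda>x. \<bar>\<phi> x\<bar>) y" for y
      using avg_bounds[of "\<lambda>x. \<bar>\<phi> x\<bar>" 0 C y] bd by simp
    ultimately show "integrable lborel
        (\<lambda>y. \<integral>x. norm (case (y, x) of (y, x) \<Rightarrow> J (x - y) * ?v y * \<phi> x) \<partial>lborel)"
      using inner by (simp add: abs_mult)
    show "AE y in lborel. integrable lborel (\<lambda>x. case (y, x) of (y, x) \<Rightarrow> J (x - y) * ?v y * \<phi> x)"
    proof (rule AE_I2)
      fix y
      have "integrable lborel (\<lambda>x. J (x - y) * ?v y)"
        using lborel_integrable_translate[OF J_integrable, of "- y"] by simp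
      then show "integrable lborel (\<lambda>x. case (y, x) of (y, x) \<Rightarrow> J (x - y) * ?v y * \<phi> x)"
        using integrable_mult_bounded[of "\<lambda>x. J (x - y) * ?v y" \<phi> C] bd by simp
    qed
  qed
  have "(\<integral>x. rep_L1 (L1_conv J v) x * \<phi> x \<partial>lborel) =
      (\<integral>x. (\<integral>y. J (x - y) * ?v y * \<phi> x \<partial>lborel) \<partial>lborel)"
  proof (rule integral_cong_AE)
    show "AE x in lborel. rep_L1 (L1_conv J v) x * \<phi> x = (\<integral>y. J (x - y) * ?v y * \<phi> x \<partial>lborel)"
      using AE_rep_conv[OF J_integrable, of v] by eventually_elim simp
  qed auto
  also have "\<dots> = (\<integral>y. (\<integral>x. J (x - y) * ?v y * \<phi> x \<partial>lborel) \<partial>lborel)"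
    using lborel_pair.Fubini_integral[OF I] by simp
  also have "\<dots> = (\<integral>y. ?v y * avg J \<phi> y \<partial>lborel)"
    by (simp add: outer)
  finally show ?thesis .
qed

lemma L1_int_conv: "L1_int (L1_conv J v) = L1_int v"
  using duality[of "\<lambda>_. 1" 1 v] by (simp add: L1_int_def avg_def)

lemma integrable_kernel_mult: "integrable lborel (\<lambda>y. J (x - y) * rep_L1 v y)"
proof -
  obtain M where M: "0 < M" "\<And>z. J z \<le> M" using J_bounded by blast
  show ?thesis
    using integrable_mult_bounded[of "rep_L1 v" "\<lambda>y. J (x - y)" M] M(2) by (simp add: mult_ac)
qed

lemma conv_plus: "L1_conv J (v + w) = L1_conv J v + L1_conv J w"
proof (rule L1_eqI)
  show "AE x in lborel. rep_L1 (L1_conv J (v + w)) x = rep_L1 (L1_conv J v + L1_conv J w) x"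
    using AE_rep_conv[OF J_integrable, of "v + w"] AE_rep_conv[OF J_integrable, of v]
      AE_rep_conv[OF J_integrable, of w] AE_rep_plus[of "L1_conv J v" "L1_conv J w"]
  proof eventually_elim
    case (elim x)
    have "(\<integral>y. J (x - y) * rep_L1 (v + w) y \<partial>lborel) =
        (\<integral>y. J (x - y) * rep_L1 v y + J (x - y) * rep_L1 w y \<partial>lborel)"
      by (intro integral_cong_AE) (use AE_rep_plus[of v w] in \<open>auto simp: algebra_simps\<close>)
    with elim integrable_kernel_mult[of x v] integrable_kernel_mult[of x w] show ?case by simp
  qed
qed

lemma conv_scaleR: "L1_conv J (c *\<^sub>R v) = c *\<^sub>R L1_conv J v"
proof (rule L1_eqI)
  show "AE x in lborel. rep_L1 (L1_conv J (c *\<^sub>R v)) x = rep_L1 (c *\<^sub>R L1_conv J v) x"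
    using AE_rep_conv[OF J_integrable, of "c *\<^sub>R v"] AE_rep_conv[OF J_integrable, of v]
      AE_rep_scaleR[of c "L1_conv J v"]
  proof eventually_elim
    case (elim x)
    have "(\<integral>y. J (x - y) * rep_L1 (c *\<^sub>R v) y \<partial>lborel) =
        (\<integral>y. c * (J (x - y) * rep_L1 v y) \<partial>lborel)"
      by (intro integral_cong_AE) (use AE_rep_scaleR[of c v] in \<open>auto simp: algebra_simps\<close>)
    with elim show ?case by simp
  qed
qed

lemma conv_mono:
  assumes "v \<le> w" shows "L1_conv J v \<le> L1_conv J w"
  unfolding less_eq_L1_def
  using AE_rep_conv[OF J_integrable, of v] AE_rep_conv[OF J_integrable, of w]
proof eventually_elim
  case (elim x)
  have "(\<integral>y. J (x - y) * rep_L1 v y \<partial>lborel) \<le> (\<integral>y. J (x - y) * rep_L1 w y \<partial>lborel)"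
  proof (rule integral_mono_AE)
    show "AE y in lborel. J (x - y) * rep_L1 v y \<le> J (x - y) * rep_L1 w y"
      using assms unfolding less_eq_L1_def by eventually_elim (auto intro: mult_left_mono)
  qed (use integrable_kernel_mult in auto)
  with elim show ?case by simp
qed

lemma conv_zero: "L1_conv J 0 = 0"
  using conv_scaleR[of 0 0] by simp

lemma conv_nonneg: "0 \<le> v \<Longrightarrow> 0 \<le> L1_conv J v"
  using conv_mono[of 0 v] by (simp add: conv_zero)

lemma conv_uminus: "L1_conv J (- v) = - L1_conv J v"
  using conv_scaleR[of "-1" v] by simp

lemma conv_diff: "L1_conv J (v - w) = L1_conv J v - L1_conv J w"
  using conv_plus[of v "- w"] by (simp add: conv_uminus)

text \<open>Young's inequality for a kernel of unit mass: on the positive and the negative part of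
  \<open>v\<close> separately, convolution preserves both sign and integral, hence the norm.\<close>

lemma norm_conv_le: "norm (L1_conv J v) \<le> norm v"
proof -
  define p n where "p = pos_part v" and "n = pos_part (- v)"
  have v: "v = p - n" by (simp add: p_def n_def pos_part_minus)
  have pn: "0 \<le> p" "0 \<le> n" by (simp_all add: p_def n_def pos_part_nonneg)
  have "norm (L1_conv J v) \<le> norm (L1_conv J p) + norm (L1_conv J n)"
    unfolding v conv_diff by (rule norm_triangle_ineq4)
  also have "\<dots> = L1_int p + L1_int n"
    using pn by (simp add: norm_eq_L1_int conv_nonneg L1_int_conv)
  also have "\<dots> = 2 * norm (pos_part v) - L1_int v"
    using L1_int_diff[of p n] pn by (simp add: norm_eq_L1_int flip: v p_def)
  also have "\<dots> = norm v" by (rule norm_eq_pos_part[symmetric])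
  finally show ?thesis .
qed

definition A :: "'a L1 \<Rightarrow> 'a L1" where "A v = L1_conv J v - v"

lemma bounded_linear_A: "bounded_linear A"
proof (rule bounded_linear_intro[where K = 2])
  show "A (v + w) = A v + A w" for v w by (simp add: A_def conv_plus)
  show "A (c *\<^sub>R v) = c *\<^sub>R A v" for c v by (simp add: A_def conv_scaleR scaleR_right_diff_distrib)
  show "norm (A v) \<le> norm v * 2" for v
    unfolding A_def using norm_triangle_ineq4[of "L1_conv J v" v] norm_conv_le[of v] by linarith
qed

lemma norm_A_le: "norm (A v) \<le> 2 * norm v"
  unfolding A_def using norm_triangle_ineq4[of "L1_conv J v" v] norm_conv_le[of v] by linarith

lemma A_diff: "A (v - w) = A v - A w"
  by (simp add: A_def conv_diff)

lemma A_plus: "A (v + w) = A v + A w"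
  by (simp add: A_def conv_plus)

lemma A_scaleR: "A (c *\<^sub>R v) = c *\<^sub>R A v"
  by (simp add: A_def conv_scaleR scaleR_right_diff_distrib)

lemma L1_int_A: "L1_int (A v) = 0"
  by (simp add: A_def L1_int_diff L1_int_conv)

lemma A_ge: "0 \<le> v \<Longrightarrow> - v \<le> A v"
  using conv_nonneg[of v] by (simp add: A_def)

lemma duality_A:
  assumes [measurable]: "\<phi> \<in> borel_measurable borel" and bd: "\<And>x. \<bar>\<phi> x\<bar> \<le> C"
  shows "(\<integral>x. rep_L1 (A v) x * \<phi> x \<partial>lborel) = (\<integral>y. rep_L1 v y * (avg J \<phi> y - \<phi> y) \<partial>lborel)"
proof -
  have C: "\<bar>avg J \<phi> y\<bar> \<le> C" for y
    using avg_bounds[of \<phi> "- C" C y] bd by (simp add: abs_le_iff minus_le_iff)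
  have i: "integrable lborel (\<lambda>x. rep_L1 w x * \<phi> x)" for w
    by (rule integrable_mult_bounded[OF integrable_rep_L1 _ bd]) simp
  have i': "integrable lborel (\<lambda>x. rep_L1 v x * avg J \<phi> x)"
    by (rule integrable_mult_bounded[OF integrable_rep_L1 _ C]) simp
  have "(\<integral>x. rep_L1 (A v) x * \<phi> x \<partial>lborel) =
      (\<integral>x. rep_L1 (L1_conv J v) x * \<phi> x - rep_L1 v x * \<phi> x \<partial>lborel)"
  proof (rule integral_cong_AE)
    show "AE x in lborel. rep_L1 (A v) x * \<phi> x = rep_L1 (L1_conv J v) x * \<phi> x - rep_L1 v x * \<phi> x"
      unfolding A_def using AE_rep_minus[of "L1_conv J v" v]
      by eventually_elim (simp add: left_diff_distrib)
  qed auto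
  also have "\<dots> = (\<integral>y. rep_L1 v y * (avg J \<phi> y - \<phi> y) \<partial>lborel)"
    using duality[OF assms] i i' by (simp add: right_diff_distrib)
  finally show ?thesis .
qed

text \<open>Duality moves \<open>A\<close> onto the indicator of \<open>P\<close>. Its average lies
  in [0, 1], so average minus indicator is nonpositive on \<open>P\<close> and nonnegative off
  \<open>P\<close>, opposite in sign to \<open>z\<close>. The set \<open>P\<close> is only squeezed
  between \<open>z > 0\<close> and \<open>z \<ge> 0\<close>; the freedom on \<open>z = 0\<close> is
  what the comparison arguments below exploit.\<close>

lemma integral_A_le_zero:
  assumes P: "P \<in> sets borel"
    and z: "AE x in lborel. (x \<in> P \<longrightarrow> 0 \<le> rep_L1 z x) \<and> (x \<notin> P \<longrightarrow> rep_L1 z x \<le> 0)"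
  shows "(\<integral>x. rep_L1 (A z) x * indicator P x \<partial>lborel) \<le> 0"
proof -
  have [measurable]: "(indicator P :: 'a \<Rightarrow> real) \<in> borel_measurable borel"
    using P by simp
  have "(\<integral>x. rep_L1 (A z) x * indicator P x \<partial>lborel) =
      (\<integral>x. rep_L1 z x * (avg J (indicator P) x - indicator P x) \<partial>lborel)"
    by (rule duality_A[where C = 1]) (auto split: split_indicator)
  also have "\<dots> \<le> 0"
  proof -
    have "AE x in lborel. 0 \<le> - (rep_L1 z x * (avg J (indicator P) x - indicator P x))"
      using z
    proof eventually_elim
      case (elim x)
      have "0 \<le> avg J (indicator P) x" "avg J (indicator P) x \<le> 1"
        using avg_bounds[of "indicator P" 0 1 x] by (auto split: split_indicator)
      with elim show ?case by (cases "x \<in> P") (auto simp: mult_le_0_iff)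
    qed
    then have "0 \<le> (\<integral>x. - (rep_L1 z x * (avg J (indicator P) x - indicator P x)) \<partial>lborel)"
      by (rule integral_nonneg_AE)
    then show ?thesis by simp
  qed
  finally show ?thesis .
qed

end

section \<open>Uniqueness for the obstacle problem\<close>

text \<open>Flipping all coordinates gives the evenness arguments; flipping a single one gives the
  vanishing of mixed second moments.\<close>

lemma lborel_distr_signs:
  fixes c :: "'a::euclidean_space \<Rightarrow> real"
  assumes "\<And>j. j \<in> Basis \<Longrightarrow> \<bar>c j\<bar> = 1"
  shows "distr lborel borel (\<lambda>x. \<Sum>j\<in>Basis. (c j * (x \<bullet> j)) *\<^sub>R j) = (lborel :: 'a measure)"
proof -
  have "c j \<noteq> 0" if "j \<in> Basis" for j using assms[OF that] by auto
  from lborel_affine_euclidean[where c = c and t = 0, OF this] assms show ?thesis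
    by (simp add: density_1 flip: one_ennreal_def)
qed

lemma lborel_distr_uminus_euclidean: "distr lborel borel uminus = (lborel :: 'a::euclidean_space measure)"
proof -
  have "(\<Sum>j\<in>Basis. (- 1 * (x \<bullet> j)) *\<^sub>R j) = - x" for x :: 'a
    by (simp add: sum_negf euclidean_representation)
  then show ?thesis using lborel_distr_signs[of "\<lambda>_ :: 'a. - 1"] by simp
qed

lemma lborel_integral_reflect:
  fixes h :: "'a::euclidean_space \<Rightarrow> real"
  assumes [measurable]: "h \<in> borel_measurable borel"
  shows "(\<integral>z. h (- z) \<partial>lborel) = (\<integral>z. h z \<partial>lborel)"
proof -
  have "(\<integral>z. h z \<partial>lborel) = (\<integral>z. h z \<partial>distr lborel borel uminus)"
    by (simp add: lborel_distr_uminus_euclidean)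
  also have "\<dots> = (\<integral>z. h (- z) \<partial>lborel)"
    by (rule integral_distr) auto
  finally show ?thesis by simp
qed

context kernel begin

lemma avg_odd_zero:
  assumes [measurable]: "\<phi> \<in> borel_measurable borel" and odd: "\<And>z. \<phi> (- z) = - \<phi> z"
  shows "(\<integral>z. J z * \<phi> z \<partial>lborel) = 0"
proof -
  have "(\<integral>z. J z * \<phi> z \<partial>lborel) = (\<integral>z. J (- z) * \<phi> (- z) \<partial>lborel)"
    by (rule lborel_integral_reflect[symmetric]) simp
  also have "\<dots> = - (\<integral>z. J z * \<phi> z \<partial>lborel)"
    by (simp add: J_even odd)
  finally show ?thesis by simp
qed

text \<open>A continuous function is bounded on a ball that contains the support of
  \<open>J\<close>.\<close>

lemma integrable_J_cont:
  fixes \<phi> :: "'a \<Rightarrow> real"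
  assumes c: "continuous_on UNIV \<phi>"
  shows "integrable lborel (\<lambda>z. J z * \<phi> z)"
proof -
  have [measurable]: "\<phi> \<in> borel_measurable borel"
    using c by (rule borel_measurable_continuous_onI)
  obtain r where r: "0 < r" "\<And>z. J z \<noteq> 0 \<Longrightarrow> norm z \<le> r" using J_support by blast
  have "bounded (\<phi> ` cball 0 r)"
    using c by (intro compact_imp_bounded compact_continuous_image) (auto intro: continuous_on_subset)
  then obtain C where C: "0 < C" "\<And>z. norm z \<le> r \<Longrightarrow> \<bar>\<phi> z\<bar> \<le> C"
    unfolding bounded_pos by (auto simp: dist_norm)
  show ?thesis
  proof (rule Bochner_Integration.integrable_bound)
    show "integrable lborel (\<lambda>z. J z * C)" by simp
    show "AE z in lborel. norm (J z * \<phi> z) \<le> norm (J z * C)"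
    proof (rule AE_I2)
      show "norm (J z * \<phi> z) \<le> norm (J z * C)" for z
        using r(2)[of z] C(2)[of z] C(1) by (cases "J z = 0") (auto simp: abs_mult intro: mult_left_mono)
    qed
  qed simp
qed

text \<open>A vanishing moment would concentrate \<open>J\<close> on the null hyperplane
  \<open>z \<bullet> b = 0\<close>, contrary to its unit mass.\<close>

lemma moment_pos:
  assumes b: "b \<in> Basis"
  shows "0 < (\<integral>z. J z * (z \<bullet> b)\<^sup>2 \<partial>lborel)"
proof (rule ccontr)
  assume "\<not> ?thesis"
  moreover have i: "integrable lborel (\<lambda>z. J z * (z \<bullet> b)\<^sup>2)"
    by (rule integrable_J_cont) (intro continuous_intros)
  moreover have "0 \<le> (\<integral>z. J z * (z \<bullet> b)\<^sup>2 \<partial>lborel)" by simp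
  ultimately have "AE z in lborel. J z * (z \<bullet> b)\<^sup>2 = 0"
    by (subst integral_nonneg_eq_0_iff_AE[symmetric]) auto
  then have "AE z in lborel. J z = 0"
    using AE_lborel_inner_neq[OF b, of 0] by eventually_elim simp
  then have "(\<integral>z. J z \<partial>lborel) = 0"
    by (rule integral_eq_zero_AE)
  then show False by simp
qed

text \<open>A slow cosine \<open>\<phi> n\<close> is an eigenfunction of \<open>avg J\<close>, since
  the sine term of the addition formula drops out by evenness. Its eigenvalue \<open>c\<close>
  differs from 1, so duality with \<open>A h = 0\<close> makes the integral of \<open>h\<close>
  against \<open>\<phi> n\<close> vanish. As \<open>n\<close> grows the cosines tend to 1, and the
  integral of \<open>h\<close> itself is 0.\<close>

lemma A_eq_zero_imp:
  assumes h: "0 \<le> h" "A h = 0"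
  shows "h = 0"
proof (rule L1_eq_zeroI[OF h(1)])
  obtain b :: 'a where b: "b \<in> Basis" using nonempty_Basis by blast
  obtain r where r: "0 < r" "\<And>z. J z \<noteq> 0 \<Longrightarrow> norm z \<le> r" using J_support by blast
  define \<phi> where "\<phi> n x = cos ((x \<bullet> b) / real n)" for n :: nat and x :: 'a
  have [measurable]: "\<phi> n \<in> borel_measurable borel" for n
    unfolding \<phi>_def by measurable
  have zero: "(\<integral>x. rep_L1 h x * \<phi> n x \<partial>lborel) = 0" if n: "real n > r" for n
  proof -
    define c where "c = (\<integral>z. J z * \<phi> n z \<partial>lborel)"
    have n0: "0 < real n" using n r by simp
    have i: "integrable lborel (\<lambda>z. J z * \<phi> n z)"
      unfolding \<phi>_def using n0 by (intro integrable_J_cont continuous_intros) auto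
    have i2: "integrable lborel (\<lambda>z. J z * sin ((z \<bullet> b) / real n))"
      using n0 by (intro integrable_J_cont continuous_intros) auto
    have s: "(\<integral>z. J z * sin ((z \<bullet> b) / real n) \<partial>lborel) = 0"
      by (rule avg_odd_zero) auto
    have avg: "avg J (\<phi> n) x = \<phi> n x * c" for x
    proof -
      let ?a = "(x \<bullet> b) / real n"
      have "avg J (\<phi> n) x =
          (\<integral>z. cos ?a * (J z * \<phi> n z) - sin ?a * (J z * sin ((z \<bullet> b) / real n)) \<partial>lborel)"
        unfolding avg_def \<phi>_def
        by (intro Bochner_Integration.integral_cong)
          (auto simp: inner_add_left add_divide_distrib cos_add algebra_simps)
      also have "\<dots> = cos ?a * c"
        using i i2 s by (simp add: c_def)
      finally show ?thesis by (simp add: \<phi>_def)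
    qed
    \<comment> \<open>Equality would force the cosine to be 1 almost everywhere on the support of
      \<open>J\<close>. There its argument has modulus below 1, because \<open>n\<close> exceeds the
      support radius \<open>r\<close>, so this happens only on the null hyperplane
      \<open>z \<bullet> b = 0\<close>.\<close>
    have c: "c \<noteq> 1"
    proof
      assume "c = 1"
      then have "(\<integral>z. J z - J z * \<phi> n z \<partial>lborel) = 0"
        using i by (simp add: c_def)
      moreover have "J z * \<phi> n z \<le> J z" for z
        using mult_left_mono[of "\<phi> n z" 1 "J z"] by (simp add: \<phi>_def)
      ultimately have "AE z in lborel. J z - J z * \<phi> n z = 0"
        using i by (subst (asm) integral_nonneg_eq_0_iff_AE) auto
      then have "AE z in lborel. J z = 0"
        using AE_lborel_inner_neq[OF b, of 0]
      proof eventually_elim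
        case (elim z)
        show "J z = 0"
        proof (rule ccontr)
          assume nz: "J z \<noteq> 0"
          let ?y = "(z \<bullet> b) / real n"
          have "cos ?y = 1" using elim nz by (simp add: \<phi>_def)
          moreover have "cos ?y = 1 - 2 * (sin (?y / 2))\<^sup>2"
            using cos_double_sin[of "?y / 2"] by simp
          ultimately have s0: "sin (?y / 2) = 0" by simp
          have "\<bar>z \<bullet> b\<bar> \<le> norm z" using b by (rule Basis_le_norm)
          then have "\<bar>?y\<bar> < 1" using r(2)[OF nz] n n0 by (simp add: abs_divide)
          moreover have "y / 2 < pi \<and> - (y / 2) < pi" if "\<bar>y\<bar> < 1" for y :: real
            using that pi_gt3 by linarith
          ultimately have y: "?y / 2 < pi" "- (?y / 2) < pi" by blast+
          have "?y / 2 \<noteq> 0" using elim n0 by simp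
          then consider "0 < ?y / 2" | "0 < - (?y / 2)" by linarith
          then show False
          proof cases
            case 1
            with sin_gt_zero[OF 1 y(1)] s0 show False by simp
          next
            case 2
            with sin_gt_zero[OF 2 y(2)] s0 show False by simp
          qed
        qed
      qed
      then have "(\<integral>z. J z \<partial>lborel) = 0"
        by (rule integral_eq_zero_AE)
      then show False by simp
    qed
    have "0 = (\<integral>x. rep_L1 (A h) x * \<phi> n x \<partial>lborel)"
      unfolding h(2) by (rule integral_eq_zero_AE[symmetric]) (use AE_rep_zero in auto)
    also have "\<dots> = (\<integral>x. rep_L1 h x * (avg J (\<phi> n) x - \<phi> n x) \<partial>lborel)"
      by (rule duality_A[where C = 1]) (auto simp: \<phi>_def)
    also have "\<dots> = (\<integral>x. (c - 1) * (rep_L1 h x * \<phi> n x) \<partial>lborel)"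
      by (simp add: avg algebra_simps)
    also have "\<dots> = (c - 1) * (\<integral>x. rep_L1 h x * \<phi> n x \<partial>lborel)"
      by simp
    finally show ?thesis using c by simp
  qed
  have "(\<lambda>n. \<integral>x. rep_L1 h x * \<phi> n x \<partial>lborel) \<longlonglongrightarrow> (\<integral>x. rep_L1 h x * 1 \<partial>lborel)"
  proof (rule integral_dominated_convergence[where w = "\<lambda>x. \<bar>rep_L1 h x\<bar>"])
    show "AE x in lborel. (\<lambda>n. rep_L1 h x * \<phi> n x) \<longlonglongrightarrow> rep_L1 h x * 1"
    proof (rule AE_I2, intro tendsto_intros)
      fix x
      have "(\<lambda>n. (x \<bullet> b) / real n) \<longlonglongrightarrow> 0"
        by (rule lim_const_over_n)
      then have "(\<lambda>n. cos ((x \<bullet> b) / real n)) \<longlonglongrightarrow> cos 0"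
        by (rule tendsto_cos)
      then show "(\<lambda>n. \<phi> n x) \<longlonglongrightarrow> 1" by (simp add: \<phi>_def)
    qed
    show "AE x in lborel. norm (rep_L1 h x * \<phi> n x) \<le> \<bar>rep_L1 h x\<bar>" for n
      by (rule AE_I2) (auto simp: abs_mult \<phi>_def mult_left_le)
  qed auto
  moreover have "(\<lambda>n. \<integral>x. rep_L1 h x * \<phi> n x \<partial>lborel) \<longlonglongrightarrow> 0"
  proof (rule tendsto_eventually)
    obtain N :: nat where "r < real N" using reals_Archimedean2 by blast
    then show "\<forall>\<^sub>F n in sequentially. (\<integral>x. rep_L1 h x * \<phi> n x \<partial>lborel) = 0"
      using zero by (intro eventually_sequentiallyI[of N]) (auto intro!: zero)
  qed
  ultimately have "L1_int h = 0"
    using LIMSEQ_unique by (fastforce simp: L1_int_def)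
  then show "L1_int h \<le> 0" by simp
qed

text \<open>Reduction to the nonnegative case: \<open>h = |z|\<close> satisfies
  \<open>h \<le> J * h\<close> because \<open>z = J * z\<close>, so \<open>A h\<close> is
  nonnegative with integral 0 and therefore vanishes.\<close>

lemma A_kernel_trivial:
  assumes z: "A z = 0"
  shows "z = 0"
proof -
  define h where "h = pos_part z + pos_part (- z)"
  have h: "0 \<le> h" by (simp add: h_def pos_part_nonneg add_nonneg_nonneg)
  have le: "z \<le> h" "- z \<le> h"
    unfolding h_def using pos_part_minus[of z] pos_part_nonneg[of z] pos_part_nonneg[of "- z"]
    by (metis add.commute diff_le_eq le_add_same_cancel1 add_increasing2 order_refl,
        metis add.commute minus_diff_eq diff_le_eq add_increasing2 le_add_same_cancel1 order_refl)
  have "L1_conv J z = z" using z by (simp add: A_def)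
  then have "z \<le> L1_conv J h" "- z \<le> L1_conv J h"
    using conv_mono[OF le(1)] conv_mono[OF le(2)] by (simp_all add: conv_uminus)
  then have "h \<le> L1_conv J h"
    unfolding less_eq_L1_def h_def
    using AE_rep_plus[of "pos_part z" "pos_part (- z)"] AE_rep_pos_part[of z]
      AE_rep_pos_part[of "- z"] AE_rep_uminus[of z]
    by eventually_elim (auto simp: max_def)
  then have "0 \<le> A h" by (simp add: A_def)
  then have "A h = 0" by (rule L1_eq_zeroI) (simp add: L1_int_A)
  with h have "h = 0" by (rule A_eq_zero_imp)
  with le have "z \<le> 0" "0 \<le> z" by simp_all
  then show ?thesis by (rule antisym)
qed

lemma solves_OP_iff:
  "solves_OP J F w \<longleftrightarrow> 0 \<le> w \<and> 0 \<le> F + A w \<and>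
     (AE x in lborel. rep_L1 (F + A w) x \<le> 1 \<and> (0 < rep_L1 w x \<longrightarrow> rep_L1 (F + A w) x = 1))"
proof -
  let ?q = "rep_L1 (F + A w)"
  have 1: "(AE x in lborel. 0 \<le> ?q x) \<longleftrightarrow> 0 \<le> F + A w"
    unfolding L1_nonneg_iff[symmetric] L1_nonneg_def ..
  have 2: "(AE x in lborel. (?q x - 1) * rep_L1 w x = 0) \<longleftrightarrow>
      (AE x in lborel. 0 < rep_L1 w x \<longrightarrow> ?q x = 1)" if "0 \<le> w"
  proof
    show "AE x in lborel. 0 < rep_L1 w x \<longrightarrow> ?q x = 1"
      if "AE x in lborel. (?q x - 1) * rep_L1 w x = 0"
      using that by eventually_elim auto
    show "AE x in lborel. (?q x - 1) * rep_L1 w x = 0"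
      if "AE x in lborel. 0 < rep_L1 w x \<longrightarrow> ?q x = 1"
      using that AE_nonneg_L1[OF \<open>0 \<le> w\<close>] by eventually_elim auto
  qed
  show ?thesis
    unfolding solves_OP_def L1_nonneg_iff add_diff_eq[symmetric] A_def[symmetric] AE_conj_iff 1
    using 2 by blast
qed

text \<open>On \<open>P\<close> one has \<open>z \<ge> 0\<close>, because
  \<open>q2 < q1 \<le> 1\<close> forces \<open>w2 = 0\<close>, and also \<open>q1 \<ge> q2\<close>,
  because \<open>w1 > w2 \<ge> 0\<close> forces \<open>q1 = 1\<close>. Thus
  \<open>A z = q1 - q2\<close> is nonnegative on \<open>P\<close> while its integral there is
  nonpositive, so it vanishes on \<open>P\<close>, which contains all points with
  \<open>q1 > q2\<close>.\<close>

lemma solves_OP_proj_le: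
  assumes "solves_OP J F w1" "solves_OP J F w2"
  shows "F + A w1 \<le> F + A w2"
proof -
  define z where "z = w1 - w2"
  define q1 q2 where "q1 = F + A w1" and "q2 = F + A w2"
  define P where "P = {x. rep_L1 q2 x < rep_L1 q1 x} \<union> {x. 0 < rep_L1 z x}"
  have P[measurable]: "P \<in> sets borel" unfolding P_def by measurable
  have w: "0 \<le> w1" "0 \<le> w2" using assms by (auto simp: solves_OP_iff)
  have q1: "AE x in lborel. rep_L1 q1 x \<le> 1 \<and> (0 < rep_L1 w1 x \<longrightarrow> rep_L1 q1 x = 1)"
    and q2: "AE x in lborel. rep_L1 q2 x \<le> 1 \<and> (0 < rep_L1 w2 x \<longrightarrow> rep_L1 q2 x = 1)"
    using assms by (auto simp: solves_OP_iff q1_def q2_def)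
  note rz = AE_rep_minus[of w1 w2, folded z_def]
  have "AE x in lborel. (x \<in> P \<longrightarrow> 0 \<le> rep_L1 z x) \<and> (x \<notin> P \<longrightarrow> rep_L1 z x \<le> 0)"
    using q1 q2 rz AE_nonneg_L1[OF w(1)] AE_nonneg_L1[OF w(2)]
    by eventually_elim (auto simp: P_def not_less)
  then have le: "(\<integral>x. rep_L1 (A z) x * indicator P x \<partial>lborel) \<le> 0"
    by (rule integral_A_le_zero[OF P])
  have Az: "A z = q1 - q2" by (simp add: z_def A_diff q1_def q2_def)
  have "AE x in lborel. 0 \<le> rep_L1 (A z) x * indicator P x"
    using q1 q2 rz AE_nonneg_L1[OF w(1)] AE_nonneg_L1[OF w(2)] AE_rep_minus[of q1 q2] unfolding Az
    by eventually_elim (auto simp: P_def split: split_indicator)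
  moreover have "integrable lborel (\<lambda>x. rep_L1 (A z) x * indicator P x)"
    by (rule integrable_mult_bounded[where C = 1]) (auto split: split_indicator)
  moreover from calculation have "0 \<le> (\<integral>x. rep_L1 (A z) x * indicator P x \<partial>lborel)"
    by (intro integral_nonneg_AE)
  ultimately have "AE x in lborel. rep_L1 (A z) x * indicator P x = 0"
    using le by (subst integral_nonneg_eq_0_iff_AE[symmetric]) auto
  then have "q1 \<le> q2"
    using AE_rep_minus[of q1 q2] unfolding less_eq_L1_def Az
    by eventually_elim (auto simp: P_def split: split_indicator_asm)
  then show ?thesis by (simp add: q1_def q2_def)
qed

lemma solves_OP_unique:
  assumes "solves_OP J F w1" "solves_OP J F w2"
  shows "w1 = w2"
proof -
  have "F + A w1 = F + A w2"
    using solves_OP_proj_le assms by (blast intro: antisym)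
  then have "A (w1 - w2) = 0" by (simp add: A_diff)
  then show ?thesis using A_kernel_trivial by fastforce
qed

lemma OP_proj_eq:
  assumes "solves_OP J F w"
  shows "OP_proj J F = F + A w"
proof -
  have "(THE w. solves_OP J F w) = w"
    using assms solves_OP_unique by blast
  then show ?thesis by (simp add: OP_proj_def A_def Let_def)
qed

section \<open>Existence for the obstacle problem\<close>

text \<open>
  Explicit Euler steps of unit length for the Stefan problem: \<open>topple F k\<close> is the excess accumulated
  in \<open>k\<close> steps and \<open>F + A (topple F k)\<close> the state reached, as in a divisible sandpile.
\<close>

primrec topple :: "'a L1 \<Rightarrow> nat \<Rightarrow> 'a L1" where
  "topple F 0 = 0"
| "topple F (Suc k) = topple F k + excess (F + A (topple F k))"

lemma topple_le_Suc: "topple F k \<le> topple F (Suc k)"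
  by (simp add: excess_nonneg)

lemma incseq_topple: "incseq (topple F)"
  by (rule incseq_SucI) (rule topple_le_Suc)

lemma topple_nonneg: "0 \<le> topple F k"
  by (induction k) (simp_all add: excess_nonneg add_nonneg_nonneg)

text \<open>A step first cuts the state \<open>U\<close> down to \<open>min U 1\<close> and then
  adds the nonnegative \<open>J * V\<close>.\<close>

lemma AE_topple_step:
  "AE x in lborel. min (rep_L1 (F + A (topple F k)) x) 1 \<le> rep_L1 (F + A (topple F (Suc k))) x"
proof -
  define U V where "U = F + A (topple F k)" and "V = excess U"
  have "F + A (topple F (Suc k)) = U + A V"
    by (simp add: U_def V_def A_plus add.assoc)
  moreover have "AE x in lborel. min (rep_L1 U x) 1 \<le> rep_L1 (U + A V) x"
    using AE_rep_plus[of U "A V"] AE_rep_minus[of "L1_conv J V" V] AE_rep_excess[of U]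
      AE_nonneg_L1[OF conv_nonneg[OF excess_nonneg[of U]]]
    unfolding A_def V_def[symmetric]
    by eventually_elim auto
  ultimately show ?thesis by (simp only: U_def)
qed

lemma AE_topple_mono:
  assumes "k \<le> m"
  shows "AE x in lborel. min (rep_L1 (F + A (topple F k)) x) 1 \<le> rep_L1 (F + A (topple F m)) x"
  using assms
proof (induction m rule: dec_induct)
  case base
  show ?case by simp
next
  case (step m)
  from step.IH AE_topple_step[of F m] show ?case by eventually_elim simp
qed

lemma topple_state_nonneg:
  assumes "0 \<le> F" shows "0 \<le> F + A (topple F k)"
proof (rule nonneg_L1_I)
  have "F + A (topple F 0) = F" by (simp add: A_def conv_zero)
  with AE_topple_mono[of 0 k F]
  have "AE x in lborel. min (rep_L1 F x) 1 \<le> rep_L1 (F + A (topple F k)) x" by simp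
  then show "AE x in lborel. 0 \<le> rep_L1 (F + A (topple F k)) x"
    using AE_nonneg_L1[OF assms] by eventually_elim simp
qed

text \<open>When a point topples its state exceeds 1, and \<open>AE_topple_step\<close> keeps it at
  least 1 from then on. This is the source of the complementarity condition in the limit.\<close>

lemma AE_topple_pos:
  "AE x in lborel. 0 < rep_L1 (topple F k) x \<longrightarrow> 1 \<le> rep_L1 (F + A (topple F k)) x"
proof (induction k)
  case 0
  show ?case using AE_rep_zero unfolding topple.simps by eventually_elim simp
next
  case (Suc k)
  have e: "AE x in lborel. rep_L1 (topple F (Suc k)) x =
      rep_L1 (topple F k) x + rep_L1 (excess (F + A (topple F k))) x"
    using AE_rep_plus by simp
  from Suc e AE_rep_excess[of "F + A (topple F k)"] AE_topple_step[of F k]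
  show ?case by eventually_elim (auto simp: max_def min_def split: if_splits)
qed

text \<open>The solution is the limit \<open>w\<close> of the increasing, bounded sequence
  \<open>topple F\<close>; the obstacle conditions are obtained by passing to the limit.\<close>

lemma ex_solves_OP:
  assumes F: "0 \<le> F" and bd: "\<And>k. L1_int (topple F k) \<le> B"
  shows "\<exists>w. solves_OP J F w"
proof -
  obtain w where w: "topple F \<longlonglongrightarrow> w"
    using L1_mono_bounded_convergent[of "topple F" B] topple_le_Suc bd by blast
  define U where "U k = F + A (topple F k)" for k
  have U: "U \<longlonglongrightarrow> F + A w"
    unfolding U_def by (intro tendsto_intros bounded_linear.tendsto[OF bounded_linear_A] w)
  \<comment> \<open>The excesses are the increments of a convergent sequence, hence tend to 0; by
    continuity the limit state has no excess.\<close>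
  have "(\<lambda>k. excess (U k)) \<longlonglongrightarrow> excess (F + A w)"
    using continuous_on_nonexpansive[OF norm_excess_diff_le, of UNIV] U
    by (rule continuous_on_tendsto_compose) auto
  moreover have "(\<lambda>k. topple F (Suc k) - topple F k) \<longlonglongrightarrow> w - w"
    using w by (intro tendsto_diff LIMSEQ_Suc)
  then have "(\<lambda>k. excess (U k)) \<longlonglongrightarrow> 0" by (simp add: U_def)
  ultimately have "excess (F + A w) = 0" by (rule LIMSEQ_unique)
  with AE_rep_excess[of "F + A w"]
  have "AE x in lborel. rep_L1 0 x = max (rep_L1 (F + A w) x - 1) 0" by simp
  then have le1: "AE x in lborel. rep_L1 (F + A w) x \<le> 1"
    using AE_rep_zero by eventually_elim simp
  have w_ge: "topple F k \<le> w" for k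
  proof -
    have "\<forall>\<^sub>F m in sequentially. 0 \<le> topple F m - topple F k"
      by (rule eventually_sequentiallyI[of k]) (simp add: incseqD[OF incseq_topple])
    then have "0 \<le> w - topple F k"
      using w by (intro nonneg_L1_LIMSEQ[of "\<lambda>m. topple F m - topple F k"] tendsto_intros)
    then show ?thesis by simp
  qed
  have wn: "0 \<le> w" using w_ge[of 0] by simp
  have q: "0 \<le> F + A w"
    by (rule nonneg_L1_LIMSEQ[OF U]) (simp add: U_def topple_state_nonneg[OF F])
  have ge1: "AE x in lborel. min (rep_L1 (U k) x) 1 \<le> rep_L1 (F + A w) x" for k
  proof -
    define g where "g = U k - excess (U k)"
    have g: "AE x in lborel. rep_L1 g x = min (rep_L1 (U k) x) 1"
      using AE_rep_minus[of "U k" "excess (U k)"] AE_rep_excess[of "U k"]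
      unfolding g_def by eventually_elim auto
    have "\<forall>\<^sub>F m in sequentially. 0 \<le> U m - g"
    proof (rule eventually_sequentiallyI[of k])
      fix m assume "k \<le> m"
      from AE_topple_mono[OF this, of F, folded U_def] g
      have "g \<le> U m" unfolding less_eq_L1_def by eventually_elim simp
      then show "0 \<le> U m - g" by simp
    qed
    then have "0 \<le> F + A w - g"
      using U by (intro nonneg_L1_LIMSEQ[of "\<lambda>m. U m - g"] tendsto_intros)
    then have "g \<le> F + A w" by simp
    with g show ?thesis unfolding less_eq_L1_def by eventually_elim simp
  qed
  have pos: "AE x in lborel. 0 < rep_L1 (topple F k) x \<longrightarrow> 1 \<le> rep_L1 (F + A w) x" for k
    using AE_topple_pos[of F k] ge1[of k, unfolded U_def] by eventually_elim auto
  \<comment> \<open>On the unsaturated set \<open>B\<close> no \<open>topple F k\<close> is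
    positive, so the integral of \<open>w\<close> over \<open>B\<close> is at most
    \<open>norm (w - topple F k)\<close>, which tends to 0.\<close>
  define B where "B = {x. rep_L1 (F + A w) x < 1}"
  have B[measurable]: "B \<in> sets borel" unfolding B_def by measurable
  have "(\<integral>x. rep_L1 w x * indicator B x \<partial>lborel) \<le> 0"
  proof (rule LIMSEQ_le_const)
    show "(\<lambda>k. norm (w - topple F k)) \<longlonglongrightarrow> 0"
      using tendsto_diff[OF tendsto_const w, of w] by (simp add: tendsto_norm_zero)
    have "(\<integral>x. rep_L1 w x * indicator B x \<partial>lborel) \<le> norm (w - topple F k)" for k
      unfolding norm_L1_eq
    proof (rule integral_mono_AE)
      show "integrable lborel (\<lambda>x. rep_L1 w x * indicator B x)"
        by (rule integrable_mult_bounded[where C = 1]) (auto split: split_indicator)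
      show "AE x in lborel. rep_L1 w x * indicator B x \<le> \<bar>rep_L1 (w - topple F k) x\<bar>"
        using AE_rep_minus[of w "topple F k"] pos[of k]
        by eventually_elim (auto simp: B_def split: split_indicator)
    qed auto
    then show "\<exists>N. \<forall>n\<ge>N. (\<integral>x. rep_L1 w x * indicator B x \<partial>lborel) \<le> norm (w - topple F n)"
      by blast
  qed
  moreover have nn: "AE x in lborel. 0 \<le> rep_L1 w x * indicator B x"
    using AE_nonneg_L1[OF wn] by eventually_elim simp
  moreover have "integrable lborel (\<lambda>x. rep_L1 w x * indicator B x)"
    by (rule integrable_mult_bounded[where C = 1]) (auto split: split_indicator)
  moreover have "0 \<le> (\<integral>x. rep_L1 w x * indicator B x \<partial>lborel)"
    using nn by (rule integral_nonneg_AE)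
  ultimately have "AE x in lborel. rep_L1 w x * indicator B x = 0"
    by (subst integral_nonneg_eq_0_iff_AE[symmetric]) auto
  with le1 have "AE x in lborel. rep_L1 (F + A w) x \<le> 1 \<and> (0 < rep_L1 w x \<longrightarrow> rep_L1 (F + A w) x = 1)"
    by eventually_elim (auto simp: B_def split: split_indicator_asm)
  with wn q show ?thesis unfolding solves_OP_iff by blast
qed

text \<open>Least action principle: a step replaces \<open>T\<close> by the maximum of
  \<open>T\<close> and \<open>F + J * T - 1\<close>, and the latter is at most
  \<open>F + J * W - 1 \<le> W\<close>.\<close>

lemma topple_le_supersolution:
  assumes W: "0 \<le> W" "AE x in lborel. rep_L1 (F + A W) x \<le> 1"
  shows "topple F k \<le> W"
proof (induction k)
  case (Suc k)
  let ?T = "topple F k"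
  have c: "L1_conv J ?T \<le> L1_conv J W" by (rule conv_mono[OF Suc])
  show ?case
    using Suc c W(2) AE_rep_plus[of F "A W"] AE_rep_plus[of F "A ?T"] AE_rep_minus[of "L1_conv J W" W]
      AE_rep_minus[of "L1_conv J ?T" ?T] AE_rep_excess[of "F + A ?T"]
      AE_rep_plus[of ?T "excess (F + A ?T)"]
    unfolding less_eq_L1_def A_def topple.simps by eventually_elim auto
qed (simp add: W)

section \<open>Compactly supported supersolutions for data below a barrier\<close>

lemma AE_rep_conv_abs:
  assumes h: "integrable lborel h"
  shows "AE x in lborel. rep_L1 (L1_conv J (abs_L1 h)) x = avg J h x"
  using AE_rep_conv[OF J_integrable, of "abs_L1 h"]
proof eventually_elim
  case (elim x)
  have [measurable]: "h \<in> borel_measurable borel" using borel_measurable_integrable[OF h] by simp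
  have "(\<integral>y. J (x - y) * rep_L1 (abs_L1 h) y \<partial>lborel) = (\<integral>y. J (x - y) * h y \<partial>lborel)"
  proof (rule integral_cong_AE)
    show "AE y in lborel. J (x - y) * rep_L1 (abs_L1 h) y = J (x - y) * h y"
      using AE_rep_abs_L1[OF h] by eventually_elim simp
  qed auto
  also have "\<dots> = (\<integral>z. J (x - (x + z)) * h (x + z) \<partial>lborel)"
    by (rule lborel_integral_translate[symmetric])
  also have "\<dots> = avg J h x" by (simp add: avg_def J_even)
  finally show ?case using elim by simp
qed

lemma avg_mono_on_support:
  assumes "\<And>z. J z \<noteq> 0 \<Longrightarrow> \<phi> (x + z) \<le> \<psi> (x + z)"
    and "integrable lborel (\<lambda>z. J z * \<phi> (x + z))" "integrable lborel (\<lambda>z. J z * \<psi> (x + z))"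
  shows "avg J \<phi> x \<le> avg J \<psi> x"
  unfolding avg_def
proof (rule integral_mono[OF assms(2,3)])
  show "J z * \<phi> (x + z) \<le> J z * \<psi> (x + z)" for z
    using assms(1)[of z] by (cases "J z = 0") (auto intro: mult_left_mono)
qed

lemma integrable_J_cont_shift:
  assumes "continuous_on UNIV \<phi>"
  shows "integrable lborel (\<lambda>z. J z * \<phi> (x + z))"
  by (rule integrable_J_cont) (rule continuous_on_compose2[OF assms], auto intro!: continuous_intros)

text \<open>Since \<open>J\<close> is even, \<open>z\<close> and \<open>- z\<close> can be averaged
  together; first-order terms cancel and only symmetric second differences of \<open>\<phi>\<close>
  remain.\<close>

lemma avg_minus_le:
  assumes \<phi>: "continuous_on UNIV \<phi>" and \<psi>: "continuous_on UNIV \<psi>"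
    and le: "\<And>z. J z \<noteq> 0 \<Longrightarrow> \<phi> (x + z) + \<phi> (x - z) - 2 * \<phi> x \<le> 2 * \<psi> z"
  shows "avg J \<phi> x - \<phi> x \<le> (\<integral>z. J z * \<psi> z \<partial>lborel)"
proof -
  have [measurable]: "\<phi> \<in> borel_measurable borel"
    using \<phi> by (rule borel_measurable_continuous_onI)
  note i = integrable_J_cont_shift[OF \<phi>, of x]
  have i': "integrable lborel (\<lambda>z. J z * \<phi> (x - z))"
    by (rule integrable_J_cont) (rule continuous_on_compose2[OF \<phi>], auto intro!: continuous_intros)
  have "avg J \<phi> x = (\<integral>z. J (- z) * \<phi> (x + - z) \<partial>lborel)"
    unfolding avg_def by (rule lborel_integral_reflect[symmetric]) simp
  then have "avg J \<phi> x = (\<integral>z. J z * \<phi> (x - z) \<partial>lborel)"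
    by (simp add: J_even)
  then have "2 * (avg J \<phi> x - \<phi> x) =
      (\<integral>z. J z * \<phi> (x + z) + J z * \<phi> (x - z) - J z * (2 * \<phi> x) \<partial>lborel)"
    using i i' by (simp add: avg_def)
  also have "\<dots> \<le> (\<integral>z. 2 * (J z * \<psi> z) \<partial>lborel)"
  proof (rule integral_mono)
    show "integrable lborel (\<lambda>z. J z * \<phi> (x + z) + J z * \<phi> (x - z) - J z * (2 * \<phi> x))"
      using i i' by simp
    show "integrable lborel (\<lambda>z. 2 * (J z * \<psi> z))"
      using integrable_J_cont[OF \<psi>] by simp
    show "J z * \<phi> (x + z) + J z * \<phi> (x - z) - J z * (2 * \<phi> x) \<le> 2 * (J z * \<psi> z)" for z
    proof (cases "J z = 0")
      case False
      from mult_left_mono[OF le[OF this] J_nonneg[of z]] show ?thesis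
        by (simp add: algebra_simps)
    qed simp
  qed
  finally show ?thesis by simp
qed

lemma second_moment_pos: "0 < (\<integral>z. J z * (norm z)\<^sup>2 \<partial>lborel)"
proof -
  obtain b :: 'a where b: "b \<in> Basis" using nonempty_Basis by blast
  have "(\<integral>z. J z * (z \<bullet> b)\<^sup>2 \<partial>lborel) \<le> (\<integral>z. J z * (norm z)\<^sup>2 \<partial>lborel)"
  proof (intro integral_mono integrable_J_cont mult_left_mono J_nonneg)
    show "(z \<bullet> b)\<^sup>2 \<le> (norm z)\<^sup>2" for z :: 'a
      using power_mono[OF Basis_le_norm[OF b, of z], of 2] by simp
  qed (intro continuous_intros)+
  with moment_pos[OF b] show ?thesis by linarith
qed

text \<open>If both displaced points lie in the ball of radius \<open>R\<close>, the parallelogram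
  law leaves \<open>2 * d^2 - 2 * R * (p + m - 2 * a)\<close>, and \<open>p + m \<ge> 2 * a\<close>.
  If one lies outside, its term vanishes and the other is bounded through
  \<open>(s + d)^2 \<le> 2 * s^2 + 2 * d^2\<close>.\<close>

lemma quadratic_bump_second_difference:
  fixes x z :: "'b::real_inner" and R :: real
  defines "\<phi> \<equiv> \<lambda>x. (max (R - norm x) 0)\<^sup>2"
  shows "\<phi> (x + z) + \<phi> (x - z) - 2 * \<phi> x \<le> 2 * (norm z)\<^sup>2"
proof -
  define p m a d where "p = norm (x + z)" and "m = norm (x - z)" and "a = norm x" and "d = norm z"
  have par: "p\<^sup>2 + m\<^sup>2 = 2 * a\<^sup>2 + 2 * d\<^sup>2"
    by (simp add: p_def m_def a_def d_def power2_norm_eq_inner algebra_simps inner_commute)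
  have tri: "2 * a \<le> p + m"
  proof -
    have "2 * a = norm ((x + z) + (x - z))" by (simp add: a_def flip: scaleR_2)
    also have "\<dots> \<le> p + m" unfolding p_def m_def by (rule norm_triangle_ineq)
    finally show ?thesis .
  qed
  have da: "a - d \<le> p" "a - d \<le> m"
    using norm_diff_ineq[of x z] norm_triangle_ineq2[of x z] by (simp_all add: a_def d_def p_def m_def)
  have d0: "0 \<le> d" "0 \<le> p" "0 \<le> m" "0 \<le> a" by (simp_all add: d_def p_def m_def a_def)
  have one: "(max (R - q) 0)\<^sup>2 \<le> 2 * (max (R - a) 0)\<^sup>2 + 2 * d\<^sup>2" if "a - d \<le> q" for q
  proof -
    have "max (R - q) 0 \<le> max (R - a) 0 + d" using that d0 by auto
    then have "(max (R - q) 0)\<^sup>2 \<le> (max (R - a) 0 + d)\<^sup>2" by (intro power_mono) auto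
    also have "\<dots> \<le> 2 * (max (R - a) 0)\<^sup>2 + 2 * d\<^sup>2"
      using sum_squares_bound[of "max (R - a) 0" d] by (simp add: power2_sum)
    finally show ?thesis .
  qed
  have "(max (R - p) 0)\<^sup>2 + (max (R - m) 0)\<^sup>2 - 2 * (max (R - a) 0)\<^sup>2 \<le> 2 * d\<^sup>2"
  proof (cases "p \<le> R \<and> m \<le> R")
    case True
    then have "a \<le> R" using tri by linarith
    have R0: "0 \<le> R" using True d0 by linarith
    have "(R - p)\<^sup>2 + (R - m)\<^sup>2 - 2 * (R - a)\<^sup>2 = 2 * d\<^sup>2 - 2 * R * (p + m - 2 * a)"
      using par by (simp add: power2_diff algebra_simps)
    also have "\<dots> \<le> 2 * d\<^sup>2" using R0 tri by simp
    finally show ?thesis using True \<open>a \<le> R\<close> by (simp add: max_absorb1)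
  next
    case False
    then consider "R < p" | "R < m" by linarith
    then show ?thesis
    proof cases
      case 1
      with one[OF da(2)] show ?thesis by simp
    next
      case 2
      with one[OF da(1)] show ?thesis by simp
    qed
  qed
  then show ?thesis by (simp add: \<phi>_def p_def m_def a_def d_def)
qed

text \<open>
  The supersolution glues the cap \<open>w1\<close>, which absorbs the large values of \<open>g\<close> near the origin, to
  the bump \<open>w2\<close>, whose vanishing slope at its boundary is compatible with \<open>g \<le> 1/2\<close> far out.
\<close>

lemma ex_supersolution:
  fixes g :: "'a \<Rightarrow> real"
  assumes M: "\<And>x. g x \<le> M" and R0: "0 < R0" and half: "\<And>x. R0 < norm x \<Longrightarrow> g x \<le> 1/2"
  obtains W where "0 \<le> W"
    "\<And>F. AE x in lborel. rep_L1 F x \<le> g x \<Longrightarrow> AE x in lborel. rep_L1 (F + A W) x \<le> 1"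
proof -
  obtain r where r: "0 < r" "\<And>z. J z \<noteq> 0 \<Longrightarrow> norm z \<le> r" using J_support by blast
  define s where "s = (\<integral>z. J z * (norm z)\<^sup>2 \<partial>lborel)"
  have s0: "0 < s" unfolding s_def by (rule second_moment_pos)
  have int2: "integrable lborel (\<lambda>z. J z * (norm z)\<^sup>2)"
    by (rule integrable_J_cont) (intro continuous_intros)
  have sr: "s \<le> r\<^sup>2"
  proof -
    have "s \<le> (\<integral>z. J z * r\<^sup>2 \<partial>lborel)"
      unfolding s_def
    proof (rule integral_mono[OF int2])
      show "J z * (norm z)\<^sup>2 \<le> J z * r\<^sup>2" for z
        using r(2)[of z] by (cases "J z = 0") (auto intro!: mult_left_mono power_mono)
    qed simp
    then show ?thesis by simp
  qed
  \<comment> \<open>The average of the cap drops by \<open>M' * s = max M 0\<close>, while that of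
    the bump rises by at most \<open>c * s \<le> 1/2\<close>. \<open>T\<close> exceeds
    \<open>\<rho>\<close> by one jump length \<open>r\<close>. The height \<open>L\<close> puts the
    cap below the bump up to radius \<open>R0\<close>, and the size of \<open>R\<close> puts the
    bump below the cap between \<open>2 * R0\<close> and \<open>T\<close>.\<close>
  define M' where "M' = max M 0 / s"
  define c where "c = 1 / (2 * r\<^sup>2)"
  define \<rho> where "\<rho> = 2 * R0 + r"
  define T where "T = 2 * R0 + 2 * r"
  define R where "R = 4 * R0 + T + (c + M') * T\<^sup>2 / (2 * c * R0)"
  define L where "L = c * R\<^sup>2 - 2 * c * R * R0"
  define w1 where "w1 x = L - M' * (norm x)\<^sup>2" for x :: 'a
  define w2 where "w2 x = c * (max (R - norm x) 0)\<^sup>2" for x :: 'a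
  define h where "h x = (if norm x \<le> \<rho> then min (w1 x) (w2 x) else w2 x)" for x :: 'a
  have c0: "0 < c" and M'0: "0 \<le> M'" and T0: "0 < T" using r s0 R0 by (auto simp: c_def M'_def T_def)
  have q0: "0 \<le> (c + M') * T\<^sup>2 / (2 * c * R0)" using c0 M'0 R0 by simp
  have RT: "T \<le> R" "4 * R0 \<le> R" using q0 R0 T0 by (auto simp: R_def)
  have RR: "(c + M') * T\<^sup>2 \<le> 2 * c * R * R0"
  proof -
    have "(c + M') * T\<^sup>2 / (2 * c * R0) \<le> R" using R0 T0 by (simp add: R_def)
    then show ?thesis using c0 R0 by (simp add: divide_le_eq mult_ac)
  qed
  have w1_le_w2: "w1 x \<le> w2 x" if "norm x \<le> R0" for x
  proof -
    have "R * norm x \<le> R * R0" using that RT R0 by (intro mult_left_mono) auto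
    then have "R\<^sup>2 - 2 * (R * R0) \<le> (R - norm x)\<^sup>2"
      using zero_le_power2[of "norm x"] unfolding power2_diff by linarith
    then have "c * (R\<^sup>2 - 2 * (R * R0)) \<le> c * (R - norm x)\<^sup>2"
      using c0 by (intro mult_left_mono) auto
    moreover have "max (R - norm x) 0 = R - norm x" using that RT R0 by simp
    moreover have "0 \<le> M' * (norm x)\<^sup>2" using M'0 by simp
    ultimately show ?thesis by (simp add: w1_def w2_def L_def algebra_simps)
  qed
  have w2_le_w1: "w2 x \<le> w1 x" if "2 * R0 \<le> norm x" "norm x \<le> T" for x
  proof -
    have m: "max (R - norm x) 0 = R - norm x" using that RT by simp
    have 1: "(c + M') * (norm x)\<^sup>2 \<le> (c + M') * T\<^sup>2"
      using that c0 M'0 by (intro mult_left_mono power_mono) auto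
    have "2 * c * R * (2 * R0) \<le> 2 * c * R * norm x"
      using that(1) c0 RT R0 by (intro mult_left_mono) auto
    with 1 RR show ?thesis unfolding w1_def w2_def L_def m power2_diff by (simp add: algebra_simps)
  qed
  have w1_nonneg: "0 \<le> w1 x" if "norm x \<le> \<rho>" for x
  proof -
    have "norm x \<le> T" using that r by (simp add: \<rho>_def T_def)
    then have "M' * (norm x)\<^sup>2 \<le> (c + M') * T\<^sup>2"
      using c0 M'0 by (intro mult_mono power_mono) auto
    moreover have "c * R * (4 * R0) \<le> c * R * R" using c0 RT R0 by (intro mult_left_mono) auto
    ultimately show ?thesis using RR by (simp add: w1_def L_def power2_eq_square algebra_simps)
  qed
  have w2_nonneg: "0 \<le> w2 x" for x using c0 by (simp add: w2_def)
  have h0: "0 \<le> h x" for x using w1_nonneg[of x] w2_nonneg[of x] by (simp add: h_def)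
  have hw2: "h x \<le> w2 x" for x by (simp add: h_def)
  have hw1: "h x \<le> w1 x" if "norm x \<le> T" for x
    using w2_le_w1[OF _ that] r by (auto simp: h_def \<rho>_def)
  have cont: "continuous_on UNIV w1" "continuous_on UNIV w2"
    unfolding w1_def w2_def by (intro continuous_intros)+
  have [measurable]: "w1 \<in> borel_measurable borel" "w2 \<in> borel_measurable borel"
    using cont by (auto intro: borel_measurable_continuous_onI)
  have hm[measurable]: "h \<in> borel_measurable borel" unfolding h_def by measurable
  have w2_ind: "w2 x \<le> c * R\<^sup>2 * indicator (cball 0 R) x" for x
  proof (cases "norm x \<le> R")
    case True
    then show ?thesis using c0 by (auto simp: w2_def intro!: mult_left_mono power_mono)
  next
    case False
    then show ?thesis by (simp add: w2_def)
  qed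
  have hi: "integrable lborel h"
  proof (rule Bochner_Integration.integrable_bound)
    show "integrable lborel (\<lambda>x::'a. c * R\<^sup>2 * indicator (cball 0 R) x)"
      using emeasure_lborel_cball_finite[of "0::'a" R]
      by (intro integrable_mult_right integrable_real_indicator) auto
    show "AE x in lborel. norm (h x) \<le> norm (c * R\<^sup>2 * indicator (cball 0 R) x)"
    proof (rule AE_I2)
      show "norm (h x) \<le> norm (c * R\<^sup>2 * indicator (cball 0 R) x)" for x
        using h0[of x] hw2[of x] w2_ind[of x] by simp
    qed
  qed simp
  have hb: "\<bar>h x\<bar> \<le> c * R\<^sup>2" for x
  proof -
    have "c * R\<^sup>2 * indicator (cball 0 R) x \<le> c * R\<^sup>2" using c0 by (simp split: split_indicator)
    then show ?thesis using h0[of x] hw2[of x] w2_ind[of x] by linarith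
  qed
  note hint = integrable_J_mult[OF hm hb]
  \<comment> \<open>Where \<open>h\<close> equals one of the two profiles, that profile majorises
    \<open>h\<close> at every point within reach of a jump, so its own average bounds that of
    \<open>h\<close>. On the bump side \<open>x\<close> lies outside the ball of radius
    \<open>R0\<close>, where \<open>g \<le> 1/2\<close>.\<close>
  have key: "g x + (avg J h x - h x) \<le> 1" for x
  proof (cases "norm x \<le> \<rho> \<and> w1 x \<le> w2 x")
    case True
    have "avg J h x \<le> avg J w1 x"
    proof (rule avg_mono_on_support[OF _ hint integrable_J_cont_shift[OF cont(1)]])
      fix z assume "J z \<noteq> 0"
      then have "norm (x + z) \<le> T"
        using norm_triangle_ineq[of x z] r(2)[of z] True by (simp add: \<rho>_def T_def)
      then show "h (x + z) \<le> w1 (x + z)" by (rule hw1)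
    qed
    moreover have "avg J w1 x - w1 x \<le> (\<integral>z. J z * (- M' * (norm z)\<^sup>2) \<partial>lborel)"
    proof (rule avg_minus_le[OF cont(1)])
      show "w1 (x + z) + w1 (x - z) - 2 * w1 x \<le> 2 * (- M' * (norm z)\<^sup>2)" for z
        by (simp add: w1_def power2_norm_eq_inner algebra_simps inner_commute)
    qed (intro continuous_intros)
    moreover have "(\<integral>z. J z * (- M' * (norm z)\<^sup>2) \<partial>lborel) = - M' * s"
      unfolding s_def by (subst integral_mult_right_zero[symmetric]) (simp add: mult_ac)
    moreover have "M' * s = max M 0" using s0 by (simp add: M'_def)
    ultimately show ?thesis using True M[of x] by (simp add: h_def)
  next
    case False
    then have hx: "h x = w2 x" by (auto simp: h_def)
    have xR: "R0 < norm x"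
    proof (rule ccontr)
      assume "\<not> R0 < norm x"
      then have "norm x \<le> \<rho>" "w1 x \<le> w2 x"
        using w1_le_w2[of x] R0 r by (simp_all add: \<rho>_def)
      with False show False by blast
    qed
    have "avg J h x \<le> avg J w2 x"
      by (rule avg_mono_on_support[OF hw2 hint integrable_J_cont_shift[OF cont(2)]])
    moreover have "avg J w2 x - w2 x \<le> (\<integral>z. J z * (c * (norm z)\<^sup>2) \<partial>lborel)"
    proof (rule avg_minus_le[OF cont(2)])
      show "w2 (x + z) + w2 (x - z) - 2 * w2 x \<le> 2 * (c * (norm z)\<^sup>2)" for z
        using mult_left_mono[OF quadratic_bump_second_difference[where x = x and z = z and R = R], of c] c0
        by (simp add: w2_def algebra_simps)
    qed (intro continuous_intros)
    moreover have "(\<integral>z. J z * (c * (norm z)\<^sup>2) \<partial>lborel) = c * s"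
      unfolding s_def by (subst integral_mult_right_zero[symmetric]) (simp add: mult_ac)
    moreover have "c * s \<le> 1/2" using sr c0 r(1) by (simp add: c_def field_simps)
    ultimately show ?thesis using hx half[OF xR] by simp
  qed
  show ?thesis
  proof
    show "0 \<le> abs_L1 h"
    proof (rule nonneg_L1_I)
      show "AE x in lborel. 0 \<le> rep_L1 (abs_L1 h) x"
        using AE_rep_abs_L1[OF hi] by eventually_elim (simp add: h0)
    qed
    show "AE x in lborel. rep_L1 (F + A (abs_L1 h)) x \<le> 1"
      if "AE x in lborel. rep_L1 F x \<le> g x" for F
      using that AE_rep_plus[of F "A (abs_L1 h)"] AE_rep_minus[of "L1_conv J (abs_L1 h)" "abs_L1 h"]
        AE_rep_conv_abs[OF hi] AE_rep_abs_L1[OF hi] unfolding A_def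
    proof eventually_elim
      case (elim x)
      with key[of x] show ?case by simp
    qed
  qed
qed

lemma ex_solves_OP_barrier:
  assumes F: "0 \<le> F" and g: "radial_barrier g" and le: "AE x in lborel. rep_L1 F x \<le> g x"
  shows "\<exists>w. solves_OP J F w"
proof -
  have "\<forall>\<^sub>F x in at_infinity. g x < 1/2"
    using g unfolding radial_barrier_def by (intro order_tendstoD(2)[of g 0]) simp_all
  then obtain b where b: "\<And>x. b \<le> norm x \<Longrightarrow> g x < 1/2"
    unfolding eventually_at_infinity by blast
  then have half: "\<And>x. max b 1 < norm x \<Longrightarrow> g x \<le> 1/2"
    by (meson less_imp_le max.strict_boundedE)
  have g0: "g x \<le> g 0" for x
  proof (cases "x = 0")
    case False
    then have "norm (0::'a) < norm x" by simp
    then have "g x < g 0" using g unfolding radial_barrier_def by blast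
    then show ?thesis by simp
  qed simp
  have "0 < max b 1" by simp
  obtain W where W: "0 \<le> W"
      "\<And>F. AE x in lborel. rep_L1 F x \<le> g x \<Longrightarrow> AE x in lborel. rep_L1 (F + A W) x \<le> 1"
    using ex_supersolution[of g, OF g0 \<open>0 < max b 1\<close> half] by blast
  have "L1_int (topple F k) \<le> L1_int W" for k
    by (intro L1_int_mono topple_le_supersolution W le)
  with F show ?thesis by (rule ex_solves_OP)
qed

end

section \<open>A bounded superharmonic function in dimension at least three\<close>

lemma powr_neg_quarter_le:
  fixes y :: real
  assumes "- 3 / 20 \<le> y"
  shows "(1 + y) powr (- 1 / 4) \<le> 1 - y / 4 + 9 / 50 * y\<^sup>2"
proof -
  \<comment> \<open>With \<open>y = t^4 - 1\<close> the claim is polynomial in \<open>t\<close> and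
    contains the factor \<open>(t - 1)^2\<close>; the cofactor is nonnegative for
    \<open>t \<ge> 24/25\<close>, which \<open>y \<ge> -3/20\<close> ensures. The slack of 9/50 over
    the Taylor coefficient 5/32 pays for this range of \<open>y\<close>.\<close>
  define t where "t = (1 + y) powr (1 / 4)"
  have t0: "0 < t" using assms by (simp add: t_def)
  have t4: "t ^ 4 = 1 + y"
    using assms by (simp add: t_def powr_powr flip: powr_numeral)
  have t: "24 / 25 \<le> t"
  proof (rule power_le_imp_le_base[of _ 3])
    show "(24 / 25) ^ Suc 3 \<le> t ^ Suc 3"
      using assms t4 by (simp add: power_divide)
  qed (use t0 in simp)
  have p2: "24 / 25 * t \<le> t ^ 2" using mult_right_mono[OF t, of t] t0 by (simp add: power2_eq_square)
  have p4: "849 / 1000 \<le> t ^ 4" using t4 assms by simp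
  have p5: "849 / 1000 * t \<le> t ^ 5" using mult_right_mono[OF p4, of t] t0 by (simp add: eval_nat_numeral)
  have p6: "849 / 1000 * t ^ 2 \<le> t ^ 6"
    using mult_right_mono[OF p4, of "t ^ 2"] by (simp add: power_add[symmetric])
  have p7: "849 / 1000 * t ^ 3 \<le> t ^ 7"
    using mult_right_mono[OF p4, of "t ^ 3"] t0 by (simp add: power_add[symmetric])
  have p3: "884 / 1000 \<le> t ^ 3" using power_mono[OF t, of 3] by (simp add: power_divide)
  have "0 \<le> 18 / 25 * (t + 2 * t ^ 2 + 3 * t ^ 3 + 4 * t ^ 4 + 3 * t ^ 5 + 2 * t ^ 6 + t ^ 7)
      - (t ^ 3 + 2 * t ^ 2 + 3 * t + 4)"
    unfolding distrib_left using p2 p3 p4 p5 p6 p7 t by linarith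
  then have "0 \<le> (t - 1)\<^sup>2 * (18 / 25 * (t + 2 * t ^ 2 + 3 * t ^ 3 + 4 * t ^ 4 + 3 * t ^ 5 + 2 * t ^ 6 + t ^ 7)
      - (t ^ 3 + 2 * t ^ 2 + 3 * t + 4))"
    by (intro mult_nonneg_nonneg zero_le_power2)
  also have "\<dots> = 4 * (t * (1 - (t ^ 4 - 1) / 4 + 9 / 50 * (t ^ 4 - 1)\<^sup>2) - 1)"
    by (simp add: field_simps eval_nat_numeral)
  finally have "1 \<le> t * (1 - y / 4 + 9 / 50 * y\<^sup>2)" by (simp add: t4)
  then have "1 / t \<le> 1 - y / 4 + 9 / 50 * y\<^sup>2" using t0 by (simp add: divide_le_eq mult.commute)
  moreover have "(1 + y) powr (- 1 / 4) = 1 / t"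
    using powr_minus_divide[of "1 + y" "1 / 4"] by (simp add: t_def)
  ultimately show ?thesis by simp
qed

context kernel begin

definition moment :: "'a \<Rightarrow> real" where
  "moment b = (\<integral>z. J z * (z \<bullet> b)\<^sup>2 \<partial>lborel)"

text \<open>Flipping the sign of the coordinate \<open>b\<close> preserves the radial
  \<open>J\<close> and Lebesgue measure but reverses the integrand.\<close>

lemma mixed_moment_zero:
  assumes b: "b \<in> Basis" "b' \<in> Basis" "b \<noteq> b'"
  shows "(\<integral>z. J z * ((z \<bullet> b) * (z \<bullet> b')) \<partial>lborel) = 0"
proof -
  define c where "c j = (if j = b then - 1 else 1 :: real)" for j
  define S where "S x = (\<Sum>j\<in>Basis. (c j * (x \<bullet> j)) *\<^sub>R j)" for x :: 'a
  have Sj: "S x \<bullet> j = c j * (x \<bullet> j)" if "j \<in> Basis" for x j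
    using that by (simp add: S_def)
  have "norm (S x) = norm x" for x
  proof -
    have "S x \<bullet> S x = x \<bullet> x"
      by (subst (1 2) euclidean_inner) (auto intro!: sum.cong simp: Sj c_def)
    then show ?thesis by (simp add: norm_eq_sqrt_inner)
  qed
  then have JS: "J (S x) = J x" for x by (rule J_radial)
  have [measurable]: "S \<in> borel \<rightarrow>\<^sub>M borel" unfolding S_def by measurable
  have "(\<integral>z. J z * ((z \<bullet> b) * (z \<bullet> b')) \<partial>lborel) =
      (\<integral>z. J z * ((z \<bullet> b) * (z \<bullet> b')) \<partial>distr lborel borel S)"
    unfolding S_def by (subst lborel_distr_signs) (auto simp: c_def)
  also have "\<dots> = (\<integral>z. J (S z) * ((S z \<bullet> b) * (S z \<bullet> b')) \<partial>lborel)"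
    by (rule integral_distr) auto
  also have "\<dots> = - (\<integral>z. J z * ((z \<bullet> b) * (z \<bullet> b')) \<partial>lborel)"
    using b by (simp add: JS Sj c_def)
  finally show ?thesis by simp
qed

text \<open>The inner product of the inverse covariance matrix of \<open>J\<close>, for which
  \<open>J\<close> has identity covariance. Dividing by each moment separately avoids comparing the
  moments of different coordinates.\<close>

definition form :: "'a \<Rightarrow> 'a \<Rightarrow> real" where
  "form x z = (\<Sum>b\<in>Basis. (x \<bullet> b) * (z \<bullet> b) / moment b)"

lemma moment_gt_zero: "b \<in> Basis \<Longrightarrow> 0 < moment b"
  unfolding moment_def by (rule moment_pos)

lemma form_nonneg: "0 \<le> form x x"
  unfolding form_def by (intro sum_nonneg) (auto intro!: divide_nonneg_nonneg less_imp_le[OF moment_gt_zero])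

lemma form_add: "form (x + z) (x + z) = form x x + form z z + 2 * form x z"
  unfolding form_def
  by (simp add: sum_distrib_left flip: sum.distrib)
     (auto intro!: sum.cong simp: inner_add_left add_divide_distrib algebra_simps)

lemma form_continuous: "continuous_on UNIV (\<lambda>x. form x x)" "continuous_on UNIV (form x)"
  unfolding form_def using moment_gt_zero by (fastforce intro!: continuous_intros)+

lemma integral_form_diag: "(\<integral>z. J z * form z z \<partial>lborel) = real DIM('a)"
proof -
  have "(\<integral>z. J z * form z z \<partial>lborel) = (\<integral>z. (\<Sum>b\<in>Basis. J z * (z \<bullet> b)\<^sup>2 / moment b) \<partial>lborel)"
    by (simp add: form_def sum_distrib_left power2_eq_square)
  also have "\<dots> = (\<Sum>b\<in>Basis. (\<integral>z. J z * (z \<bullet> b)\<^sup>2 / moment b \<partial>lborel))"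
    by (intro Bochner_Integration.integral_sum integrable_divide integrable_J_cont)
       (intro continuous_intros)
  also have "\<dots> = (\<Sum>b\<in>(Basis::'a set). 1)"
    using moment_gt_zero by (intro sum.cong) (force simp: moment_def[symmetric])+
  finally show ?thesis by simp
qed

lemma integral_form_odd:
  "(\<integral>z. J z * form x z \<partial>lborel) = 0" "(\<integral>z. J z * (form x z * form z z) \<partial>lborel) = 0"
proof -
  have [measurable]: "form x \<in> borel_measurable borel" "(\<lambda>z. form z z) \<in> borel_measurable borel"
    using form_continuous by (auto intro: borel_measurable_continuous_onI)
  show "(\<integral>z. J z * form x z \<partial>lborel) = 0"
    by (rule avg_odd_zero) (auto simp: form_def sum_negf)
  show "(\<integral>z. J z * (form x z * form z z) \<partial>lborel) = 0"
    by (rule avg_odd_zero[of "\<lambda>z. form x z * form z z"]) (auto simp: form_def sum_negf)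
qed

text \<open>Identity covariance: after expanding the square, only the diagonal terms survive
  \<open>mixed_moment_zero\<close>.\<close>

lemma integral_form_square: "(\<integral>z. J z * (form x z)\<^sup>2 \<partial>lborel) = form x x"
proof -
  define e where "e b = (x \<bullet> b) / moment b" for b
  have i: "integrable lborel (\<lambda>z. J z * ((z \<bullet> b) * (z \<bullet> b')))" for b b'
    by (rule integrable_J_cont) (intro continuous_intros)
  have "(\<integral>z. J z * (form x z)\<^sup>2 \<partial>lborel) =
      (\<integral>z. (\<Sum>b\<in>Basis. \<Sum>b'\<in>Basis. e b * e b' * (J z * ((z \<bullet> b) * (z \<bullet> b')))) \<partial>lborel)"
    by (simp add: form_def e_def power2_eq_square sum_product sum_distrib_left mult_ac)
  also have "\<dots> = (\<Sum>b\<in>Basis. \<Sum>b'\<in>Basis. e b * e b' * (\<integral>z. J z * ((z \<bullet> b) * (z \<bullet> b')) \<partial>lborel))"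
    using i by (subst Bochner_Integration.integral_sum; (subst Bochner_Integration.integral_sum)?) auto
  also have "\<dots> = (\<Sum>b\<in>Basis. \<Sum>b'\<in>Basis. if b' = b then e b * e b * moment b else 0)"
    by (intro sum.cong) (auto simp: mixed_moment_zero moment_def power2_eq_square)
  also have "\<dots> = form x x"
    unfolding form_def e_def
    by (subst sum.delta) (auto intro!: sum.cong dest: moment_gt_zero)
  finally show ?thesis .
qed

text \<open>
  In dimension at least three the power \<open>-1/4\<close> of a positive definite quadratic function is strictly
  superharmonic for the averaging: after expanding to second order, the gain is
  \<open>DIM('a) / 4\<close> and the loss \<open>4 * 9/50 < 3/4\<close>.
\<close>

lemma ex_superharmonic:
  assumes dim: "3 \<le> DIM('a)"
  obtains K :: "'a \<Rightarrow> real" and C c where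
    "continuous_on UNIV K" "\<And>x. 0 \<le> K x" "\<And>x. K x \<le> C" "0 < c"
    "\<And>x. c * J x \<le> K x - avg J K x"
proof -
  obtain r where r: "0 < r" "\<And>z. J z \<noteq> 0 \<Longrightarrow> norm z \<le> r" using J_support by blast
  obtain M where M: "0 < M" "\<And>z. J z \<le> M" using J_bounded by blast
  define Qm where "Qm = (\<Sum>b\<in>(Basis::'a set). r\<^sup>2 / moment b)"
  define Q where "Q = (\<integral>z. J z * (form z z)\<^sup>2 \<partial>lborel)"
  \<comment> \<open>The summand \<open>40 * Qm\<close> keeps the relative increment
    \<open>h z / s\<close> above -3/20 on the support of \<open>J\<close>; \<open>9 * Q\<close> lets
    \<open>s\<close> dominate the fourth-order term.\<close>
  define a where "a = 1 + 40 * Qm + 9 * Q"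
  define K where "K x = (a + form x x) powr (- 1 / 4)" for x :: 'a
  define S where "S = a + Qm"
  define \<kappa> where "\<kappa> = S powr (- 1 / 4) * (1 / (100 * S))"
  have Qm: "form z z \<le> Qm" if "norm z \<le> r" for z
    unfolding form_def Qm_def
  proof (rule sum_mono)
    fix b :: 'a assume b: "b \<in> Basis"
    have "(z \<bullet> b)\<^sup>2 \<le> r\<^sup>2"
      using power_mono[OF order.trans[OF Basis_le_norm[OF b, of z] that], of 2] by simp
    then show "(z \<bullet> b) * (z \<bullet> b) / moment b \<le> r\<^sup>2 / moment b"
      using moment_gt_zero[OF b] by (simp add: divide_right_mono power2_eq_square)
  qed
  have Qm0: "0 \<le> Qm" using Qm[of 0] r by (simp add: form_def)
  have Q0: "0 \<le> Q" unfolding Q_def by simp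
  have a1: "1 \<le> a" using Qm0 Q0 by (simp add: a_def)
  have spos: "1 \<le> a + form x x" for x using a1 form_nonneg[of x] by linarith
  have ne: "a + form x x \<noteq> 0" for x using spos[of x] by linarith
  have Kc: "continuous_on UNIV K"
    unfolding K_def using spos form_continuous(1)
    by (intro continuous_on_powr continuous_intros) (auto simp: ne)
  have K01: "0 \<le> K x" "K x \<le> 1" for x
  proof -
    show "0 \<le> K x" by (simp add: K_def)
    have "(a + form x x) powr (- 1 / 4) \<le> (a + form x x) powr 0"
      by (rule powr_mono) (use spos in auto)
    then show "K x \<le> 1" using spos[of x] by (simp add: K_def)
  qed
  have main: "avg J K x \<le> K x - K x * (1 / (100 * (a + form x x)))" for x
  proof -
    define s where "s = a + form x x"
    have s1: "1 \<le> s" unfolding s_def by (rule spos)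
    have sK: "K x = s powr (- 1 / 4)" by (simp add: K_def s_def)
    define h where "h z = form z z + 2 * form x z" for z
    have hc: "continuous_on UNIV h"
      unfolding h_def by (intro continuous_intros form_continuous)
    have step: "K (x + z) \<le> K x * (1 - h z / s / 4 + 9 / 50 * (h z / s)\<^sup>2)" if Jz: "J z \<noteq> 0" for z
    proof -
      \<comment> \<open>A completed square: it bounds \<open>2 * form x z\<close> below by
        \<open>- 3/20 * form x x - 20/3 * form z z\<close>. Adding \<open>form z z\<close> leaves
        the factor 17/3, which is below \<open>3/20 * 40 = 6\<close>.\<close>
      have "0 \<le> (\<Sum>b\<in>(Basis::'a set). (3 / 20 * (x \<bullet> b) + (z \<bullet> b))\<^sup>2 * (20 / 3) / moment b)"
        using moment_gt_zero by (intro sum_nonneg divide_nonneg_nonneg) (auto intro: less_imp_le)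
      also have "\<dots> = 3 / 20 * form x x + 2 * form x z + 20 / 3 * form z z"
        unfolding form_def sum_distrib_left sum.distrib[symmetric]
        by (intro sum.cong) (auto simp: power2_eq_square add_divide_distrib algebra_simps)
      finally have "- 3 / 20 * form x x - 17 / 3 * form z z \<le> h z" by (simp add: h_def)
      moreover have "form z z \<le> Qm" by (rule Qm) (rule r(2)[OF Jz])
      moreover have "- 3 / 20 * s = - 3 / 20 * form x x - 3 / 20 - 6 * Qm - 27 / 20 * Q"
        by (simp add: s_def a_def algebra_simps)
      ultimately have "- 3 / 20 * s \<le> h z"
        using Q0 Qm0 by linarith
      then have y: "- 3 / 20 \<le> h z / s" using s1 by (simp add: pos_le_divide_eq)
      have "a + form (x + z) (x + z) = s * (1 + h z / s)"
        using s1 by (simp add: form_add s_def h_def field_simps)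
      then have "K (x + z) = K x * (1 + h z / s) powr (- 1 / 4)"
        unfolding K_def[of "x + z"] sK using s1 y by (simp add: powr_mult)
      also have "\<dots> \<le> K x * (1 - h z / s / 4 + 9 / 50 * (h z / s)\<^sup>2)"
        by (intro mult_left_mono powr_neg_quarter_le y K01)
      finally show ?thesis .
    qed
    have ih: "integrable lborel (\<lambda>z. J z * h z)" "integrable lborel (\<lambda>z. J z * (h z)\<^sup>2)"
      by (intro integrable_J_cont continuous_intros hc)+
    have i3: "integrable lborel (\<lambda>z. J z * form z z)" "integrable lborel (\<lambda>z. J z * form x z)"
      "integrable lborel (\<lambda>z. J z * (form z z)\<^sup>2)" "integrable lborel (\<lambda>z. J z * (form x z)\<^sup>2)"
      "integrable lborel (\<lambda>z. J z * (form x z * form z z))"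
      by (intro integrable_J_cont continuous_intros form_continuous)+
    have h1: "(\<integral>z. J z * h z \<partial>lborel) = real DIM('a)"
    proof -
      have "(\<integral>z. J z * h z \<partial>lborel) = (\<integral>z. J z * form z z + 2 * (J z * form x z) \<partial>lborel)"
        by (simp add: h_def algebra_simps)
      then show ?thesis using i3 by (simp add: integral_form_diag integral_form_odd)
    qed
    have h2: "(\<integral>z. J z * (h z)\<^sup>2 \<partial>lborel) = Q + 4 * form x x"
    proof -
      have "(\<integral>z. J z * (h z)\<^sup>2 \<partial>lborel) = (\<integral>z. J z * (form z z)\<^sup>2 + 4 * (J z * (form x z)\<^sup>2)
          + 4 * (J z * (form x z * form z z)) \<partial>lborel)"
        by (simp add: h_def power2_eq_square algebra_simps)
      then show ?thesis using i3 by (simp add: integral_form_square integral_form_odd Q_def)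
    qed
    have "avg J K x \<le> (\<integral>z. K x * (J z - (J z * h z) / (4 * s) + 9 / (50 * s\<^sup>2) * (J z * (h z)\<^sup>2)) \<partial>lborel)"
      unfolding avg_def
    proof (rule integral_mono)
      show "integrable lborel (\<lambda>z. J z * K (x + z))" by (rule integrable_J_cont_shift[OF Kc])
      show "integrable lborel (\<lambda>z. K x * (J z - (J z * h z) / (4 * s) + 9 / (50 * s\<^sup>2) * (J z * (h z)\<^sup>2)))"
        using ih by simp
      fix z
      show "J z * K (x + z) \<le> K x * (J z - (J z * h z) / (4 * s) + 9 / (50 * s\<^sup>2) * (J z * (h z)\<^sup>2))"
      proof (cases "J z = 0")
        case False
        have "J z * K (x + z) \<le> J z * (K x * (1 - h z / s / 4 + 9 / 50 * (h z / s)\<^sup>2))"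
          by (intro mult_left_mono step False) simp
        also have "\<dots> = K x * (J z - (J z * h z) / (4 * s) + 9 / (50 * s\<^sup>2) * (J z * (h z)\<^sup>2))"
          using s1 by (simp add: field_simps power2_eq_square)
        finally show ?thesis .
      qed simp
    qed
    also have "\<dots> = K x * (1 - real DIM('a) / (4 * s) + 9 / (50 * s\<^sup>2) * (Q + 4 * form x x))"
      using ih by (simp add: h1 h2)
    \<comment> \<open>After multiplication by \<open>100 * s^2\<close> the gain is at least
      \<open>75 * s\<close> and the loss at most \<open>74 * s\<close>, since
      \<open>9 * Q \<le> s\<close> and \<open>form x x \<le> s\<close>. The remaining
      \<open>s\<close> is the strict deficit.\<close>
    also have "\<dots> \<le> K x * (1 - 1 / (100 * s))"
    proof (intro mult_left_mono K01)
      have "form x x \<le> s" "9 * Q \<le> s"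
        using a1 form_nonneg[of x] Qm0 Q0 by (simp_all add: s_def a_def)
      then have "9 * (Q + 4 * form x x) \<le> 37 * s" unfolding distrib_left by linarith
      moreover have "3 \<le> real DIM('a)" using dim by simp
      ultimately have "9 * (Q + 4 * form x x) * 2 + s \<le> 25 * (real DIM('a) * s)"
        using mult_right_mono[of 3 "real DIM('a)" s] s1 by linarith
      then have le: "(9 * (Q + 4 * form x x) * 2 + s) / (100 * s\<^sup>2) \<le> 25 * (real DIM('a) * s) / (100 * s\<^sup>2)"
        by (intro divide_right_mono) auto
      have e: "(9 * X * 2 + s) / (100 * s\<^sup>2) = 9 / (50 * s\<^sup>2) * X + 1 / (100 * s)"
        "25 * (N * s) / (100 * s\<^sup>2) = N / (4 * s)" for X N
        using s1 by (simp_all add: power2_eq_square add_divide_distrib)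
      from le[unfolded e]
      show "1 - real DIM('a) / (4 * s) + 9 / (50 * s\<^sup>2) * (Q + 4 * form x x) \<le> 1 - 1 / (100 * s)"
        by linarith
    qed
    finally show ?thesis by (simp add: s_def algebra_simps)
  qed
  have S1: "1 \<le> S" using a1 Qm0 by (simp add: S_def)
  have \<kappa>0: "0 < \<kappa>" using S1 by (simp add: \<kappa>_def)
  \<comment> \<open>On the support of \<open>J\<close> the shifted form is at most \<open>S\<close>,
    so the deficit is at least \<open>\<kappa>\<close>; dividing by the bound \<open>M\<close> of
    \<open>J\<close> compares it with \<open>J\<close> itself.\<close>
  have sup: "\<kappa> / M * J x \<le> K x - avg J K x" for x
  proof (cases "J x = 0")
    case True
    have "0 \<le> K x * (1 / (100 * (a + form x x)))" using K01[of x] spos[of x] by simp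
    then show ?thesis using main[of x] True by simp
  next
    case False
    then have "form x x \<le> Qm" by (intro Qm r(2))
    then have sS: "a + form x x \<le> S" by (simp add: S_def)
    have "S powr (- 1 / 4) \<le> K x"
      unfolding K_def using sS spos[of x] by (intro powr_mono2') auto
    moreover have "1 / (100 * S) \<le> 1 / (100 * (a + form x x))"
      using sS spos[of x] by (intro divide_left_mono) auto
    ultimately have "\<kappa> \<le> K x * (1 / (100 * (a + form x x)))"
      unfolding \<kappa>_def using S1 K01[of x] by (intro mult_mono) auto
    moreover have "\<kappa> / M * J x \<le> \<kappa>"
      using M(2)[of x] M(1) \<kappa>0 by (simp add: divide_le_eq)
    ultimately show ?thesis using main[of x] by linarith
  qed
  show ?thesis
    by (rule that[of K 1 "\<kappa> / M"]) (use Kc K01 \<kappa>0 M(1) sup in auto)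
qed

text \<open>The function \<open>K\<close> replaces a Green function: it bounds
  \<open>J * topple F k\<close> pointwise, uniformly in \<open>k\<close>, and the mass of the state
  then controls the mass of \<open>topple F k\<close>.\<close>

lemma ex_solves_OP_transient:
  assumes dim: "3 \<le> DIM('a)" and F: "0 \<le> F"
  shows "\<exists>w. solves_OP J F w"
proof -
  obtain K :: "'a \<Rightarrow> real" and C c where Kc: "continuous_on UNIV K"
    and K0: "\<And>x. 0 \<le> K x" and KC: "\<And>x. K x \<le> C" and c: "0 < c"
    and K: "\<And>x. c * J x \<le> K x - avg J K x"
    using ex_superharmonic[OF dim] by metis
  have [measurable]: "K \<in> borel_measurable borel"
    using Kc by (rule borel_measurable_continuous_onI)
  have Kb: "\<bar>K x\<bar> \<le> C" for x using K0[of x] KC[of x] by simp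
  have iF: "0 \<le> L1_int F" using norm_eq_L1_int[OF F] norm_ge_zero[of F] by linarith
  define D where "D = C * L1_int F / c"
  have D0: "0 \<le> D" using K0[of 0] KC[of 0] iF c by (simp add: D_def)
  have "L1_int (topple F k) \<le> L1_int F + D * L1_int F" for k
  proof -
    define T where "T = topple F k"
    have T: "0 \<le> T" unfolding T_def by (rule topple_nonneg)
    have U: "0 \<le> F + A T" unfolding T_def by (rule topple_state_nonneg[OF F])
    \<comment> \<open>Testing the nonnegative state \<open>F + A T\<close> with \<open>K\<close>
      centred at \<open>y\<close> gives \<open>c * (J * T) y \<le> C * L1_int F\<close>, because
      \<open>\<phi> - avg J \<phi>\<close> dominates \<open>c * J (y - x)\<close>.\<close>
    have bound: "(\<integral>x. J (y - x) * rep_L1 T x \<partial>lborel) \<le> D" for y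
    proof -
      define \<phi> where "\<phi> x = K (x - y)" for x
      have [measurable]: "\<phi> \<in> borel_measurable borel" unfolding \<phi>_def by measurable
      have \<phi>b: "\<bar>\<phi> x\<bar> \<le> C" for x unfolding \<phi>_def by (rule Kb)
      have avg\<phi>: "avg J \<phi> x = avg J K (x - y)" for x
        by (simp add: avg_def \<phi>_def algebra_simps)
      have avgb: "\<bar>avg J \<phi> x\<bar> \<le> C" for x
        using avg_bounds[of \<phi> "- C" C x] \<phi>b by (simp add: abs_le_iff minus_le_iff)
      have i: "integrable lborel (\<lambda>x. rep_L1 w x * \<phi> x)" for w
        by (rule integrable_mult_bounded[OF _ _ \<phi>b]) auto
      have i': "integrable lborel (\<lambda>x. rep_L1 T x * avg J \<phi> x)"
        by (rule integrable_mult_bounded[OF _ _ avgb]) auto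
      have "0 \<le> (\<integral>x. rep_L1 (F + A T) x * \<phi> x \<partial>lborel)"
      proof (rule integral_nonneg_AE)
        show "AE x in lborel. 0 \<le> rep_L1 (F + A T) x * \<phi> x"
          using AE_nonneg_L1[OF U] by eventually_elim (simp add: \<phi>_def K0)
      qed
      also have "\<dots> = (\<integral>x. rep_L1 F x * \<phi> x + rep_L1 (A T) x * \<phi> x \<partial>lborel)"
      proof (rule integral_cong_AE)
        show "AE x in lborel. rep_L1 (F + A T) x * \<phi> x = rep_L1 F x * \<phi> x + rep_L1 (A T) x * \<phi> x"
          using AE_rep_plus[of F "A T"] by eventually_elim (simp add: algebra_simps)
      qed auto
      also have "\<dots> = (\<integral>x. rep_L1 F x * \<phi> x \<partial>lborel) + (\<integral>x. rep_L1 T x * (avg J \<phi> x - \<phi> x) \<partial>lborel)"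
        using i duality_A[where \<phi> = \<phi> and C = C and v = T] \<phi>b by simp
      finally have 1: "- (\<integral>x. rep_L1 T x * (avg J \<phi> x - \<phi> x) \<partial>lborel) \<le> (\<integral>x. rep_L1 F x * \<phi> x \<partial>lborel)"
        by simp
      have "(\<integral>x. rep_L1 F x * \<phi> x \<partial>lborel) \<le> (\<integral>x. rep_L1 F x * C \<partial>lborel)"
      proof (rule integral_mono_AE)
        show "AE x in lborel. rep_L1 F x * \<phi> x \<le> rep_L1 F x * C"
          using AE_nonneg_L1[OF F] by eventually_elim (simp add: \<phi>_def KC mult_left_mono)
      qed (use i in auto)
      then have 2: "(\<integral>x. rep_L1 F x * \<phi> x \<partial>lborel) \<le> C * L1_int F"
        by (simp add: L1_int_def mult.commute)
      have "c * (\<integral>x. J (y - x) * rep_L1 T x \<partial>lborel) = (\<integral>x. c * (J (y - x) * rep_L1 T x) \<partial>lborel)"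
        by simp
      also have "\<dots> \<le> (\<integral>x. - (rep_L1 T x * (avg J \<phi> x - \<phi> x)) \<partial>lborel)"
      proof (rule integral_mono_AE)
        show "integrable lborel (\<lambda>x. c * (J (y - x) * rep_L1 T x))"
          by (intro integrable_mult_right integrable_kernel_mult)
        show "integrable lborel (\<lambda>x. - (rep_L1 T x * (avg J \<phi> x - \<phi> x)))"
          using i i' by (simp add: right_diff_distrib)
        show "AE x in lborel. c * (J (y - x) * rep_L1 T x) \<le> - (rep_L1 T x * (avg J \<phi> x - \<phi> x))"
          using AE_nonneg_L1[OF T]
        proof eventually_elim
          case (elim x)
          have "c * J (y - x) \<le> \<phi> x - avg J \<phi> x"
            using K[of "x - y"] by (simp add: avg\<phi> \<phi>_def J_commute[of y x])
          from mult_left_mono[OF this elim] show ?case by (simp add: algebra_simps)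
        qed
      qed
      also have "\<dots> \<le> C * L1_int F" using 1 2 by simp
      finally show ?thesis using c by (simp add: D_def pos_le_divide_eq mult.commute)
    qed
    \<comment> \<open>Where \<open>T > 0\<close> the state is at least 1, so
      \<open>T \<le> F + D\<close> and \<open>D\<close> is at most \<open>D\<close> times the state.
      Integrating removes \<open>A T\<close> and leaves a bound independent of
      \<open>k\<close>.\<close>
    have "T \<le> F + D *\<^sub>R (F + A T)"
      unfolding less_eq_L1_def
      using AE_rep_plus[of F "D *\<^sub>R (F + A T)"] AE_rep_scaleR[of D "F + A T"] AE_rep_plus[of F "A T"]
        AE_rep_minus[of "L1_conv J T" T, folded A_def] AE_rep_conv[OF J_integrable, of T]
        AE_topple_pos[where F = F and k = k, folded T_def] AE_nonneg_L1[OF T] AE_nonneg_L1[OF U] AE_nonneg_L1[OF F]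
    proof eventually_elim
      case (elim x)
      show ?case
      proof (cases "0 < rep_L1 T x")
        case True
        with elim have u: "1 \<le> rep_L1 (F + A T) x" by simp
        have "rep_L1 (A T) x \<le> D - rep_L1 T x" using elim bound[of x] by simp
        then have "rep_L1 T x \<le> rep_L1 F x + D" using u elim(3) by linarith
        moreover have "D \<le> D * rep_L1 (F + A T) x" using mult_left_mono[OF u D0] by simp
        ultimately show ?thesis using elim by simp
      next
        case False
        moreover have "0 \<le> D * rep_L1 (F + A T) x" using D0 elim by simp
        ultimately show ?thesis using elim by simp
      qed
    qed
    from L1_int_mono[OF this] show ?thesis
      by (simp add: T_def L1_int_plus L1_int_scaleR L1_int_A)
  qed
  with F show ?thesis by (rule ex_solves_OP)
qed

lemma ex_solves_OP_data: "F \<in> OP_data \<Longrightarrow> \<exists>w. solves_OP J F w"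
  using ex_solves_OP_transient[of F] ex_solves_OP_barrier[of F]
  by (cases "DIM('a) \<le> 2") (auto simp: OP_data_def L1_nonneg_iff)

end

section \<open>Solutions of the Stefan problem\<close>

lemma L1_integral_nonneg:
  fixes k :: "real \<Rightarrow> 'a::euclidean_space L1"
  assumes k: "continuous_on {a..b} k" and nn: "\<And>s. s \<in> {a..b} \<Longrightarrow> 0 \<le> k s"
  shows "0 \<le> integral {a..b} k"
proof -
  have i: "k integrable_on {a..b}" using k by (rule integrable_continuous_interval)
  \<comment> \<open>For nonnegative values the norm is the bounded linear functional
    \<open>L1_int\<close>, which commutes with the time integral; \<open>nonneg_L1_iff\<close> then
    reads the norm bound as positivity.\<close>
  have "norm (integral {a..b} k) \<le> integral {a..b} (L1_int \<circ> k)"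
  proof (rule integral_norm_bound_integral[OF i])
    show "(L1_int \<circ> k) integrable_on {a..b}"
      using i bounded_linear_L1_int by (rule integrable_linear)
    show "norm (k s) \<le> (L1_int \<circ> k) s" if "s \<in> {a..b}" for s
      using nn[OF that] by (simp add: norm_eq_L1_int)
  qed
  also have "\<dots> = L1_int (integral {a..b} k)"
    using i bounded_linear_L1_int by (rule integral_linear)
  finally show ?thesis by (simp add: nonneg_L1_iff)
qed

text \<open>Integrating factor: lower bounds on \<open>p' + p\<close> become lower bounds on the
  growth of \<open>exp s\<close> times \<open>p s\<close>.\<close>

lemma has_integral_exp_scaleR:
  fixes p :: "real \<Rightarrow> 'b::banach"
  assumes "a \<le> b"
    and p: "\<And>s. s \<in> {a..b} \<Longrightarrow> (p has_vector_derivative p' s) (at s within {a..b})"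
  shows "((\<lambda>s. exp s *\<^sub>R (p' s + p s)) has_integral (exp b *\<^sub>R p b - exp a *\<^sub>R p a)) {a..b}"
proof (rule fundamental_theorem_of_calculus[OF assms(1)])
  show "((\<lambda>s. exp s *\<^sub>R p s) has_vector_derivative exp s *\<^sub>R (p' s + p s)) (at s within {a..b})"
    if "s \<in> {a..b}" for s
  proof -
    have "((\<lambda>s. exp s *\<^sub>R p s) has_vector_derivative exp s *\<^sub>R p' s + exp s *\<^sub>R p s) (at s within {a..b})"
      by (rule has_vector_derivative_scaleR[OF _ p[OF that]])
         (auto intro!: derivative_eq_intros)
    then show ?thesis by (simp add: scaleR_add_right)
  qed
qed

text \<open>The primitive \<open>I\<close> satisfies \<open>I' = m \<le> I\<close>, so
  \<open>exp (- t) * I t\<close> is nonincreasing and starts at 0.\<close>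

lemma gronwall_zero:
  fixes m :: "real \<Rightarrow> real"
  assumes ab: "a \<le> b" and m: "continuous_on {a..b} m"
    and le: "\<And>t. t \<in> {a..b} \<Longrightarrow> m t \<le> integral {a..t} m"
  shows "m b \<le> 0"
proof -
  define I where "I t = integral {a..t} m" for t
  have "((\<lambda>s. exp (- s) * (I s - m s)) has_integral (- exp (- b) * I b - - exp (- a) * I a)) {a..b}"
  proof (rule fundamental_theorem_of_calculus[OF ab])
    fix s assume s: "s \<in> {a..b}"
    have "(I has_real_derivative m s) (at s within {a..b})"
      using integral_has_vector_derivative[OF m s]
      by (simp add: I_def[abs_def] has_real_derivative_iff_has_vector_derivative)
    then have "((\<lambda>s. - exp (- s) * I s) has_real_derivative exp (- s) * (I s - m s)) (at s within {a..b})"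
      by (auto intro!: derivative_eq_intros simp: algebra_simps)
    then show "((\<lambda>s. - exp (- s) * I s) has_vector_derivative exp (- s) * (I s - m s)) (at s within {a..b})"
      by (simp add: has_real_derivative_iff_has_vector_derivative)
  qed
  then have "0 \<le> - exp (- b) * I b - - exp (- a) * I a"
    by (rule has_integral_nonneg) (use le in \<open>auto simp: I_def\<close>)
  then have "I b \<le> 0" by (simp add: I_def mult_le_0_iff)
  with le[of b] ab show ?thesis by (simp add: I_def)
qed

text \<open>A bounded linear functional for Borel \<open>B\<close>: it evaluates a time integral on
  a fixed set without choosing representatives at every time.\<close>

definition L1_on :: "'a::euclidean_space set \<Rightarrow> 'a L1 \<Rightarrow> real" where
  "L1_on B h = (\<integral>x. rep_L1 h x * indicator B x \<partial>lborel)"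

lemma integrable_L1_on: "B \<in> sets borel \<Longrightarrow> integrable lborel (\<lambda>x. rep_L1 h x * indicator B x)"
  by (rule integrable_mult_bounded[where C = 1]) (auto split: split_indicator)

lemma bounded_linear_L1_on:
  assumes B[measurable]: "B \<in> sets borel"
  shows "bounded_linear (L1_on B)"
proof (rule bounded_linear_intro[where K = 1])
  note [simp] = integrable_L1_on[OF B]
  show "L1_on B (g + h) = L1_on B g + L1_on B h" for g h
  proof -
    have "L1_on B (g + h) = (\<integral>x. rep_L1 g x * indicator B x + rep_L1 h x * indicator B x \<partial>lborel)"
      unfolding L1_on_def
    proof (rule integral_cong_AE)
      show "AE x in lborel. rep_L1 (g + h) x * indicator B x = rep_L1 g x * indicator B x + rep_L1 h x * indicator B x"
        using AE_rep_plus[of g h] by eventually_elim (simp add: algebra_simps)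
    qed auto
    then show ?thesis by (simp add: L1_on_def)
  qed
  show "L1_on B (c *\<^sub>R h) = c *\<^sub>R L1_on B h" for c h
  proof -
    have "L1_on B (c *\<^sub>R h) = (\<integral>x. c * (rep_L1 h x * indicator B x) \<partial>lborel)"
      unfolding L1_on_def
    proof (rule integral_cong_AE)
      show "AE x in lborel. rep_L1 (c *\<^sub>R h) x * indicator B x = c * (rep_L1 h x * indicator B x)"
        using AE_rep_scaleR[of c h] by eventually_elim simp
    qed auto
    then show ?thesis by (simp add: L1_on_def)
  qed
  show "norm (L1_on B h) \<le> norm h * 1" for h
  proof -
    have "norm (L1_on B h) \<le> (\<integral>x. norm (rep_L1 h x * indicator B x) \<partial>lborel)"
      unfolding L1_on_def by (rule integral_norm_bound)
    also have "\<dots> \<le> (\<integral>x. \<bar>rep_L1 h x\<bar> \<partial>lborel)"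
      by (rule integral_mono_AE) (auto split: split_indicator)
    finally show ?thesis by (simp add: norm_L1_eq)
  qed
qed

lemma L1_on_zeroD:
  assumes B: "B \<in> sets borel" and h: "0 \<le> h" and z: "L1_on B h \<le> 0"
  shows "AE x in lborel. x \<in> B \<longrightarrow> rep_L1 h x = 0"
proof -
  have nn: "AE x in lborel. 0 \<le> rep_L1 h x * indicator B x"
    using AE_nonneg_L1[OF h] by eventually_elim simp
  have "L1_on B h = 0"
    using z integral_nonneg_AE[OF nn] by (simp add: L1_on_def)
  then have "AE x in lborel. rep_L1 h x * indicator B x = 0"
    unfolding L1_on_def using nn integrable_L1_on[OF B, of h]
    by (subst (asm) integral_nonneg_eq_0_iff_AE) auto
  then show ?thesis by eventually_elim (auto split: split_indicator_asm)
qed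

section \<open>Monotonicity of the Stefan flow and of the accumulated excess\<close>

locale stefan = kernel J for J :: "'a::euclidean_space \<Rightarrow> real" +
  fixes f :: "'a L1" and u :: "real \<Rightarrow> 'a L1"
  assumes f_nonneg: "0 \<le> f" and sol: "L1_solution J f u"
begin

definition w :: "real \<Rightarrow> 'a L1" where
  "w t = integral {0..t} (\<lambda>s. excess (u s))"

lemma u_continuous: "continuous_on {0..} u"
  using sol by (simp add: L1_solution_def)

lemma v_continuous: "0 \<le> a \<Longrightarrow> continuous_on {a..b} (\<lambda>s. excess (u s))"
  by (intro continuous_intros continuous_on_subset[OF u_continuous]) auto

lemma v_integrable: "0 \<le> a \<Longrightarrow> (\<lambda>s. excess (u s)) integrable_on {a..b}"
  by (intro integrable_continuous_interval v_continuous)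

lemma w_continuous: "continuous_on {0..b} w"
  unfolding w_def by (intro indefinite_integral_continuous_1 v_integrable order_refl)

lemma u_eq: assumes "0 \<le> t" shows "u t = f + A (w t)"
proof -
  have pos: "u t = f + A (w t)" if "0 < t" for t
  proof -
    have "u t = f + integral {0..t} (A \<circ> (\<lambda>s. excess (u s)))"
      using sol that by (simp add: L1_solution_def comp_def A_def)
    then show ?thesis
      using integral_linear[OF v_integrable[of 0 t] bounded_linear_A] by (simp add: w_def)
  qed
  \<comment> \<open>The defining equation covers positive times only; continuity extends it to
    \<open>t = 0\<close>.\<close>
  have "u 0 - (f + A (w 0)) = 0"
  proof (rule continuous_constant_on_closure[where S = "{0<..<1::real}" and f = "\<lambda>t. u t - (f + A (w t))"])
    show "continuous_on (closure {0<..<1}) (\<lambda>t. u t - (f + A (w t)))"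
      by (simp, intro continuous_intros continuous_on_subset[OF u_continuous]
           bounded_linear.continuous_on[OF bounded_linear_A] w_continuous) auto
  qed (use pos in auto)
  with pos assms show ?thesis by (cases "t = 0") auto
qed

lemma w_diff:
  assumes "0 \<le> s" "s \<le> t" shows "w t - w s = integral {s..t} (\<lambda>r. excess (u r))"
proof -
  have "w s + integral {s..t} (\<lambda>r. excess (u r)) = w t"
    unfolding w_def
    by (rule Henstock_Kurzweil_Integration.integral_combine) (use assms in \<open>auto intro: v_integrable\<close>)
  then show ?thesis by (metis add_diff_cancel_left')
qed

lemma w_mono: assumes "0 \<le> s" "s \<le> t" shows "w s \<le> w t"
proof -
  have "0 \<le> w t - w s"
    unfolding w_diff[OF assms] by (intro L1_integral_nonneg v_continuous excess_nonneg assms)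
  then show ?thesis by simp
qed

lemma w_zero: "w 0 = 0"
  by (simp add: w_def)

lemma w_nonneg: "0 \<le> t \<Longrightarrow> 0 \<le> w t"
  using w_mono[of 0 t] by (simp add: w_zero)

lemma w_has_derivative:
  assumes "0 \<le> a" "s \<in> {a..b}"
  shows "(w has_vector_derivative excess (u s)) (at s within {a..b})"
proof -
  have "((\<lambda>r. integral {0..r} (\<lambda>s. excess (u s))) has_vector_derivative excess (u s)) (at s within {0..b})"
    by (rule integral_has_vector_derivative[OF v_continuous]) (use assms in auto)
  then show ?thesis
    unfolding w_def by (rule has_vector_derivative_within_subset) (use assms in auto)
qed

lemma u_has_derivative:
  assumes "0 \<le> a" "s \<in> {a..b}"
  shows "(u has_vector_derivative A (excess (u s))) (at s within {a..b})"
proof -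
  have "((\<lambda>r. f + A (w r)) has_vector_derivative 0 + A (excess (u s))) (at s within {a..b})"
    by (intro has_vector_derivative_add has_vector_derivative_const
         bounded_linear.has_vector_derivative[OF bounded_linear_A] w_has_derivative assms)
  then have "((\<lambda>r. f + A (w r)) has_vector_derivative A (excess (u s))) (at s within {a..b})" by simp
  then show ?thesis
    by (rule has_vector_derivative_transform[rotated 2]) (use assms u_eq in auto)
qed

text \<open>
  For \<open>g = min (u a) 1\<close>, the positive part of \<open>g - u s\<close> satisfies, after multiplication by \<open>exp s\<close>,
  a homogeneous Gronwall inequality.
\<close>

lemma AE_min_le:
  assumes ab: "0 \<le> a" "a \<le> b"
  shows "AE x in lborel. min (rep_L1 (u a) x) 1 \<le> rep_L1 (u b) x"
proof -
  define g where "g = u a - excess (u a)"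
  have g: "AE x in lborel. rep_L1 g x = min (rep_L1 (u a) x) 1"
    using AE_rep_minus[of "u a" "excess (u a)"] AE_rep_excess[of "u a"]
    unfolding g_def by eventually_elim auto
  define y where "y s = pos_part (g - u s)" for s
  have uc: "continuous_on {a..c} u" for c
    using u_continuous by (rule continuous_on_subset) (use ab in auto)
  have yc: "continuous_on {a..c} y" for c unfolding y_def by (intro continuous_intros uc)
  have "exp b * norm (y b) \<le> 0"
  proof (rule gronwall_zero[OF ab(2), where m = "\<lambda>s. exp s * norm (y s)"])
    show "continuous_on {a..b} (\<lambda>s. exp s * norm (y s))" by (intro continuous_intros yc)
    fix c assume c: "c \<in> {a..b}"
    define k where "k s = exp s *\<^sub>R (A (excess (u s)) + (u s - g))" for s
    have kc: "continuous_on {a..c} k"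
      unfolding k_def
      by (intro continuous_intros uc bounded_linear.continuous_on[OF bounded_linear_A])
    have "(k has_integral (exp c *\<^sub>R (u c - g) - exp a *\<^sub>R (u a - g))) {a..c}"
      unfolding k_def
    proof (rule has_integral_exp_scaleR)
      show "((\<lambda>s. u s - g) has_vector_derivative A (excess (u s))) (at s within {a..c})"
        if "s \<in> {a..c}" for s
        using has_vector_derivative_diff[OF u_has_derivative[OF ab(1) that] has_vector_derivative_const[of g]]
        by simp
    qed (use c in simp)
    then have K: "integral {a..c} k = exp c *\<^sub>R (u c - g) - exp a *\<^sub>R (u a - g)"
      by (rule integral_unique)
    define Y where "Y = integral {a..c} (\<lambda>s. exp s *\<^sub>R y s)"
    have eyc: "continuous_on {a..c} (\<lambda>s. exp s *\<^sub>R y s)" by (intro continuous_intros yc)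
    have Y0: "0 \<le> Y"
      unfolding Y_def by (intro L1_integral_nonneg eyc scaleR_nonneg_nonneg) (auto simp: y_def pos_part_nonneg)
    have "0 \<le> integral {a..c} (\<lambda>s. k s + exp s *\<^sub>R y s)"
    proof (intro L1_integral_nonneg continuous_on_add kc eyc)
      fix s
      \<comment> \<open>Since \<open>A v \<ge> - v\<close> and \<open>u - v = min u 1\<close>, the
        sum is at least \<open>min (u s) 1 - g\<close> plus the positive part of
        \<open>g - u s\<close>. This is nonnegative because \<open>g \<le> 1\<close>.\<close>
      have "0 \<le> A (excess (u s)) + (u s - g) + y s"
      proof (rule nonneg_L1_I)
        have "AE x in lborel. - rep_L1 (excess (u s)) x \<le> rep_L1 (A (excess (u s))) x"
          using A_ge[OF excess_nonneg[of "u s"]] AE_rep_uminus[of "excess (u s)"]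
          unfolding less_eq_L1_def by eventually_elim simp
        then show "AE x in lborel. 0 \<le> rep_L1 (A (excess (u s)) + (u s - g) + y s) x"
          using AE_rep_plus[of "A (excess (u s)) + (u s - g)" "y s"] AE_rep_plus[of "A (excess (u s))" "u s - g"]
            AE_rep_minus[of "u s" g] AE_rep_minus[of g "u s"] AE_rep_pos_part[of "g - u s", folded y_def]
            AE_rep_excess[of "u s"] g
          by eventually_elim (auto simp: max_def min_def split: if_splits)
      qed
      from scaleR_nonneg_nonneg[OF _ this, of "exp s"]
      show "0 \<le> k s + exp s *\<^sub>R y s" by (simp add: k_def scaleR_add_right)
    qed
    also have "\<dots> = exp c *\<^sub>R (u c - g) - exp a *\<^sub>R (u a - g) + Y"
      unfolding K[symmetric] Y_def
      by (intro Henstock_Kurzweil_Integration.integral_add integrable_continuous_interval kc eyc)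
    also have "\<dots> \<le> exp c *\<^sub>R (u c - g) + Y"
      by (simp add: g_def excess_nonneg scaleR_nonneg_nonneg)
    finally have nn: "0 \<le> exp c *\<^sub>R (u c - g) + Y" .
    have "exp c *\<^sub>R y c \<le> Y"
      unfolding less_eq_L1_def
      using AE_nonneg_L1[OF nn] AE_nonneg_L1[OF Y0] AE_rep_plus[of "exp c *\<^sub>R (u c - g)" Y]
        AE_rep_scaleR[of "exp c" "u c - g"] AE_rep_minus[of "u c" g] AE_rep_minus[of g "u c"]
        AE_rep_scaleR[of "exp c" "y c"] AE_rep_pos_part[of "g - u c", folded y_def]
      by eventually_elim (auto simp: max_def right_diff_distrib)
    then have "norm (exp c *\<^sub>R y c) \<le> norm Y"
      by (intro norm_mono_L1 scaleR_nonneg_nonneg) (auto simp: y_def pos_part_nonneg)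
    also have "\<dots> \<le> integral {a..c} (\<lambda>s. exp s * norm (y s))"
      unfolding Y_def
      by (intro integral_norm_bound_integral integrable_continuous_interval continuous_intros yc) auto
    finally show "exp c * norm (y c) \<le> integral {a..c} (\<lambda>s. exp s * norm (y s))" by simp
  qed
  then have "norm (y b) \<le> 0" by (simp add: mult_le_0_iff)
  then have "pos_part (g - u b) = 0" by (simp add: y_def)
  then have "g \<le> u b" using pos_part_eq_zero[of "g - u b"] by simp
  with g show ?thesis unfolding less_eq_L1_def by eventually_elim simp
qed

lemma u_nonneg: assumes "0 \<le> t" shows "0 \<le> u t"
proof (rule nonneg_L1_I)
  have "AE x in lborel. min (rep_L1 f x) 1 \<le> rep_L1 (u t) x"
    using AE_min_le[OF order_refl assms] u_eq[of 0] by (simp add: w_zero A_def conv_zero)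
  then show "AE x in lborel. 0 \<le> rep_L1 (u t) x"
    using AE_nonneg_L1[OF f_nonneg] by eventually_elim simp
qed

lemma L1_int_u: "0 \<le> t \<Longrightarrow> L1_int (u t) = L1_int f"
  by (simp add: u_eq L1_int_plus L1_int_A)

lemma norm_v_le: assumes "0 \<le> t" shows "norm (excess (u t)) \<le> norm f"
proof -
  have "excess (u t) \<le> u t"
    using AE_rep_excess[of "u t"] AE_nonneg_L1[OF u_nonneg[OF assms]]
    unfolding less_eq_L1_def by eventually_elim auto
  then have "norm (excess (u t)) \<le> norm (u t)" by (rule norm_mono_L1[OF excess_nonneg])
  also have "\<dots> = norm f" using assms by (simp add: norm_eq_L1_int u_nonneg f_nonneg L1_int_u)
  finally show ?thesis .
qed

text \<open>Where \<open>u t < 1\<close>, \<open>AE_min_le\<close> excludes an earlier excess. The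
  null sets depend on the earlier time \<open>s\<close>, so the conclusion is drawn from the mass
  over the fixed set \<open>B\<close>, which commutes with the time integral.\<close>

lemma AE_w_pos:
  assumes t: "0 \<le> t"
  shows "AE x in lborel. 0 < rep_L1 (w t) x \<longrightarrow> 1 \<le> rep_L1 (u t) x"
proof -
  define B where "B = {x. rep_L1 (u t) x < 1}"
  have B[measurable]: "B \<in> sets borel" unfolding B_def by measurable
  have zero: "L1_on B (excess (u s)) = 0" if s: "s \<in> {0..t}" for s
    unfolding L1_on_def
  proof (rule integral_eq_zero_AE)
    have "AE x in lborel. min (rep_L1 (u s) x) 1 \<le> rep_L1 (u t) x"
      using s by (intro AE_min_le) auto
    then show "AE x in lborel. rep_L1 (excess (u s)) x * indicator B x = 0"
      using AE_rep_excess[of "u s"] by eventually_elim (auto simp: B_def split: split_indicator)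
  qed
  have "L1_on B (w t) = integral {0..t} (L1_on B \<circ> (\<lambda>s. excess (u s)))"
    unfolding w_def by (rule integral_linear[symmetric, OF v_integrable bounded_linear_L1_on[OF B]]) simp
  also have "\<dots> = integral {0..t} (\<lambda>_. 0)"
    by (rule Henstock_Kurzweil_Integration.integral_cong) (simp add: zero)
  finally have "L1_on B (w t) \<le> 0" by simp
  from L1_on_zeroD[OF B w_nonneg[OF t] this]
  show ?thesis by eventually_elim (auto simp: B_def)
qed

text \<open>With \<open>d = w s - w a\<close> one has \<open>u s = u a + A d \<ge> u a - d\<close>,
  so \<open>d\<close> grows at rate at least \<open>excess (u a) - d\<close>. Solving this over one
  unit of time gives the factor \<open>1 - exp (- 1)\<close>.\<close>

lemma w_increment_ge:
  assumes a: "0 \<le> a"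
  shows "(1 - exp (- 1)) *\<^sub>R excess (u a) \<le> w (a + 1) - w a"
proof -
  define p where "p s = w s - w a - excess (u a)" for s
  define k where "k s = exp s *\<^sub>R (excess (u s) + p s)" for s
  have "(k has_integral (exp (a + 1) *\<^sub>R p (a + 1) - exp a *\<^sub>R p a)) {a..a + 1}"
    unfolding k_def
  proof (rule has_integral_exp_scaleR)
    show "(p has_vector_derivative excess (u s)) (at s within {a..a + 1})" if "s \<in> {a..a + 1}" for s
      using has_vector_derivative_diff[OF w_has_derivative[OF a that] has_vector_derivative_const[of "w a + excess (u a)"]]
      unfolding p_def by (simp add: diff_diff_eq)
  qed simp
  then have eq: "integral {a..a + 1} k = exp (a + 1) *\<^sub>R p (a + 1) - exp a *\<^sub>R p a"
    by (rule integral_unique)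
  have "0 \<le> integral {a..a + 1} k"
  proof (rule L1_integral_nonneg)
    have "continuous_on {a..a + 1} w"
      by (rule continuous_on_subset[OF w_continuous[of "a + 1"]]) (use a in auto)
    then show "continuous_on {a..a + 1} k"
      unfolding k_def p_def
      by (intro continuous_intros continuous_on_subset[OF u_continuous]) (use a in auto)
    fix s assume s: "s \<in> {a..a + 1}"
    define d where "d = w s - w a"
    have d: "0 \<le> d" using w_mono[OF a, of s] s by (simp add: d_def)
    have us: "u s = u a + A d" using s a by (simp add: u_eq d_def A_diff)
    have "0 \<le> excess (u s) + p s"
    proof (rule nonneg_L1_I)
      have p: "p s = d - excess (u a)" by (simp add: p_def d_def)
      have "AE x in lborel. - rep_L1 d x \<le> rep_L1 (A d) x"
        using A_ge[OF d] AE_rep_uminus[of d] unfolding less_eq_L1_def by eventually_elim simp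
      then show "AE x in lborel. 0 \<le> rep_L1 (excess (u s) + p s) x"
        using AE_rep_plus[of "excess (u s)" "p s"] AE_rep_minus[of d "excess (u a)"]
          AE_rep_plus[of "u a" "A d"] AE_rep_excess[of "u s"] AE_rep_excess[of "u a"] AE_nonneg_L1[OF d]
        unfolding p us by eventually_elim auto
    qed
    then show "0 \<le> k s" unfolding k_def by (intro scaleR_nonneg_nonneg) auto
  qed
  then have "0 \<le> exp (- (a + 1)) *\<^sub>R (exp (a + 1) *\<^sub>R p (a + 1) - exp a *\<^sub>R p a)"
    unfolding eq by (intro scaleR_nonneg_nonneg) auto
  also have "\<dots> = p (a + 1) - exp (- 1) *\<^sub>R p a"
    by (simp add: scaleR_right_diff_distrib flip: exp_add)
  also have "\<dots> = w (a + 1) - w a - (1 - exp (- 1)) *\<^sub>R excess (u a)"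
    by (simp add: p_def scaleR_left_diff_distrib)
  finally show ?thesis by simp
qed

section \<open>Convergence to the mesa\<close>

text \<open>
  The shift by \<open>\<delta> *\<^sub>R v\<close> in \<open>z\<close> is what makes the error visible in \<open>w\<close>: where \<open>z > 0\<close>, the whole
  amount \<open>\<delta> *\<^sub>R v\<close> is gained by \<open>min (w t) W\<close> during the next unit of time.
\<close>

lemma norm_diff_stationary_le:
  assumes W: "solves_OP J F W" and t: "0 \<le> t" and \<delta>: "0 < \<delta>" "\<delta> \<le> 1 - exp (- 1)"
  shows "norm (u t - (F + A W)) \<le> norm (f - F) + 4 * \<delta> * norm f +
    2 / \<delta> * (L1_int (pos_part (W - w t)) - L1_int (pos_part (W - w (t + 1))))"
proof -
  define q v z where "q = F + A W" and "v = excess (u t)" and "z = W - w t - \<delta> *\<^sub>R v"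
  define \<Delta> where "\<Delta> = pos_part (W - w t) - pos_part (W - w (t + 1))"
  define P where "P = {x. rep_L1 (u t) x < rep_L1 q x} \<union> {x. 0 < rep_L1 z x}"
  have P[measurable]: "P \<in> sets borel" unfolding P_def by measurable
  interpret P: bounded_linear "L1_on P" by (rule bounded_linear_L1_on[OF P])
  have W0: "0 \<le> W"
    and q: "AE x in lborel. rep_L1 q x \<le> 1 \<and> (0 < rep_L1 W x \<longrightarrow> rep_L1 q x = 1)"
    using W by (auto simp: solves_OP_iff q_def)
  have z: "AE x in lborel. rep_L1 z x = rep_L1 W x - rep_L1 (w t) x - \<delta> * rep_L1 v x"
    using AE_rep_minus[of "W - w t" "\<delta> *\<^sub>R v"] AE_rep_minus[of W "w t"] AE_rep_scaleR[of \<delta> v]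
    unfolding z_def by eventually_elim simp
  have v: "AE x in lborel. rep_L1 v x = max (rep_L1 (u t) x - 1) 0"
    unfolding v_def by (rule AE_rep_excess)
  have w0: "AE x in lborel. 0 \<le> rep_L1 (w t) x" by (rule AE_nonneg_L1[OF w_nonneg[OF t]])
  \<comment> \<open>If \<open>u t < q \<le> 1\<close>, then \<open>v\<close> and \<open>w t\<close>
    both vanish and \<open>z = W \<ge> 0\<close>; the rest of \<open>P\<close> has
    \<open>z > 0\<close> by definition.\<close>
  have Pz: "AE x in lborel. (x \<in> P \<longrightarrow> 0 \<le> rep_L1 z x) \<and> (x \<notin> P \<longrightarrow> rep_L1 z x \<le> 0)"
    using z v q w0 AE_nonneg_L1[OF W0] AE_w_pos[OF t]
  proof eventually_elim
    case (elim x)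
    show ?case
    proof (intro conjI impI)
      assume "x \<in> P"
      show "0 \<le> rep_L1 z x"
      proof (rule ccontr)
        assume neg: "\<not> 0 \<le> rep_L1 z x"
        with \<open>x \<in> P\<close> have "rep_L1 (u t) x < rep_L1 q x" by (auto simp: P_def)
        with elim have u1: "rep_L1 (u t) x < 1" by linarith
        then have "rep_L1 v x = 0" "\<not> 0 < rep_L1 (w t) x" using elim by auto
        with elim neg show False by simp
      qed
    qed (auto simp: P_def)
  qed
  have le: "L1_on P (A z) \<le> 0"
    unfolding L1_on_def by (rule integral_A_le_zero[OF P Pz])
  have step: "\<delta> *\<^sub>R v \<le> w (t + 1) - w t"
  proof -
    have "\<delta> *\<^sub>R v \<le> (1 - exp (- 1)) *\<^sub>R v"
      using \<delta>(2) by (intro scaleR_right_mono) (auto simp: v_def excess_nonneg)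
    also have "\<dots> \<le> w (t + 1) - w t" unfolding v_def by (rule w_increment_ge[OF t])
    finally show ?thesis .
  qed
  have mono: "w t \<le> w (t + 1)" using t by (intro w_mono) auto
  have \<Delta>: "AE x in lborel. rep_L1 \<Delta> x = max (rep_L1 W x - rep_L1 (w t) x) 0 - max (rep_L1 W x - rep_L1 (w (t + 1)) x) 0"
    using AE_rep_minus[of "pos_part (W - w t)" "pos_part (W - w (t + 1))"]
      AE_rep_pos_part[of "W - w t"] AE_rep_pos_part[of "W - w (t + 1)"]
      AE_rep_minus[of W "w t"] AE_rep_minus[of W "w (t + 1)"]
    unfolding \<Delta>_def by eventually_elim simp
  have qu: "AE x in lborel. rep_L1 (q - u t) x = rep_L1 q x - rep_L1 (u t) x" by (rule AE_rep_minus)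
  have "AE x in lborel. rep_L1 (w t) x + \<delta> * rep_L1 v x \<le> rep_L1 (w (t + 1)) x"
    using step AE_rep_scaleR[of \<delta> v] AE_rep_minus[of "w (t + 1)" "w t"]
    unfolding less_eq_L1_def by eventually_elim simp
  \<comment> \<open>Where \<open>z > 0\<close> and \<open>q \<le> u t\<close>, \<open>W > 0\<close>
    gives \<open>q = 1\<close> and \<open>q - u t = - v\<close>; the loss
    \<open>\<delta> * v\<close> is covered by \<open>\<Delta>\<close>, whether or not
    \<open>w\<close> passes \<open>W\<close> before \<open>t + 1\<close>. Elsewhere
    \<open>\<Delta> \<ge> 0\<close> suffices.\<close>
  then have "AE x in lborel. \<delta> * rep_L1 (pos_part (q - u t)) x \<le>
      \<delta> * (rep_L1 (q - u t) x * indicator P x) + rep_L1 \<Delta> x"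
    using mono[unfolded less_eq_L1_def] z v q \<Delta> qu AE_rep_pos_part[of "q - u t"] w0 AE_nonneg_L1[OF W0]
  proof eventually_elim
    case (elim x)
    have D0: "0 \<le> \<delta> * rep_L1 v x" using \<delta> elim by simp
    have \<Delta>0: "0 \<le> rep_L1 \<Delta> x" using elim by (simp add: max_def)
    consider "rep_L1 (u t) x < rep_L1 q x" | "rep_L1 q x \<le> rep_L1 (u t) x" "0 < rep_L1 z x"
      | "rep_L1 q x \<le> rep_L1 (u t) x" "rep_L1 z x \<le> 0" by linarith
    then show ?case
    proof cases
      case 1
      then show ?thesis using elim \<Delta>0 by (simp add: P_def)
    next
      case 2
      then have "rep_L1 q x = 1" using elim D0 by simp
      with 2 elim have *: "rep_L1 (q - u t) x = - rep_L1 v x" by simp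
      have "\<delta> * rep_L1 v x \<le> rep_L1 \<Delta> x" using 2 elim D0 by (simp add: max_def)
      moreover have "x \<in> P" using 2 by (simp add: P_def)
      moreover have "rep_L1 (pos_part (q - u t)) x = 0" using 2 elim by simp
      ultimately show ?thesis by (simp add: *)
    next
      case 3
      then show ?thesis using elim \<Delta>0 by (simp add: P_def)
    qed
  qed
  then have "(\<integral>x. \<delta> * rep_L1 (pos_part (q - u t)) x \<partial>lborel) \<le>
      (\<integral>x. \<delta> * (rep_L1 (q - u t) x * indicator P x) + rep_L1 \<Delta> x \<partial>lborel)"
    using integrable_L1_on[OF P] by (intro integral_mono_AE) auto
  also have "\<dots> = \<delta> * L1_on P (q - u t) + L1_int \<Delta>"
    using integrable_L1_on[OF P, of "q - u t"] by (simp add: L1_on_def L1_int_def)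
  finally have 1: "\<delta> * L1_int (pos_part (q - u t)) \<le> \<delta> * L1_on P (q - u t) + L1_int \<Delta>"
    by (simp add: L1_int_def)
  \<comment> \<open>The three contributions are the error in the data, a term of favourable sign on
    \<open>P\<close>, and the cost of the shift.\<close>
  have "q - u t = (F - f) + (A z + \<delta> *\<^sub>R A v)"
    using t by (simp add: q_def u_eq z_def A_diff A_scaleR)
  then have "L1_on P (q - u t) = L1_on P (F - f) + L1_on P (A z) + \<delta> * L1_on P (A v)"
    by (simp add: P.add P.scaleR)
  moreover have "L1_on P (F - f) \<le> L1_int (pos_part (F - f))"
    unfolding L1_on_def L1_int_def
  proof (rule integral_mono_AE)
    show "AE x in lborel. rep_L1 (F - f) x * indicator P x \<le> rep_L1 (pos_part (F - f)) x"
      using AE_rep_pos_part[of "F - f"] by eventually_elim (auto split: split_indicator)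
  qed (use integrable_L1_on[OF P] in auto)
  moreover have "\<delta> * L1_on P (A v) \<le> \<delta> * (2 * norm f)"
  proof (rule mult_left_mono)
    have "L1_on P (A v) \<le> norm (A v)"
      unfolding L1_on_def norm_L1_eq
      by (rule integral_mono_AE) (use integrable_L1_on[OF P] in \<open>auto split: split_indicator\<close>)
    also have "\<dots> \<le> 2 * norm v" by (rule norm_A_le)
    also have "\<dots> \<le> 2 * norm f" using norm_v_le[OF t] by (simp add: v_def)
    finally show "L1_on P (A v) \<le> 2 * norm f" .
  qed (use \<delta> in simp)
  ultimately have 2: "L1_on P (q - u t) \<le> L1_int (pos_part (F - f)) + \<delta> * (2 * norm f)"
    using le by linarith
  have "L1_int (pos_part (q - u t)) \<le> L1_on P (q - u t) + L1_int \<Delta> / \<delta>"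
    using 1 \<delta>(1) by (simp add: field_simps)
  with 2 have 3: "L1_int (pos_part (q - u t)) \<le> L1_int (pos_part (F - f)) + \<delta> * (2 * norm f) + L1_int \<Delta> / \<delta>"
    by linarith
  \<comment> \<open>Mass conservation gives \<open>q - u t\<close> and \<open>F - f\<close> the same
    integral, so the bound on positive parts becomes a bound on norms.\<close>
  have 4: "norm (q - u t) = 2 * L1_int (pos_part (q - u t)) - L1_int (q - u t)"
    "norm (F - f) = 2 * L1_int (pos_part (F - f)) - L1_int (F - f)"
    by (simp_all only: norm_eq_pos_part[of "q - u t"] norm_eq_pos_part[of "F - f"] norm_eq_L1_int[OF pos_part_nonneg])
  have 5: "L1_int (q - u t) = L1_int (F - f)"
    using t by (simp add: q_def L1_int_diff L1_int_plus L1_int_A L1_int_u)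
  have "norm (q - u t) \<le> norm (F - f) + 4 * \<delta> * norm f + 2 / \<delta> * L1_int \<Delta>"
    using 3 unfolding 4 5 by simp
  then show ?thesis
    by (simp add: norm_minus_commute q_def \<Delta>_def L1_int_diff)
qed

text \<open>\<open>H t\<close> is the part of \<open>W\<close> not yet filled by \<open>w t\<close>.
  It is nonincreasing and bounded below, so its decrease over one unit of time becomes small while
  \<open>\<delta>\<close> stays fixed.\<close>

lemma eventually_norm_less:
  assumes W: "solves_OP J F W" and e: "0 < e"
  shows "\<forall>\<^sub>F t in at_top. norm (u t - (F + A W)) < norm (f - F) + e"
proof -
  \<comment> \<open>The first bound permits \<open>w_increment_ge\<close>, the second makes the
    shift cost at most \<open>e / 2\<close>; the decrease of \<open>H\<close> will cost at most
    \<open>e / 4\<close>.\<close>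
  define \<delta> where "\<delta> = min (1 - exp (- 1)) (e / (8 * (norm f + 1)))"
  have nf: "0 < norm f + 1" using norm_ge_zero[of f] by linarith
  have \<delta>: "0 < \<delta>" "\<delta> \<le> 1 - exp (- 1)" using e nf by (auto simp: \<delta>_def)
  have "\<delta> * (8 * (norm f + 1)) \<le> e"
    using nf by (subst pos_le_divide_eq[symmetric]) (auto simp: \<delta>_def)
  then have small: "4 * \<delta> * norm f \<le> e / 2" using \<delta>(1) by (simp add: algebra_simps)
  define H where "H t = L1_int (pos_part (W - w t))" for t
  have H0: "0 \<le> H t" for t
    unfolding H_def using norm_eq_L1_int[OF pos_part_nonneg] by (metis norm_ge_zero)
  have H_anti: "H t \<le> H s" if "0 \<le> s" "s \<le> t" for s t
    unfolding H_def
  proof (intro L1_int_mono)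
    show "pos_part (W - w t) \<le> pos_part (W - w s)"
      using w_mono[OF that] AE_rep_pos_part[of "W - w t"] AE_rep_pos_part[of "W - w s"]
        AE_rep_minus[of W "w t"] AE_rep_minus[of W "w s"]
      unfolding less_eq_L1_def by eventually_elim auto
  qed
  define I where "I = Inf (H ` {0..})"
  have bdd: "bdd_below (H ` {0..})" using H0 by (intro bdd_belowI[of _ 0]) auto
  have I: "I \<le> H t" if "0 \<le> t" for t
    unfolding I_def using bdd that by (intro cInf_lower) auto
  have "I < I + e * \<delta> / 8" using e \<delta> by simp
  then obtain T where T: "0 \<le> T" "H T < I + e * \<delta> / 8"
    unfolding I_def using cInf_lessD[of "H ` {0..}"] by fastforce
  show ?thesis
  proof (rule eventually_at_top_linorderI[of T])
    fix t assume t: "T \<le> t"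
    with T have t0: "0 \<le> t" by linarith
    have "H t - H (t + 1) \<le> e * \<delta> / 8"
      using H_anti[OF T(1) t] I[of "t + 1"] T(2) t0 by linarith
    then have "2 / \<delta> * (H t - H (t + 1)) \<le> 2 / \<delta> * (e * \<delta> / 8)"
      using \<delta>(1) by (intro mult_left_mono) auto
    also have "\<dots> = e / 4" using \<delta>(1) by simp
    finally have "2 / \<delta> * (H t - H (t + 1)) \<le> e / 4" .
    with norm_diff_stationary_le[OF W t0 \<delta>, folded H_def] small e
    show "norm (u t - (F + A W)) < norm (f - F) + e" by linarith
  qed
qed

lemma eventually_norm_OP_proj_less:
  assumes "F \<in> OP_data" "0 < e"
  shows "\<forall>\<^sub>F t in at_top. norm (u t - OP_proj J F) < norm (f - F) + e"
proof -
  obtain W where W: "solves_OP J F W" using ex_solves_OP_data[OF assms(1)] by blast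
  show ?thesis unfolding OP_proj_eq[OF W] by (rule eventually_norm_less[OF W assms(2)])
qed

text \<open>Both projections are compared with the same \<open>u t\<close> at one large time. This
  estimate takes the place of the contraction property of the projection.\<close>

lemma norm_OP_proj_diff_le:
  assumes "F \<in> OP_data" "F' \<in> OP_data"
  shows "norm (OP_proj J F - OP_proj J F') \<le> norm (f - F) + norm (f - F')"
proof (rule field_le_epsilon)
  fix e :: real assume e: "0 < e"
  have "\<forall>\<^sub>F t in at_top. norm (u t - OP_proj J F) < norm (f - F) + e / 2 \<and>
      norm (u t - OP_proj J F') < norm (f - F') + e / 2"
    using e by (intro eventually_conj eventually_norm_OP_proj_less assms) auto
  then obtain t where "norm (u t - OP_proj J F) < norm (f - F) + e / 2"
      "norm (u t - OP_proj J F') < norm (f - F') + e / 2"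
    using eventually_happens'[OF trivial_limit_at_top_linorder] by blast
  moreover have "norm (OP_proj J F - OP_proj J F') \<le> norm (u t - OP_proj J F) + norm (u t - OP_proj J F')"
    using norm_triangle_ineq4[of "u t - OP_proj J F'" "u t - OP_proj J F"] by simp
  ultimately show "norm (OP_proj J F - OP_proj J F') \<le> norm (f - F) + norm (f - F') + e"
    by simp
qed

text \<open>One approximating sequence yields a limit \<open>p\<close>; \<open>near\<close> shows
  that every other one has the same limit, so the description in \<open>mesa_proj\<close> denotes
  \<open>p\<close>. The convergence of \<open>u\<close> is then a triangle inequality through one
  close datum.\<close>

lemma tendsto_mesa_proj:
  assumes ex: "\<And>n. F0 n \<in> OP_data" "F0 \<longlonglongrightarrow> f"
  shows "(u \<longlongrightarrow> mesa_proj J f) at_top"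
proof -
  have dist0: "(\<lambda>n. norm (f - F n)) \<longlonglongrightarrow> 0" if "F \<longlonglongrightarrow> f" for F :: "nat \<Rightarrow> 'a L1"
    using tendsto_norm_zero[OF tendsto_diff[OF tendsto_const that, of f, simplified]] by simp
  have "Cauchy (\<lambda>n. OP_proj J (F0 n))"
    unfolding Cauchy_iff
  proof (intro allI impI)
    fix e :: real assume "0 < e"
    then have "0 < e / 2" by simp
    from order_tendstoD(2)[OF dist0[OF ex(2)] this]
    obtain N where N: "\<And>n. N \<le> n \<Longrightarrow> norm (f - F0 n) < e / 2"
      unfolding eventually_sequentially by blast
    have "norm (OP_proj J (F0 m) - OP_proj J (F0 n)) < e" if "N \<le> m" "N \<le> n" for m n
      using norm_OP_proj_diff_le[OF ex(1) ex(1), of m n] N[OF that(1)] N[OF that(2)] by linarith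
    then show "\<exists>M. \<forall>m\<ge>M. \<forall>n\<ge>M. norm (OP_proj J (F0 m) - OP_proj J (F0 n)) < e" by blast
  qed
  then obtain p where p: "(\<lambda>n. OP_proj J (F0 n)) \<longlonglongrightarrow> p"
    using Cauchy_convergent convergent_def by metis
  have near: "norm (p - OP_proj J F) \<le> norm (f - F)" if F: "F \<in> OP_data" for F
  proof (rule LIMSEQ_le)
    show "(\<lambda>n. norm (OP_proj J (F0 n) - OP_proj J F)) \<longlonglongrightarrow> norm (p - OP_proj J F)"
      by (intro tendsto_intros p)
    show "(\<lambda>n. norm (f - F0 n) + norm (f - F)) \<longlonglongrightarrow> norm (f - F)"
      using tendsto_add[OF dist0[OF ex(2)] tendsto_const[of "norm (f - F)"]] by simp
    show "\<exists>N. \<forall>n\<ge>N. norm (OP_proj J (F0 n) - OP_proj J F) \<le> norm (f - F0 n) + norm (f - F)"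
      using norm_OP_proj_diff_le[OF ex(1) F] by blast
  qed
  have lim: "(\<lambda>n. OP_proj J (F n)) \<longlonglongrightarrow> p" if F: "\<forall>n. F n \<in> OP_data" "F \<longlonglongrightarrow> f" for F
  proof -
    have "(\<lambda>n. OP_proj J (F n) - p) \<longlonglongrightarrow> 0"
    proof (rule Lim_null_comparison[OF always_eventually dist0[OF F(2)]])
      show "\<forall>n. norm (OP_proj J (F n) - p) \<le> norm (f - F n)"
        using near F(1) by (metis norm_minus_commute)
    qed
    then show ?thesis by (rule LIM_zero_cancel)
  qed
  have mesa: "mesa_proj J f = p"
    unfolding mesa_proj_def
  proof (rule the_equality)
    show "\<forall>F. (\<forall>n. F n \<in> OP_data) \<and> F \<longlonglongrightarrow> f \<longrightarrow> (\<lambda>n. OP_proj J (F n)) \<longlonglongrightarrow> p"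
      using lim by blast
    fix p' assume "\<forall>F. (\<forall>n. F n \<in> OP_data) \<and> F \<longlonglongrightarrow> f \<longrightarrow> (\<lambda>n. OP_proj J (F n)) \<longlonglongrightarrow> p'"
    then have "(\<lambda>n. OP_proj J (F0 n)) \<longlonglongrightarrow> p'" using ex by blast
    then show "p' = p" using p by (rule LIMSEQ_unique)
  qed
  show ?thesis
    unfolding mesa tendsto_iff dist_norm
  proof (intro allI impI)
    fix e :: real assume e: "0 < e"
    then have "0 < e / 3" by simp
    from eventually_happens'[OF sequentially_bot order_tendstoD(2)[OF dist0[OF ex(2)] this]]
    obtain n where n: "norm (f - F0 n) < e / 3" by blast
    have "\<forall>\<^sub>F t in at_top. norm (u t - OP_proj J (F0 n)) < norm (f - F0 n) + e / 3"
      using e by (intro eventually_norm_OP_proj_less ex) simp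
    then show "\<forall>\<^sub>F t in at_top. norm (u t - p) < e"
    proof eventually_elim
      case (elim t)
      have "norm (u t - p) \<le> norm (u t - OP_proj J (F0 n)) + norm (p - OP_proj J (F0 n))"
        using norm_triangle_ineq4[of "u t - OP_proj J (F0 n)" "p - OP_proj J (F0 n)"] by simp
      with elim near[OF ex(1), of n] n show ?case by linarith
    qed
  qed
qed

end

section \<open>Density of the data below Gaussian barriers\<close>

lemma integrable_gaussian:
  "integrable lborel (\<lambda>x::'a::euclidean_space. exp (- (norm x)\<^sup>2 / 2))"
proof (rule integrableI_nonneg)
  \<comment> \<open>The Gaussian factorises over the coordinates, so its integral is a product of
    finite one-dimensional ones.\<close>
  have *: "exp (- (norm x)\<^sup>2 / 2) = (\<Prod>b\<in>Basis. exp (- (x \<bullet> b)\<^sup>2 / 2))" for x :: 'a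
    unfolding power2_norm_eq_inner
    by (subst euclidean_inner)
       (simp add: exp_sum[symmetric] sum_negf power2_eq_square sum_divide_distrib)
  have 1: "(\<integral>\<^sup>+t. ennreal (exp (- t\<^sup>2 / 2)) \<partial>lborel) < \<infinity>"
  proof -
    have "integrable lborel (\<lambda>t. sqrt (2 * pi) * std_normal_density t)" by simp
    then have "integrable lborel (\<lambda>t::real. exp (- t\<^sup>2 / 2))"
      by (simp add: std_normal_density_def)
    then show ?thesis
      by (subst nn_integral_eq_integral) auto
  qed
  have "(\<integral>\<^sup>+x. ennreal (exp (- (norm (x::'a))\<^sup>2 / 2)) \<partial>lborel) =
      (\<integral>\<^sup>+x. (\<Prod>b\<in>Basis. ennreal (exp (- ((x::'a) \<bullet> b)\<^sup>2 / 2))) \<partial>lborel)"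
    unfolding * by (simp add: prod_ennreal)
  also have "\<dots> = (\<Prod>b\<in>(Basis::'a set). \<integral>\<^sup>+t. ennreal (exp (- t\<^sup>2 / 2)) \<partial>lborel)"
    by (rule nn_integral_lborel_prod) auto
  also have "\<dots> < \<infinity>" using 1 by (simp add: power_less_top_ennreal)
  finally show "(\<integral>\<^sup>+x. ennreal (exp (- (norm (x::'a))\<^sup>2 / 2)) \<partial>lborel) < \<infinity>" .
qed auto

lemma radial_barrier_gaussian:
  assumes c: "0 < c"
  shows "radial_barrier (\<lambda>x::'a::euclidean_space. c * exp (- (norm x)\<^sup>2 / 2))"
  unfolding radial_barrier_def
proof (intro conjI allI impI)
  have "filterlim (\<lambda>x::'a. 1 / 2 * (norm x)\<^sup>2) at_top at_infinity"
    by (intro filterlim_tendsto_pos_mult_at_top[OF tendsto_const] filterlim_pow_at_top filterlim_norm_at_top)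
       auto
  then have "filterlim (\<lambda>x::'a. - (1 / 2 * (norm x)\<^sup>2)) at_bot at_infinity"
    by (simp add: filterlim_uminus_at_bot)
  then have "((\<lambda>x::'a. exp (- (1 / 2 * (norm x)\<^sup>2))) \<longlongrightarrow> 0) at_infinity"
    by (rule filterlim_compose[OF exp_at_bot])
  from tendsto_mult[OF tendsto_const this, of c]
  show "((\<lambda>x::'a. c * exp (- (norm x)\<^sup>2 / 2)) \<longlongrightarrow> 0) at_infinity" by simp
  show "c * exp (- (norm y)\<^sup>2 / 2) < c * exp (- (norm x)\<^sup>2 / 2)" if "norm x < norm y" for x y :: 'a
    using c power_strict_mono[OF that, of 2] by simp
qed (use c integrable_gaussian in \<open>auto intro!: continuous_intros\<close>)

text \<open>Cut \<open>f\<close> off at \<open>n + 1\<close> times a Gaussian. The Gaussian is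
  positive everywhere, so at each point the cut-off equals \<open>f\<close> for large
  \<open>n\<close>, and \<open>f\<close> itself dominates the errors. The same cut-off serves every
  dimension.\<close>

lemma OP_data_dense:
  fixes f :: "'a::euclidean_space L1"
  assumes f: "0 \<le> f"
  obtains F where "\<And>n. F n \<in> OP_data" "F \<longlonglongrightarrow> f"
proof -
  define g where "g n x = real (Suc n) * exp (- (norm x)\<^sup>2 / 2)" for n and x :: 'a
  have g0: "0 \<le> g n x" for n x by (simp add: g_def)
  have barrier: "radial_barrier (g n)" for n
    unfolding g_def by (rule radial_barrier_gaussian) simp
  then have gi: "integrable lborel (g n)" for n by (simp add: radial_barrier_def)
  define h where "h n x = min (rep_L1 f x) (g n x)" for n x
  have hi: "integrable lborel (h n)" for n
    unfolding h_def by (rule integrable_min[OF integrable_rep_L1 gi])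
  note [measurable] = borel_measurable_integrable[OF hi, simplified]
  define F where "F n = abs_L1 (h n)" for n
  note rF = AE_rep_abs_L1[OF hi, folded F_def]
  show ?thesis
  proof
    fix n
    have "0 \<le> F n"
    proof (rule nonneg_L1_I)
      show "AE x in lborel. 0 \<le> rep_L1 (F n) x"
        using rF[of n] AE_nonneg_L1[OF f] by eventually_elim (simp add: h_def g0)
    qed
    moreover have "AE x in lborel. rep_L1 (F n) x \<le> g n x"
      using rF[of n] by eventually_elim (simp add: h_def)
    ultimately show "F n \<in> OP_data"
      using barrier[of n] by (auto simp: OP_data_def L1_nonneg_iff)
  next
    have "(\<lambda>n. \<integral>x. \<bar>h n x - rep_L1 f x\<bar> \<partial>lborel) \<longlonglongrightarrow> (\<integral>x. 0 \<partial>(lborel :: 'a measure))"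
    proof (rule integral_dominated_convergence[where w = "rep_L1 f"])
      show "AE x in lborel. (\<lambda>n. \<bar>h n x - rep_L1 f x\<bar>) \<longlonglongrightarrow> 0"
      proof (rule AE_I2, rule tendsto_eventually)
        fix x :: 'a
        let ?e = "exp (- (norm x)\<^sup>2 / 2)"
        obtain N :: nat where "rep_L1 f x / ?e < real N" using reals_Archimedean2 by blast
        then have N: "rep_L1 f x < real N * ?e" by (simp add: divide_less_eq)
        have "rep_L1 f x \<le> g n x" if "N \<le> n" for n
        proof -
          have "real N * ?e \<le> real (Suc n) * ?e" using that by (intro mult_right_mono) auto
          with N show ?thesis unfolding g_def by linarith
        qed
        then show "\<forall>\<^sub>F n in sequentially. \<bar>h n x - rep_L1 f x\<bar> = 0"
          by (intro eventually_sequentiallyI[of N]) (simp add: h_def)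
      qed
      show "AE x in lborel. norm \<bar>h n x - rep_L1 f x\<bar> \<le> rep_L1 f x" for n
        using AE_nonneg_L1[OF f]
      proof eventually_elim
        case (elim x)
        with g0[of n x] show ?case by (auto simp: h_def min_def)
      qed
    qed auto
    moreover have "norm (F n - f) = (\<integral>x. \<bar>h n x - rep_L1 f x\<bar> \<partial>lborel)" for n
      unfolding norm_L1_eq
    proof (rule integral_cong_AE)
      show "AE x in lborel. \<bar>rep_L1 (F n - f) x\<bar> = \<bar>h n x - rep_L1 f x\<bar>"
        using rF[of n] AE_rep_minus[of "F n" f] by eventually_elim simp
    qed auto
    ultimately have "(\<lambda>n. norm (F n - f)) \<longlonglongrightarrow> 0" by simp
    then show "F \<longlonglongrightarrow> f"
      by (intro LIM_zero_cancel[of F]) (rule tendsto_norm_zero_cancel)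
  qed
qed

theorem theorem5p6:
  fixes J :: "'a::euclidean_space \<Rightarrow> real"
    and f :: "'a L1"
    and u :: "real \<Rightarrow> 'a L1"
  assumes "admissible_kernel J"
    and "DIM('a) = 1 \<or> DIM('a) = 2 \<Longrightarrow> radially_nonincreasing J"
    and "L1_nonneg f"
    and "L1_solution J f u"
  shows "(u \<longlongrightarrow> mesa_proj J f) at_top"
proof -
  interpret stefan J f u
    by unfold_locales (use assms in \<open>simp_all add: L1_nonneg_iff\<close>)
  obtain F where "\<And>n. F n \<in> OP_data" "F \<longlonglongrightarrow> f"
    using OP_data_dense[OF f_nonneg] by blast
  then show ?thesis by (rule tendsto_mesa_proj)
qed

end
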